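(* Let $\mathfrak{G}$ be a subgroup of the symmetric group on $\{1,\dots,p\}$, let $\Sigma\in\mathbb{R}^{p\times p}$ be a $\mathfrak{G}$-invariant covariance matrix with spectral norm $\psi=\|\Sigma\|$, and let $\Sigma^n$ be the empirical covariance matrix formed from $n$ i.i.d. samples drawn from the Gaussian distribution $\mathcal{N}(0,\Sigma)$. Let $s_i$ and $m_i$ ($i\in\mathcal{I}$) be the block sizes and block multiplicities associated to $\mathfrak{G}$. Then for every $\delta>0$ with $\delta\le 8\psi$ and every $n\ge \max_{i\in\mathcal{I}}\frac{64\, s_i\psi^2}{m_i\delta^2}$, $$\mathbb{P}\left[\|\Sigma-\mathcal{P}_{\mathfrak{G}}(\Sigma^n)\|\ge\delta\right]\le |\mathcal{I}|\exp\left(-\frac{n\,\min_{i\in\mathcal{I}}m_i\,\delta^2}{128\,\psi^2}\right).$$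
   Context: For $g\in\mathfrak{G}$, $\Pi_g\in\mathbb{R}^{p\times p}$ is the permutation matrix of $g$. A matrix $M$ is $\mathfrak{G}$-invariant if $\Pi_g M\Pi_g^T=M$ for all $g\in\mathfrak{G}$; $\mathcal{W}_{\mathfrak{G}}\subseteq\mathbb{R}^{p\times p}$ is the subspace of all invariant matrices (fixed point subspace), and $\mathcal{P}_{\mathfrak{G}}$ is the Euclidean (Frobenius-orthogonal) projection of $\mathbb{R}^{p\times p}$ onto $\mathcal{W}_{\mathfrak{G}}$. For samples $X^{(1)},\dots,X^{(n)}$ the empirical covariance matrix is $\Sigma^n=\frac1n\sum_{k=1}^n X^{(k)}(X^{(k)})^T$. $\|\cdot\|$ is the spectral norm (largest singular value). Group parameters: let $\mathcal{I}$ index the (pairwise inequivalent) complex irreducible representations of $\mathfrak{G}$ that occur in the permutation representation $g\mapsto\Pi_g$ on $\mathbb{C}^p$ ("active" irreducibles). By Schur's lemma there is a unitary matrix $T\in\mathbb{C}^{p\times p}$ depending only on $\mathfrak{G}$ such that for every $M\in\mathcal{W}_{\mathfrak{G}}$, $T^*MT=\mathrm{diag}(M_i)_{i\in\mathcal{I}}$, where each $M_i=\mathrm{diag}(B_i,\dots,B_i)$ consists of $m_i$ identical copies of a block $B_i$ of size $s_i\times s_i$. The parameters $s_i$ (block sizes) and $m_i$ (number of repetitions of the block) are those of this decomposition; i.e. $m_i$ is the dimension of the $i$-th irreducible representation and $s_i$ the number of times it occurs in the permutation representation. (For example, for $\mathfrak{G}$ the full symmetric group: $|\mathcal{I}|=2$,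 $s_1=m_1=1$, $s_2=1$, $m_2=p-1$.) *)

theory Defs
  imports
    "HOL-Probability.Probability"
    "HOL-Algebra.Bij"
begin

section \<open>Invariant matrices\<close>

text \<open>The index set $\{1,\dots,p\}$ is an arbitrary finite type \<open>'p\<close>, so $p$ is \<open>CARD('p)\<close>;
  the symmetric group on it is \<^term>\<open>BijGroup (UNIV :: 'p set)\<close>.\<close>

text \<open>The convention is $\Pi_g e_j = e_{g(j)}$, which makes $g \mapsto \Pi_g$ a homomorphism.\<close>

definition perm_matrix :: "('p \<Rightarrow> 'p) \<Rightarrow> 'a::zero_neq_one ^ 'p ^ 'p" where
  "perm_matrix g = (\<chi> i j. if i = g j then 1 else 0)"

definition fixed_point_subspace :: "('p \<Rightarrow> 'p) set \<Rightarrow> (real ^ 'p ^ 'p) set" where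
  "fixed_point_subspace G =
     {M. \<forall>g\<in>G. perm_matrix g ** M ** transpose (perm_matrix g) = M}"

text \<open>The metric of \<^typ>\<open>real ^ 'p ^ 'p\<close> is the Frobenius metric.\<close>

definition group_projection :: "('p::finite \<Rightarrow> 'p) set \<Rightarrow> real ^ 'p ^ 'p \<Rightarrow> real ^ 'p ^ 'p" where
  "group_projection G = closest_point (fixed_point_subspace G)"


section \<open>Spectral norm\<close>

definition singular_values :: "real ^ 'n ^ 'm \<Rightarrow> real set" where
  "singular_values M =
     {\<sigma>. 0 \<le> \<sigma> \<and> (\<exists>v. v \<noteq> 0 \<and> (transpose M ** M) *v v = \<sigma>\<^sup>2 *\<^sub>R v)}"

definition spectral_norm :: "real ^ 'n ^ 'm \<Rightarrow> real" where
  "spectral_norm M = Max (singular_values M)"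


section \<open>Centred Gaussian samples\<close>

definition covariance_matrix :: "real ^ 'p ^ 'p \<Rightarrow> bool" where
  "covariance_matrix S \<longleftrightarrow> transpose S = S \<and> (\<forall>x. 0 \<le> x \<bullet> (S *v x))"

definition std_gaussian :: "(real ^ 'p) measure" where
  "std_gaussian = density lborel (\<lambda>x. ennreal (\<Prod>i\<in>UNIV. std_normal_density (x $ i)))"

text \<open>$\mathcal{N}(0, S)$ is the law of $A Z$ with $Z$ standard Gaussian and $A A^T = S$; it does
  not depend on the choice of \<open>A\<close>, and \<open>S\<close> may be singular.\<close>

definition gaussian_law :: "real ^ 'p ^ 'p \<Rightarrow> (real ^ 'p) measure \<Rightarrow> bool" where
  "gaussian_law S N \<longleftrightarrow>
     (\<exists>A :: real ^ 'p ^ 'p. A ** transpose A = S \<and> N = distr std_gaussian borel (\<lambda>z. A *v z))"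

definition empirical_covariance :: "nat \<Rightarrow> (nat \<Rightarrow> real ^ 'p) \<Rightarrow> real ^ 'p ^ 'p" where
  "empirical_covariance n x = (1 / real n) *\<^sub>R (\<Sum>k=1..n. \<chi> i j. x k $ i * x k $ j)"


section \<open>Irreducible constituents of the permutation representation\<close>

text \<open>Here \<open>vec.subspace\<close>, \<open>vec.dim\<close> and linearity with respect to \<open>(*s)\<close> are over the complex
  field. By complete reducibility, an irreducible representation occurs in the permutation
  representation iff it is equivalent to a subrepresentation, so the active irreducibles are
  taken to be equivalence classes of irreducible subrepresentations.\<close>

definition invariant_subspace :: "('p \<Rightarrow> 'p) set \<Rightarrow> (complex ^ 'p) set \<Rightarrow> bool" where
  "invariant_subspace G V \<longleftrightarrow> vec.subspace V \<and> (\<forall>g\<in>G. \<forall>v\<in>V. perm_matrix g *v v \<in> V)"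

definition irreducible_subrep :: "('p \<Rightarrow> 'p) set \<Rightarrow> (complex ^ 'p) set \<Rightarrow> bool" where
  "irreducible_subrep G V \<longleftrightarrow> invariant_subspace G V \<and> V \<noteq> {0} \<and>
     (\<forall>W. invariant_subspace G W \<and> W \<subseteq> V \<longrightarrow> W = {0} \<or> W = V)"

text \<open>The intertwiner is given as a linear map on the whole space; every linear map on a
  subspace extends to one.\<close>

definition equivalent_subreps ::
    "('p \<Rightarrow> 'p) set \<Rightarrow> (complex ^ 'p) set \<Rightarrow> (complex ^ 'p) set \<Rightarrow> bool" where
  "equivalent_subreps G V W \<longleftrightarrow>
     (\<exists>f :: complex ^ 'p \<Rightarrow> complex ^ 'p. Vector_Spaces.linear (*s) (*s) f \<and> bij_betw f V W \<and>
        (\<forall>g\<in>G. \<forall>v\<in>V. f (perm_matrix g *v v) = perm_matrix g *v f v))"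

definition active_irreps :: "('p \<Rightarrow> 'p) set \<Rightarrow> (complex ^ 'p) set set set" where
  "active_irreps G = {V. irreducible_subrep G V} //
     {(V, W). irreducible_subrep G V \<and> irreducible_subrep G W \<and> equivalent_subreps G V W}"

text \<open>\<open>D\<close> is the set of summands of a decomposition of $\mathbb{C}^p$ as an internal direct sum
  of irreducible subrepresentations; equivalent summands are distinct as subspaces.\<close>

definition irreducible_decomposition ::
    "('p \<Rightarrow> 'p) set \<Rightarrow> (complex ^ 'p) set set \<Rightarrow> bool" where
  "irreducible_decomposition G D \<longleftrightarrow> finite D \<and> (\<forall>V\<in>D. irreducible_subrep G V) \<and>
     (\<forall>v. \<exists>!f. f \<in> (\<Pi>\<^sub>E V\<in>D. V) \<and> v = (\<Sum>V\<in>D. f V))"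

text \<open>For $i \in \mathcal{I}$, \<open>irrep_dim i\<close> is the block multiplicity $m_i$ and
  \<open>irrep_mult G i\<close> is the block size $s_i$. Equivalent subrepresentations have equal
  dimension, and the number of summands in a given class is the same for all irreducible
  decompositions (Krull-Schmidt), so the choices do not matter.\<close>

definition irrep_dim :: "(complex ^ 'p::finite) set set \<Rightarrow> nat" where
  "irrep_dim i = vec.dim (SOME V. V \<in> i)"

definition irrep_mult :: "('p \<Rightarrow> 'p) set \<Rightarrow> (complex ^ 'p) set set \<Rightarrow> nat" where
  "irrep_mult G i = card (i \<inter> (SOME D. irreducible_decomposition G D))"


section \<open>The notions are well defined\<close>

text \<open>\<open>Max\<close> in \<^const>\<open>spectral_norm\<close> ranges over a finite nonempty set, irreducible
  decompositions exist, and \<^term>\<open>active_irreps G\<close> is finite and nonempty, so that maxima and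
  minima over it are meaningful.\<close>

lemma spectral_norm_eq_onorm:
  fixes M :: "real ^ 'n ^ 'm"
  shows "spectral_norm M = onorm ((*v) M)"
proof -
  let ?s = "onorm ((*v) M)"
  have bl: "bounded_linear ((*v) M)" by simp
  have le: "norm (M *v x) \<le> ?s * norm x" for x using onorm[OF bl] .
  have s0: "0 \<le> ?s" using onorm_pos_le[OF bl] .
  have gram: "((transpose M ** M) *v x) \<bullet> y = (M *v x) \<bullet> (M *v y)" for x y
    by (simp only: matrix_vector_mul_assoc[symmetric] transpose_matrix_vector dot_lmul_matrix)
  have sv_le: "\<sigma> \<le> ?s" if sv: "\<sigma> \<in> singular_values M" for \<sigma>
  proof -
    obtain v where v: "v \<noteq> 0" "(transpose M ** M) *v v = \<sigma>\<^sup>2 *\<^sub>R v" and "0 \<le> \<sigma>"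
      using sv unfolding singular_values_def by blast
    have "(norm (M *v v))\<^sup>2 = (\<sigma> * norm v)\<^sup>2"
      using gram[of v v] v(2) by (simp add: power2_norm_eq_inner power_mult_distrib)
    then have "norm (M *v v) = \<sigma> * norm v" using \<open>0 \<le> \<sigma>\<close> by (simp add: power2_eq_iff_nonneg)
    then show ?thesis using le[of v] v(1) by simp
  qed
  have fin: "finite (singular_values M)"
  proof -
    define e where "e \<sigma> = (SOME v. v \<noteq> 0 \<and> (transpose M ** M) *v v = \<sigma>\<^sup>2 *\<^sub>R v)" for \<sigma>
    have e: "e \<sigma> \<noteq> 0" "(transpose M ** M) *v e \<sigma> = \<sigma>\<^sup>2 *\<^sub>R e \<sigma>" "0 \<le> \<sigma>" if "\<sigma> \<in> singular_values M" for \<sigma>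
    proof -
      have "\<exists>v. v \<noteq> 0 \<and> (transpose M ** M) *v v = \<sigma>\<^sup>2 *\<^sub>R v"
        using that unfolding singular_values_def by blast
      from someI_ex[OF this] show "e \<sigma> \<noteq> 0" "(transpose M ** M) *v e \<sigma> = \<sigma>\<^sup>2 *\<^sub>R e \<sigma>"
        by (auto simp: e_def)
      show "0 \<le> \<sigma>" using that by (auto simp: singular_values_def)
    qed
    have orth: "e \<sigma> \<bullet> e \<tau> = 0" if "\<sigma> \<in> singular_values M" "\<tau> \<in> singular_values M" "\<sigma> \<noteq> \<tau>" for \<sigma> \<tau>
    proof -
      have "\<sigma>\<^sup>2 * (e \<sigma> \<bullet> e \<tau>) = \<tau>\<^sup>2 * (e \<sigma> \<bullet> e \<tau>)"
        using gram[of "e \<sigma>" "e \<tau>"] gram[of "e \<tau>" "e \<sigma>"] e[OF that(1)] e[OF that(2)]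
        by (simp add: inner_commute)
      moreover have "\<sigma>\<^sup>2 \<noteq> \<tau>\<^sup>2" using that e(3) by (simp add: power2_eq_iff_nonneg)
      ultimately show ?thesis by simp
    qed
    have inj: "inj_on e (singular_values M)"
      using orth e(1) by (intro inj_onI) (metis inner_eq_zero_iff)
    have "independent (e ` singular_values M)"
    proof (rule pairwise_orthogonal_independent)
      show "pairwise orthogonal (e ` singular_values M)"
        using orth by (auto simp: pairwise_def orthogonal_def)
      show "0 \<notin> e ` singular_values M" using e(1) by force
    qed
    then have "finite (e ` singular_values M)" using independent_imp_finite by blast
    then show ?thesis using inj finite_imageD by blast
  qed
  have "?s \<in> singular_values M"
  proof -
    have "compact (sphere (0 :: real^'n) 1)" by simp
    moreover have "sphere (0 :: real^'n) 1 \<noteq> {}" by simp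
    moreover have "continuous_on (sphere 0 1) (\<lambda>x. norm (M *v x))"
      by (intro continuous_on_norm linear_continuous_on bl)
    ultimately obtain v where v: "norm v = 1" and max: "\<And>x. norm x = 1 \<Longrightarrow> norm (M *v x) \<le> norm (M *v v)"
      using continuous_attains_sup[of "sphere (0 :: real^'n) 1" "\<lambda>x. norm (M *v x)"] by auto
    have "?s \<le> norm (M *v v)"
    proof (rule onorm_bound)
      fix x show "norm (M *v x) \<le> norm (M *v v) * norm x"
      proof (cases "x = 0")
        case False
        have "norm (M *v ((1 / norm x) *\<^sub>R x)) \<le> norm (M *v v)" using False by (intro max) simp
        then show ?thesis using False by (simp add: matrix_vector_mult_scaleR field_simps)
      qed simp
    qed simp
    then have eq: "norm (M *v v) = ?s" using le[of v] v by simp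
    let ?w = "(transpose M ** M) *v v"
    have "norm ?w ^ 2 \<le> norm (M *v v) * norm (M *v ?w)"
      using gram[of v ?w] norm_cauchy_schwarz[of "M *v v" "M *v ?w"] by (simp add: power2_norm_eq_inner)
    also have "\<dots> \<le> ?s * (?s * norm ?w)" unfolding eq using le[of ?w] s0 by (intro mult_left_mono)
    finally have "norm ?w * norm ?w \<le> ?s\<^sup>2 * norm ?w" by (simp add: power2_eq_square mult_ac)
    then have w: "norm ?w \<le> ?s\<^sup>2"
      by (cases "norm ?w = 0") (auto simp: mult_le_cancel_right)
    have "norm (?w - ?s\<^sup>2 *\<^sub>R v) ^ 2 = norm ?w ^ 2 - 2 * ?s\<^sup>2 * (?w \<bullet> v) + (?s\<^sup>2)\<^sup>2 * (v \<bullet> v)"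
      by (simp only: power2_norm_eq_inner inner_diff_left inner_diff_right inner_scaleR_left
          inner_scaleR_right inner_commute[of v ?w]) (simp add: algebra_simps power2_eq_square)
    also have "\<dots> = norm ?w ^ 2 - (?s\<^sup>2)\<^sup>2"
    proof -
      have "?w \<bullet> v = ?s\<^sup>2" using gram[of v v] eq by (simp add: power2_norm_eq_inner[symmetric])
      moreover have "v \<bullet> v = 1" using v by (simp add: norm_eq_1)
      ultimately show ?thesis by (simp add: power2_eq_square)
    qed
    also have "\<dots> \<le> 0" using power_mono[OF w, of 2] by simp
    finally have w_eq: "?w = ?s\<^sup>2 *\<^sub>R v" by simp
    have "v \<noteq> 0" using v by auto
    then show ?thesis using s0 w_eq unfolding singular_values_def by blast
  qed
  then show ?thesis unfolding spectral_norm_def using fin sv_le by (intro Max_eqI)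
qed

lemma perm_matrix_nth:
  fixes v :: "complex ^ 'p"
  assumes "bij g" shows "(perm_matrix g *v v) $ i = v $ (inv_into UNIV g i)"
proof -
  have "(perm_matrix g *v v) $ i = (\<Sum>j\<in>UNIV. if j = inv_into UNIV g i then v $ j else 0)"
    unfolding matrix_vector_mult_def perm_matrix_def
    using assms by (auto intro!: sum.cong simp: bij_inv_eq_iff)
  then show ?thesis by simp
qed

lemma perm_matrix_inner:
  fixes u v :: "complex ^ 'p"
  assumes "bij g" shows "(perm_matrix g *v u) \<bullet> v = u \<bullet> (perm_matrix (inv_into UNIV g) *v v)"
proof -
  have "(perm_matrix g *v u) \<bullet> v = (\<Sum>i\<in>UNIV. u $ inv_into UNIV g i \<bullet> v $ i)"
    by (simp add: inner_vec_def perm_matrix_nth assms)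
  also have "\<dots> = (\<Sum>i\<in>UNIV. u $ i \<bullet> v $ g i)"
    by (rule sum.reindex_bij_witness[of _ g "inv_into UNIV g"]) (use assms in \<open>auto simp: bij_is_surj surj_f_inv_f bij_is_inj\<close>)
  finally show ?thesis by (simp add: inner_vec_def perm_matrix_nth bij_imp_bij_inv assms inv_inv_eq)
qed

lemma subgroup_Bij:
  assumes "subgroup G (BijGroup UNIV)" "g \<in> G"
  shows "bij g" "inv_into UNIV g \<in> G"
proof -
  have g: "g \<in> Bij UNIV" using subgroup.mem_carrier[OF assms] by (simp add: BijGroup_def)
  then show "bij g" by (simp add: Bij_def)
  show "inv_into UNIV g \<in> G"
    using subgroup.m_inv_closed[OF assms] inv_BijGroup[OF g] by (simp add: restrict_UNIV)
qed

lemma invariant_orthogonal: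
  assumes G: "subgroup G (BijGroup UNIV)"
    and U: "invariant_subspace G U" and V: "invariant_subspace G V"
  shows "invariant_subspace G (V \<inter> {x. \<forall>u\<in>U. u \<bullet> x = 0})"
proof -
  have sU: "vec.subspace U" and sV: "vec.subspace V"
    using U V by (auto simp: invariant_subspace_def)
  have scale: "u \<bullet> (c *s x) = (cnj c *s u) \<bullet> x" for u x :: "complex ^ 'a" and c
    by (auto simp: inner_vec_def inner_complex_def algebra_simps intro!: sum.cong)
  have "vec.subspace (V \<inter> {x. \<forall>u\<in>U. u \<bullet> x = 0})"
    using vec.subspace_0[OF sV] vec.subspace_add[OF sV] vec.subspace_scale[OF sV] vec.subspace_scale[OF sU]
    unfolding vec.subspace_def by (auto simp: inner_add_right scale)
  moreover have "perm_matrix g *v x \<in> V \<inter> {x. \<forall>u\<in>U. u \<bullet> x = 0}"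
    if "g \<in> G" "x \<in> V" "\<forall>u\<in>U. u \<bullet> x = 0" for g x
  proof -
    have "u \<bullet> (perm_matrix g *v x) = (perm_matrix (inv_into UNIV g) *v u) \<bullet> x" for u
      using perm_matrix_inner[of "inv_into UNIV g" u x] subgroup_Bij[OF G that(1)]
      by (simp add: bij_imp_bij_inv inv_inv_eq)
    then show ?thesis using that U V subgroup_Bij[OF G that(1)] by (auto simp: invariant_subspace_def)
  qed
  ultimately show ?thesis unfolding invariant_subspace_def by blast
qed

lemma orthogonal_irreducible_decomposition:
  fixes G :: "('p::finite \<Rightarrow> 'p) set"
  assumes G: "subgroup G (BijGroup UNIV)" and "invariant_subspace G V"
  shows "\<exists>D. finite D \<and> (\<forall>W\<in>D. irreducible_subrep G W \<and> W \<subseteq> V) \<and>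
    (\<forall>A\<in>D. \<forall>B\<in>D. A \<noteq> B \<longrightarrow> (\<forall>a\<in>A. \<forall>b\<in>B. a \<bullet> b = 0)) \<and>
    (\<forall>v\<in>V. \<exists>f. (\<forall>W\<in>D. f W \<in> W) \<and> v = (\<Sum>W\<in>D. f W))"
  using assms(2)
proof (induction "vec.dim V" arbitrary: V rule: less_induct)
  case less
  have sV: "vec.subspace V" using less.prems by (simp add: invariant_subspace_def)
  show ?case
  proof (cases "V = {0}")
    case True then show ?thesis by (intro exI[of _ "{}"]) auto
  next
    case False
    let ?P = "\<lambda>U. invariant_subspace G U \<and> U \<subseteq> V \<and> U \<noteq> {0}"
    obtain U where U: "?P U" and min: "\<And>W. ?P W \<Longrightarrow> vec.dim U \<le> vec.dim W"
      using ex_has_least_nat[of ?P V vec.dim] less.prems False by blast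
    have sU: "vec.subspace U" using U by (simp add: invariant_subspace_def)
    have irr: "irreducible_subrep G U"
      unfolding irreducible_subrep_def
    proof (intro conjI allI impI)
      fix W assume W: "invariant_subspace G W \<and> W \<subseteq> U"
      show "W = {0} \<or> W = U"
      proof (cases "W = {0}")
        case False
        have sW: "vec.subspace W" using W by (simp add: invariant_subspace_def)
        have "vec.dim U \<le> vec.dim W" using min[of W] W U False by blast
        then show ?thesis using vec.subspace_dim_equal[OF sW sU] W by simp
      qed simp
    qed (use U in auto)
    define V' where "V' = V \<inter> {x. \<forall>u\<in>U. u \<bullet> x = 0}"
    have inv': "invariant_subspace G V'"
      unfolding V'_def by (rule invariant_orthogonal[OF G]) (use U less.prems in auto)
    have sV': "vec.subspace V'" using inv' by (simp add: invariant_subspace_def)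
    have "V' \<noteq> V"
    proof
      assume "V' = V"
      then have "u \<bullet> u = 0" if "u \<in> U" for u using that U unfolding V'_def by blast
      then have "U \<subseteq> {0}" by auto
      then show False using U vec.subspace_0[OF sU] by blast
    qed
    then have "vec.dim V' < vec.dim V"
      using vec.subspace_dim_equal[OF sV' sV] unfolding V'_def by fastforce
    from less.hyps[OF this inv'] obtain D where fin: "finite D"
      and D: "\<And>W. W \<in> D \<Longrightarrow> irreducible_subrep G W \<and> W \<subseteq> V'"
      and orth: "\<And>A B a b. A \<in> D \<Longrightarrow> B \<in> D \<Longrightarrow> A \<noteq> B \<Longrightarrow> a \<in> A \<Longrightarrow> b \<in> B \<Longrightarrow> a \<bullet> b = 0"
      and dec: "\<And>v. v \<in> V' \<Longrightarrow> \<exists>f. (\<forall>W\<in>D. f W \<in> W) \<and> v = (\<Sum>W\<in>D. f W)" by metis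
    have U_V': "u \<bullet> x = 0" "x \<bullet> u = 0" if "u \<in> U" "x \<in> V'" for u x
      using that by (auto simp: V'_def inner_commute)
    have UD: "U \<notin> D"
    proof
      assume "U \<in> D"
      then have "U \<subseteq> V'" using D by blast
      then have "U \<subseteq> {0}" using U_V' by (metis inner_eq_zero_iff singletonI subset_iff)
      then show False using U vec.subspace_0[OF sU] by blast
    qed
    have rsU: "subspace U"
    proof -
      have "c *\<^sub>R x = complex_of_real c *s x" for c and x :: "complex ^ 'p"
        unfolding vec_eq_iff vector_scaleR_component vector_smult_component
        by (simp only: scaleR_conv_of_real simp_thms)
      then show ?thesis using sU unfolding vec.subspace_def subspace_def by metis
    qed
    show ?thesis
    proof (intro exI[of _ "insert U D"] conjI ballI impI)
      fix v assume "v \<in> V"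
      obtain y z where yz: "y \<in> span U" "\<And>w. w \<in> span U \<Longrightarrow> orthogonal z w" "v = y + z"
        using orthogonal_subspace_decomp_exists[of U v] by metis
      have sp: "span U = U" using rsU by (simp add: span_eq_iff)
      have "z \<in> V'" unfolding V'_def
        using yz sp \<open>v \<in> V\<close> U vec.subspace_diff[OF sV, of v y] by (auto simp: orthogonal_def inner_commute)
      then obtain f where f: "\<forall>W\<in>D. f W \<in> W" "z = (\<Sum>W\<in>D. f W)" using dec by blast
      have "(\<Sum>W\<in>D. (f(U := y)) W) = (\<Sum>W\<in>D. f W)" using UD by (intro sum.cong) auto
      then show "\<exists>f. (\<forall>W\<in>insert U D. f W \<in> W) \<and> v = (\<Sum>W\<in>insert U D. f W)"
        using f yz sp UD fin by (intro exI[of _ "f(U := y)"]) auto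
    next
      show "finite (insert U D)" using fin by simp
    next
      fix W assume W: "W \<in> insert U D"
      show "irreducible_subrep G W" using W irr D by blast
      show "W \<subseteq> V" using W U D unfolding V'_def by blast
    next
      fix A B a b assume *: "A \<in> insert U D" "B \<in> insert U D" "A \<noteq> B" "a \<in> A" "b \<in> B"
      have DV: "x \<in> V'" if "W \<in> D" "x \<in> W" for W x using D that by blast
      consider "A = U" "B \<in> D" | "B = U" "A \<in> D" | "A \<in> D" "B \<in> D" using * by blast
      then show "a \<bullet> b = 0"
      proof cases
        case 1 then show ?thesis using U_V'(1) DV * by blast
      next
        case 2 then show ?thesis using U_V'(2) DV * by blast
      next
        case 3 then show ?thesis using orth * by blast
      qed
    qed
  qed
qed

lemma irreducible_decomposition_exists:
  fixes G :: "('p::finite \<Rightarrow> 'p) set"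
  assumes "subgroup G (BijGroup UNIV)"
  shows "\<exists>D. irreducible_decomposition G D"
proof -
  have "invariant_subspace G UNIV" by (simp add: invariant_subspace_def)
  from orthogonal_irreducible_decomposition[OF assms this] obtain D where fin: "finite D"
    and D: "\<And>W. W \<in> D \<Longrightarrow> irreducible_subrep G W"
    and orth: "\<And>A B a b. A \<in> D \<Longrightarrow> B \<in> D \<Longrightarrow> A \<noteq> B \<Longrightarrow> a \<in> A \<Longrightarrow> b \<in> B \<Longrightarrow> a \<bullet> b = 0"
    and dec: "\<And>v. \<exists>f. (\<forall>W\<in>D. f W \<in> W) \<and> v = (\<Sum>W\<in>D. f W)" by (metis UNIV_I)
  have "\<exists>!f. f \<in> (\<Pi>\<^sub>E W\<in>D. W) \<and> v = (\<Sum>W\<in>D. f W)" for v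
  proof (rule ex_ex1I)
    obtain f where "\<forall>W\<in>D. f W \<in> W" "v = (\<Sum>W\<in>D. f W)" using dec by blast
    then show "\<exists>f. f \<in> (\<Pi>\<^sub>E W\<in>D. W) \<and> v = (\<Sum>W\<in>D. f W)"
      by (intro exI[of _ "restrict f D"]) auto
  next
    fix f h assume f: "f \<in> (\<Pi>\<^sub>E W\<in>D. W) \<and> v = (\<Sum>W\<in>D. f W)"
      and h: "h \<in> (\<Pi>\<^sub>E W\<in>D. W) \<and> v = (\<Sum>W\<in>D. h W)"
    show "f = h"
    proof (rule PiE_ext[of f D "\<lambda>W. W" h])
      fix A assume A: "A \<in> D"
      have m: "f W - h W \<in> W" if "W \<in> D" for W
      proof -
        have "vec.subspace W" using D[OF that] by (simp add: irreducible_subrep_def invariant_subspace_def)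
        then show ?thesis using f h that by (auto intro: vec.subspace_diff)
      qed
      have "0 = (f A - h A) \<bullet> (\<Sum>W\<in>D. f W - h W)" using f h by (simp add: sum_subtractf)
      also have "\<dots> = (\<Sum>W\<in>D. (f A - h A) \<bullet> (f W - h W))" by (simp add: inner_sum_right)
      also have "\<dots> = (\<Sum>W\<in>D. if W = A then (f A - h A) \<bullet> (f A - h A) else 0)"
        using orth[OF A _ _ m[OF A] m] by (intro sum.cong) auto
      also have "\<dots> = (f A - h A) \<bullet> (f A - h A)" using fin A by simp
      finally show "f A = h A" by simp
    qed (use f h in blast)+
  qed
  then show ?thesis
    unfolding irreducible_decomposition_def using fin D by (intro exI[of _ D] conjI ballI allI)
qed

lemma equiv_equivalent_subreps:
  "equiv {V. irreducible_subrep G V}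
    {(V, W). irreducible_subrep G V \<and> irreducible_subrep G W \<and> equivalent_subreps G V W}"
proof (rule equivI)
  show "refl_on {V. irreducible_subrep G V}
    {(V, W). irreducible_subrep G V \<and> irreducible_subrep G W \<and> equivalent_subreps G V W}"
    using vec.linear_id by (auto simp: refl_on_def equivalent_subreps_def intro!: exI[of _ id])
  show "sym {(V, W). irreducible_subrep G V \<and> irreducible_subrep G W \<and> equivalent_subreps G V W}"
  proof (clarsimp simp: sym_def)
    fix V W assume V: "irreducible_subrep G V" and W: "irreducible_subrep G W" and "equivalent_subreps G V W"
    then obtain f where f: "Vector_Spaces.linear (*s) (*s) f" "bij_betw f V W"
      and eq: "\<forall>g\<in>G. \<forall>v\<in>V. f (perm_matrix g *v v) = perm_matrix g *v f v"
      unfolding equivalent_subreps_def by blast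
    have V': "vec.subspace V" "\<forall>g\<in>G. \<forall>v\<in>V. perm_matrix g *v v \<in> V"
      using V by (auto simp: irreducible_subrep_def invariant_subspace_def)
    obtain h where h: "Vector_Spaces.linear (*s) (*s) h" "\<forall>v\<in>V. h (f v) = v"
      using vec.linear_exists_left_inverse_on[OF f(1) V'(1)] f(2) by (auto simp: bij_betw_def)
    have "bij_betw h W V" 
      by (rule bij_betw_byWitness[where f' = f]) (use f(2) h(2) in \<open>auto simp: bij_betw_def\<close>)
    moreover have "h (perm_matrix g *v w) = perm_matrix g *v h w" if gw: "g \<in> G" "w \<in> W" for g w
    proof -
      obtain v where "v \<in> V" "w = f v" using f(2) gw unfolding bij_betw_def by blast
      then show ?thesis using h eq V' gw by metis
    qed
    ultimately show "equivalent_subreps G W V" unfolding equivalent_subreps_def using h(1) by blast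
  qed
  show "trans {(V, W). irreducible_subrep G V \<and> irreducible_subrep G W \<and> equivalent_subreps G V W}"
  proof (clarsimp simp: trans_def)
    fix U V W assume "equivalent_subreps G U V" "equivalent_subreps G V W"
    then obtain f h where f: "Vector_Spaces.linear (*s) (*s) f" "bij_betw f U V"
      "\<forall>g\<in>G. \<forall>v\<in>U. f (perm_matrix g *v v) = perm_matrix g *v f v"
      and h: "Vector_Spaces.linear (*s) (*s) h" "bij_betw h V W"
      "\<forall>g\<in>G. \<forall>v\<in>V. h (perm_matrix g *v v) = perm_matrix g *v h v"
      unfolding equivalent_subreps_def by blast
    have "\<forall>v\<in>U. f v \<in> V" using f(2) by (auto simp: bij_betw_def)
    then show "equivalent_subreps G U W" unfolding equivalent_subreps_def
      using Vector_Spaces.linear_compose[OF f(1) h(1)] bij_betw_trans[OF f(2) h(2)] f(3) h(3)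
      by (intro exI[of _ "h \<circ> f"]) auto
  qed
qed auto

lemma irreducible_equivalent_summand:
  assumes D: "irreducible_decomposition G D" and W: "irreducible_subrep G W"
  shows "\<exists>V\<in>D. equivalent_subreps G W V"
proof -
  have irr: "irreducible_subrep G V" if "V \<in> D" for V
    using D that by (simp add: irreducible_decomposition_def)
  have sub: "vec.subspace V" "\<And>g v. g \<in> G \<Longrightarrow> v \<in> V \<Longrightarrow> perm_matrix g *v v \<in> V"
    if "irreducible_subrep G V" for V
    using that by (auto simp: irreducible_subrep_def invariant_subspace_def)
  define c where "c v = (THE f. f \<in> (\<Pi>\<^sub>E V\<in>D. V) \<and> v = (\<Sum>V\<in>D. f V))" for v
  have ex1: "\<exists>!f. f \<in> (\<Pi>\<^sub>E V\<in>D. V) \<and> v = (\<Sum>V\<in>D. f V)" for v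
    using D by (simp add: irreducible_decomposition_def)
  have c: "c v \<in> (\<Pi>\<^sub>E V\<in>D. V)" "v = (\<Sum>V\<in>D. c v V)" for v
    using theI'[OF ex1[of v]] by (auto simp: c_def)
  have cV: "c v V \<in> V" if "V \<in> D" for v V using c(1) that by auto
  have c_eq: "c v V = f V" if "V \<in> D" "\<And>V. V \<in> D \<Longrightarrow> f V \<in> V" "v = (\<Sum>V\<in>D. f V)" for f v V
  proof -
    have "c v = restrict f D"
    proof (rule ex1E[OF ex1[of v]])
      fix k assume k: "\<forall>y. y \<in> (\<Pi>\<^sub>E V\<in>D. V) \<and> v = (\<Sum>V\<in>D. y V) \<longrightarrow> y = k"
      have "restrict f D \<in> (\<Pi>\<^sub>E V\<in>D. V)" using that(2) by auto
      moreover have "(\<Sum>V\<in>D. restrict f D V) = v" unfolding that(3) by (rule sum.cong) auto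
      ultimately have "restrict f D = k" using k by metis
      moreover have "c v = k" using k c[of v] by blast
      ultimately show ?thesis by simp
    qed
    then show ?thesis using that by simp
  qed
  have lin: "Vector_Spaces.linear (*s) (*s) (\<lambda>v. c v V)" if "V \<in> D" for V
  proof (intro Vector_Spaces.linear_iff[THEN iffD2] conjI allI vec.vector_space_axioms)
    fix u v :: "complex ^ 'a" and r
    show "c (u + v) V = c u V + c v V"
      by (rule c_eq[OF that, of "\<lambda>V. c u V + c v V"])
        (use cV irr sub in \<open>auto simp: sum.distrib intro!: vec.subspace_add simp flip: c(2)\<close>)
    show "c (r *s v) V = r *s c v V"
      by (rule c_eq[OF that, of "\<lambda>V. r *s c v V"])
        (use cV irr sub in \<open>auto intro!: vec.subspace_scale simp flip: vec.scale_sum_right c(2)\<close>)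
  qed
  have equi: "c (perm_matrix g *v v) V = perm_matrix g *v c v V" if "V \<in> D" "g \<in> G" for g v V
    by (rule c_eq[OF that(1), of "\<lambda>V. perm_matrix g *v c v V"])
      (use cV irr sub that in \<open>auto simp flip: vec.linear_sum[OF matrix_vector_mul_linear_gen] c(2)\<close>)
  obtain w where w: "w \<in> W" "w \<noteq> 0"
    using W vec.subspace_0[OF sub(1)[OF W]] by (auto simp: irreducible_subrep_def)
  then obtain V where V: "V \<in> D" "c w V \<noteq> 0" using c(2)[of w] sum.neutral[of D "c w"] by metis
  let ?f = "\<lambda>v. c v V"
  note lin = lin[OF V(1)]
  have "vec.subspace {v \<in> W. ?f v = 0}"
    using sub(1)[OF W] lin unfolding vec.subspace_def Vector_Spaces.linear_iff
    by (auto simp: vec.linear_0[OF lin])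
  then have "invariant_subspace G {v \<in> W. ?f v = 0}"
    unfolding invariant_subspace_def using sub(2)[OF W] equi[OF V(1)] by auto
  then have "{v \<in> W. ?f v = 0} = {0} \<or> {v \<in> W. ?f v = 0} = W"
    using W unfolding irreducible_subrep_def by blast
  then have ker: "{v \<in> W. ?f v = 0} = {0}" using w V by auto
  have inj: "inj_on ?f W"
  proof (rule inj_onI)
    fix u v assume uv: "u \<in> W" "v \<in> W" "?f u = ?f v"
    then have "u - v \<in> {v \<in> W. ?f v = 0}"
      using vec.subspace_diff[OF sub(1)[OF W]] vec.linear_diff[OF lin] by simp
    then show "u = v" using ker by simp
  qed
  have "invariant_subspace G (?f ` W)"
    unfolding invariant_subspace_def
    using vec.linear_subspace_image[OF lin sub(1)[OF W]] sub(2)[OF W] equi[OF V(1)]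
    by (auto simp flip: equi[OF V(1)])
  moreover have "?f ` W \<subseteq> V" using cV[OF V(1)] by auto
  moreover have "?f ` W \<noteq> {0}" using w V by auto
  ultimately have "?f ` W = V" using irr[OF V(1)] unfolding irreducible_subrep_def by blast
  then show ?thesis
    unfolding equivalent_subreps_def bij_betw_def using V(1) lin inj equi by blast
qed

lemma active_irreps_finite_nonempty:
  fixes G :: "('p::finite \<Rightarrow> 'p) set"
  assumes "subgroup G (BijGroup UNIV)"
  shows "finite (active_irreps G)" "active_irreps G \<noteq> {}"
proof -
  obtain D where D: "irreducible_decomposition G D"
    using irreducible_decomposition_exists[OF assms] by blast
  let ?R = "{(V, W). irreducible_subrep G V \<and> irreducible_subrep G W \<and> equivalent_subreps G V W}"
  have "active_irreps G \<subseteq> (\<lambda>V. ?R `` {V}) ` D"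
  proof
    fix i assume "i \<in> active_irreps G"
    then obtain W where W: "irreducible_subrep G W" "i = ?R `` {W}"
      unfolding active_irreps_def by (auto elim: quotientE)
    obtain V where "V \<in> D" "equivalent_subreps G W V"
      using irreducible_equivalent_summand[OF D W(1)] by blast
    moreover from this have "(W, V) \<in> ?R" using D W by (auto simp: irreducible_decomposition_def)
    ultimately show "i \<in> (\<lambda>V. ?R `` {V}) ` D"
      using equiv_class_eq[OF equiv_equivalent_subreps] W(2) by blast
  qed
  then show "finite (active_irreps G)"
    using D finite_surj by (auto simp: irreducible_decomposition_def)
  have "D \<noteq> {}"
  proof
    assume "D = {}"
    then have "(1 :: complex ^ 'p) = 0" using D by (auto simp: irreducible_decomposition_def)
    then show False by (simp add: vec_eq_iff)
  qed
  then obtain V where "irreducible_subrep G V" using D by (auto simp: irreducible_decomposition_def)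
  then show "active_irreps G \<noteq> {}" unfolding active_irreps_def quotient_def by blast
qed

end

theory Submission
  imports Defs "HOL-Computational_Algebra.Fundamental_Theorem_Algebra"
begin

text \<open>
  The deviation $E = \mathcal{P}_G(\Sigma^n) - \Sigma$ is a symmetric invariant matrix, so its norm is the
  modulus of an eigenvalue whose eigenspace is invariant under the group and contains a real irreducible
  representation. The proof bounds, for each member \<open>U\<close> of a finite family of real
  irreducible representations, the probability that this norm is at least $\delta$ and that the eigenspace
  contains a copy of \<open>U\<close>. It works with real representations throughout, because the Gaussian vectors are
  real: for a representation of real type a net in the sphere of a complex multiplicity space would have
  twice the dimension that the exponent pays for.

  Fix a nonzero $u \in U$ and let \<open>H\<close> be its orbit under the commutant of the representation. The
  copies of \<open>U\<close> are swept out by \<open>H\<close>: every nonzero $y \in H$ lies in an irreducible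
  representation \<open>Y\<close> with $\dim Y = \dim U$. For a unit vector \<open>y\<close> Schur's lemma for symmetric
  operators gives
  $\langle y, \mathcal{P}_G(\Sigma^n)\, y\rangle = \frac{1}{n \dim Y} \sum_k |P_Y X^{(k)}|^2$, where $P_Y X^{(k)}$
  is isotropic on \<open>Y\<close> with variance $\langle y, \Sigma y\rangle \le \psi$. So the quadratic form of \<open>E\<close> at
  \<open>y\<close> is a centred and scaled chi-squared variable with $K = n \dim U$ degrees of freedom
  (\<open>projected_empirical_quadratic_form\<close>, \<open>projected_gaussian_tail\<close>).

  The eigenvector can be chosen in \<open>H\<close>, and a net of the unit sphere of \<open>H\<close> for the distance
  $1/3$, which has at most $7^{\dim H}$ points, contains a point at which the form is almost as large as the
  eigenvalue (\<open>sphere_net_exists\<close>, \<open>quadratic_form_near_eigenvector\<close>). With $\tau = \delta / (8 \psi)$ the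
  hypothesis on \<open>n\<close> gives $\dim H \le K \tau^2$, and the chi-squared exponents leave enough room to pay for
  the net and still obtain $\exp(- K \tau^2 / 2)$ with constant one. Deviations up to $\psi$ are treated on
  both sides; beyond $\psi$ only positive eigenvalues occur, since $E \ge - \Sigma$ on \<open>H\<close>
  (\<open>irreducible_deviation_bound\<close>).

  It remains to compare \<open>U\<close> with the complex parameters. The complexification of \<open>U\<close> contains an
  active irreducible \<open>V\<close> in a class \<open>i\<close>, and it is either \<open>V\<close> or the sum of \<open>V\<close> and its
  conjugate. Schur's lemma over the complex numbers bounds the complex commutant orbit of a vector of \<open>V\<close>
  by $s_i$, and in both cases $\dim H \cdot m_i \le s_i \dim U$ and $m_i \le \dim U$
  (\<open>commutant_orbit_dim_le\<close>). Two real irreducibles that share a class are linked by a nonzero real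
  intertwiner (\<open>shared_constituent_intertwiner\<close>), so one choice of \<open>U\<close> for each class suffices and
  the union bound has at most $|\mathcal{I}|$ terms.
\<close>

section \<open>Orthogonal projections and eigenvectors\<close>

definition orth_proj :: "'a::euclidean_space set \<Rightarrow> 'a \<Rightarrow> 'a" where
  "orth_proj S x = (SOME y. y \<in> S \<and> (\<forall>w\<in>S. (x - y) \<bullet> w = 0))"

lemma orth_proj:
  assumes "subspace S"
  shows orth_proj_in: "orth_proj S x \<in> S"
    and orth_proj_orth: "w \<in> S \<Longrightarrow> (x - orth_proj S x) \<bullet> w = 0"
proof -
  obtain y z where "y \<in> span S" "\<And>w. w \<in> span S \<Longrightarrow> orthogonal z w" "x = y + z"
    using orthogonal_subspace_decomp_exists by blast
  then have "\<exists>y. y \<in> S \<and> (\<forall>w\<in>S. (x - y) \<bullet> w = 0)"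
    using assms by (intro exI[of _ y]) (auto simp: orthogonal_def span_eq_iff[THEN iffD2])
  from someI_ex[OF this]
  show "orth_proj S x \<in> S" "w \<in> S \<Longrightarrow> (x - orth_proj S x) \<bullet> w = 0"
    unfolding orth_proj_def by auto
qed

lemma orth_proj_unique:
  assumes S: "subspace S" and y: "y \<in> S" "\<And>w. w \<in> S \<Longrightarrow> (x - y) \<bullet> w = 0"
  shows "orth_proj S x = y"
proof -
  have m: "orth_proj S x - y \<in> S" using subspace_diff[OF S orth_proj_in[OF S] y(1)] .
  have "(orth_proj S x - y) \<bullet> (orth_proj S x - y)
      = (x - y) \<bullet> (orth_proj S x - y) - (x - orth_proj S x) \<bullet> (orth_proj S x - y)"
    by (simp add: inner_diff_left)
  also have "\<dots> = 0" using y(2)[OF m] orth_proj_orth[OF S m] by simp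
  finally show ?thesis by simp
qed

lemma orth_proj_id: "subspace S \<Longrightarrow> x \<in> S \<Longrightarrow> orth_proj S x = x"
  by (rule orth_proj_unique) auto

text \<open>A linear map that preserves both a subspace and its orthogonal complement preserves the
  orthogonal decomposition of every vector.\<close>

lemma orth_proj_commute:
  assumes S: "subspace S" and T: "linear T"
    and TS: "\<And>x. x \<in> S \<Longrightarrow> T x \<in> S"
    and TO: "\<And>x w. (\<And>w. w \<in> S \<Longrightarrow> x \<bullet> w = 0) \<Longrightarrow> w \<in> S \<Longrightarrow> T x \<bullet> w = 0"
  shows "orth_proj S (T x) = T (orth_proj S x)"
proof (rule orth_proj_unique[OF S TS[OF orth_proj_in[OF S]]])
  fix w assume "w \<in> S"
  then have "T (x - orth_proj S x) \<bullet> w = 0" by (intro TO orth_proj_orth[OF S])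
  then show "(T x - T (orth_proj S x)) \<bullet> w = 0" by (simp add: linear_diff[OF T])
qed

lemma linear_orth_proj:
  assumes S: "subspace S" shows "linear (orth_proj S)"
proof (rule linearI)
  fix x y :: 'a and c :: real
  show "orth_proj S (x + y) = orth_proj S x + orth_proj S y"
  proof (rule orth_proj_unique[OF S subspace_add[OF S orth_proj_in[OF S] orth_proj_in[OF S]]])
    fix w assume "w \<in> S"
    then show "(x + y - (orth_proj S x + orth_proj S y)) \<bullet> w = 0"
      using orth_proj_orth[OF S, of w x] orth_proj_orth[OF S, of w y]
      by (simp add: inner_diff_left inner_add_left)
  qed
  show "orth_proj S (c *\<^sub>R x) = c *\<^sub>R orth_proj S x"
  proof (rule orth_proj_unique[OF S subspace_scale[OF S orth_proj_in[OF S]]])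
    fix w assume "w \<in> S"
    then show "(c *\<^sub>R x - c *\<^sub>R orth_proj S x) \<bullet> w = 0"
      using orth_proj_orth[OF S, of w x] by (simp add: inner_diff_left)
  qed
qed

lemma borel_measurable_orth_proj:
  "subspace S \<Longrightarrow> orth_proj S \<in> borel_measurable borel"
  using linear_orth_proj[of S]
  by (intro borel_measurable_continuous_onI linear_continuous_on) (simp add: linear_conv_bounded_linear)

lemma orth_proj_symmetric:
  assumes S: "subspace S" shows "orth_proj S x \<bullet> y = x \<bullet> orth_proj S y"
  using orth_proj_orth[OF S orth_proj_in[OF S], of x y] orth_proj_orth[OF S orth_proj_in[OF S], of y x]
  by (simp add: inner_diff_left) (metis inner_commute)

text \<open>The maximum of the Rayleigh quotient over a subspace is an eigenvalue: at a maximiser \<open>x\<close>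
  the form \<open>l |z|\<^sup>2 - z \<bullet> f z\<close> is nonnegative and vanishes at \<open>x\<close>, so its gradient vanishes there.\<close>

lemma symmetric_max_eigenvector:
  fixes f :: "'a::euclidean_space \<Rightarrow> 'a"
  assumes f: "linear f" and sym: "\<And>x y. f x \<bullet> y = x \<bullet> f y"
    and S: "subspace S" and fS: "\<And>x. x \<in> S \<Longrightarrow> f x \<in> S" and S0: "S \<noteq> {0}"
  obtains x l where "x \<in> S" "norm x = 1" "f x = l *\<^sub>R x" "\<And>z. z \<in> S \<Longrightarrow> z \<bullet> f z \<le> l * (z \<bullet> z)"
proof -
  let ?K = "sphere 0 1 \<inter> S"
  obtain s where s: "s \<in> S" "s \<noteq> 0" using S0 subspace_0[OF S] by blast
  have "compact ?K" by (intro compact_Int_closed closed_subspace S) simp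
  moreover have "(1 / norm s) *\<^sub>R s \<in> ?K" using s subspace_scale[OF S] by auto
  then have "?K \<noteq> {}" by blast
  moreover have "continuous_on ?K (\<lambda>x. x \<bullet> f x)"
    by (intro continuous_on_inner linear_continuous_on continuous_on_id)
       (use f linear_conv_bounded_linear in auto)
  ultimately obtain x where x: "x \<in> ?K" and max: "\<And>y. y \<in> ?K \<Longrightarrow> y \<bullet> f y \<le> x \<bullet> f x"
    using continuous_attains_sup[of ?K "\<lambda>x. x \<bullet> f x"] by metis
  define l where "l = x \<bullet> f x"
  have xx: "x \<bullet> x = 1" using x by (simp add: norm_eq_1)
  have le: "z \<bullet> f z \<le> l * (z \<bullet> z)" if "z \<in> S" for z
  proof (cases "z = 0")
    case False
    have "(1 / norm z) *\<^sub>R z \<in> ?K" using False that subspace_scale[OF S] by auto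
    from max[OF this] have "(z \<bullet> f z) / (norm z)\<^sup>2 \<le> l"
      by (simp add: linear_scale[OF f] l_def power2_eq_square divide_simps)
    then show ?thesis using False by (simp add: field_simps power2_norm_eq_inner)
  qed simp
  define r where "r = f x - l *\<^sub>R x"
  have rS: "r \<in> S" unfolding r_def using x fS S by (auto intro: subspace_diff subspace_scale)
  have "r \<bullet> x = 0" unfolding r_def by (simp add: inner_diff_left xx l_def inner_commute[of "f x"])
  then have rx: "r \<bullet> r = r \<bullet> f x" unfolding r_def by (simp add: inner_diff_right)
  have key: "2 * t * (r \<bullet> r) \<le> t\<^sup>2 * (l * (r \<bullet> r) - r \<bullet> f r)" for t
  proof -
    have "x + t *\<^sub>R r \<in> S" using x rS S by (auto intro: subspace_add subspace_scale)
    from le[OF this] have "l + 2 * t * (r \<bullet> f x) + t\<^sup>2 * (r \<bullet> f r) \<le> l * (1 + t\<^sup>2 * (r \<bullet> r))"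
      using \<open>r \<bullet> x = 0\<close> sym[of x r]
      by (simp add: linear_add[OF f] linear_scale[OF f] inner_add_left inner_add_right xx
          inner_commute[of x r] inner_commute[of "f x" r] power2_eq_square algebra_simps flip: l_def)
    then show ?thesis using rx by (simp add: algebra_simps)
  qed
  have "r \<bullet> r = 0"
  proof (rule ccontr)
    assume "r \<bullet> r \<noteq> 0"
    then have pos: "0 < r \<bullet> r" by simp
    define c where "c = l * (r \<bullet> r) - r \<bullet> f r"
    define t where "t = (r \<bullet> r) / (\<bar>c\<bar> + 1)"
    have t: "0 < t" using pos by (simp add: t_def)
    have "t * c \<le> t * (\<bar>c\<bar> + 1)" using t by (intro mult_left_mono) auto
    also have "\<dots> = r \<bullet> r" unfolding t_def by (simp add: field_simps)
    finally have "t * (t * c) \<le> t * (r \<bullet> r)" using t by (intro mult_left_mono) auto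
    then show False using key[of t] t pos mult_pos_pos[OF t pos]
      by (simp add: power2_eq_square c_def[symmetric] mult.assoc)
  qed
  then have "f x = l *\<^sub>R x" by (simp add: r_def)
  then show ?thesis using that[of x l] x le by auto
qed

lemma symmetric_inner:
  fixes E :: "real ^ 'p ^ 'p"
  assumes "transpose E = E" shows "(E *v x) \<bullet> y = x \<bullet> (E *v y)"
  by (metis assms dot_lmul_matrix transpose_matrix_vector)

lemma quadratic_form_le_spectral_norm:
  fixes E :: "real ^ 'p ^ 'p"
  shows "\<bar>x \<bullet> (E *v x)\<bar> \<le> spectral_norm E * (x \<bullet> x)"
proof -
  have "\<bar>x \<bullet> (E *v x)\<bar> \<le> norm x * norm (E *v x)" by (rule Cauchy_Schwarz_ineq2)
  also have "\<dots> \<le> norm x * (spectral_norm E * norm x)"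
    unfolding spectral_norm_eq_onorm by (intro mult_left_mono onorm) auto
  finally show ?thesis by (simp add: power2_norm_eq_inner[symmetric] power2_eq_square algebra_simps)
qed

text \<open>The largest eigenvalue of \<open>E\<^sup>2\<close> is the square of the norm, and \<open>E\<^sup>2 - s\<^sup>2 = (E - s)(E + s)\<close>
  turns an eigenvector of \<open>E\<^sup>2\<close> into one of \<open>E\<close> for \<open>s\<close> or \<open>- s\<close>.\<close>

lemma symmetric_spectral_eigenvalue:
  fixes E :: "real ^ 'p ^ 'p"
  assumes sym: "transpose E = E"
  obtains x l where "x \<noteq> 0" "E *v x = l *\<^sub>R x" "\<bar>l\<bar> = spectral_norm E"
proof -
  have ne: "(UNIV :: (real ^ 'p) set) \<noteq> {0}"
    using UNIV_I[of "axis undefined 1 :: real ^ 'p"] by (metis axis_eq_0_iff singletonD zero_neq_one)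
  obtain x m where x: "norm x = 1" "E *v (E *v x) = m *\<^sub>R x"
    and max: "\<And>z. z \<bullet> (E *v (E *v z)) \<le> m * (z \<bullet> z)"
    by (rule symmetric_max_eigenvector[of "\<lambda>x. E *v (E *v x)" UNIV])
       (use ne in \<open>auto simp: symmetric_inner[OF sym] linear_compose[unfolded o_def]\<close>)
  define s where "s = norm (E *v x)"
  have "s\<^sup>2 = m"
    using x symmetric_inner[OF sym, of x "E *v x"]
    by (simp add: s_def power2_norm_eq_inner norm_eq_1)
  have "norm (E *v z) \<le> s * norm z" for z
  proof -
    have "(norm (E *v z))\<^sup>2 \<le> (s * norm z)\<^sup>2"
      using max[of z] \<open>s\<^sup>2 = m\<close> symmetric_inner[OF sym, of z "E *v z"]
      by (simp add: power_mult_distrib power2_norm_eq_inner)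
    then show ?thesis by (rule power2_le_imp_le) (simp add: s_def)
  qed
  then have "spectral_norm E \<le> s" unfolding spectral_norm_eq_onorm by (rule onorm_bound[rotated]) (simp add: s_def)
  moreover have "s \<le> spectral_norm E"
    unfolding spectral_norm_eq_onorm s_def using onorm[of "(*v) E" x] x by simp
  ultimately have s: "s = spectral_norm E" by simp
  have s0: "0 \<le> s" by (simp add: s_def)
  show ?thesis
  proof (cases "E *v x + s *\<^sub>R x = 0")
    case True
    then have "E *v x = (- s) *\<^sub>R x" by (simp add: add_eq_0_iff2)
    then show ?thesis using that[of x "- s"] x(1) s s0 by fastforce
  next
    case False
    have "E *v (E *v x + s *\<^sub>R x) = s *\<^sub>R (E *v x + s *\<^sub>R x)"
      using x(2) \<open>s\<^sup>2 = m\<close>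
      by (simp add: matrix_vector_right_distrib matrix_vector_mult_scaleR scaleR_add_right power2_eq_square)
    then show ?thesis using that[OF False] s s0 by fastforce
  qed
qed

section \<open>The matrix of an orthogonal projection\<close>

definition proj_matrix :: "(real ^ 'p) set \<Rightarrow> real ^ 'p ^ 'p" where
  "proj_matrix S = matrix (orth_proj S)"

lemma proj_matrix_vector: "subspace S \<Longrightarrow> proj_matrix S *v x = orth_proj S x"
  unfolding proj_matrix_def by (simp add: linear_orth_proj)

lemma transpose_proj_matrix:
  assumes "subspace S" shows "transpose (proj_matrix S) = proj_matrix S"
proof -
  have "x v* proj_matrix S = proj_matrix S *v x" for x
    by (rule vector_eq_ldot[THEN iffD1])
       (metis assms dot_lmul_matrix inner_commute orth_proj_symmetric proj_matrix_vector)
  then show ?thesis by (simp add: matrix_eq)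
qed

lemma proj_matrix_idem:
  assumes "subspace S" shows "proj_matrix S ** proj_matrix S = proj_matrix S"
  by (simp add: matrix_eq assms proj_matrix_vector orth_proj_id orth_proj_in flip: matrix_vector_mul_assoc)

text \<open>Lets a Gram matrix that happens to be a projection be treated as one, without knowing its range
  in advance.\<close>

lemma proj_matrix_of_idempotent:
  fixes Q :: "real ^ 'p ^ 'p"
  assumes sym: "transpose Q = Q" and idem: "Q ** Q = Q"
  shows "Q = proj_matrix (range ((*v) Q))"
proof -
  have S: "subspace (range ((*v) Q))" by (intro linear_subspace_image) auto
  have "Q *v x = orth_proj (range ((*v) Q)) x" for x
  proof (rule orth_proj_unique[OF S, symmetric])
    fix w assume "w \<in> range ((*v) Q)"
    then obtain y where "w = Q *v y" by blast
    then show "(x - Q *v x) \<bullet> w = 0"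
      by (simp add: symmetric_inner[OF sym, symmetric] matrix_vector_mult_diff_distrib
          matrix_vector_mul_assoc idem)
  qed simp
  then show ?thesis unfolding matrix_eq proj_matrix_vector[OF S] by blast
qed

text \<open>An orthonormal basis of \<open>S\<close> together with one of its orthogonal complement diagonalises
  the projection.\<close>

lemma proj_matrix_diagonalisation:
  fixes S :: "(real ^ 'p) set"
  assumes S: "subspace S"
  obtains R :: "real ^ 'p ^ 'p" and J :: "'p set"
  where "orthogonal_matrix R" "card J = dim S"
    "proj_matrix S ** R = R ** (\<chi> i j. if i = j \<and> i \<in> J then 1 else 0)"
proof -
  let ?C = "{x. \<forall>y\<in>S. orthogonal y x}"
  have C: "subspace ?C" by (rule subspace_orthogonal_to_vectors)
  obtain A where A: "A \<subseteq> S" "pairwise orthogonal A" "\<And>x. x \<in> A \<Longrightarrow> norm x = 1"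
    "independent A" "card A = dim S" "span A = S"
    by (rule orthonormal_basis_subspace[OF S], rule that)
  obtain B where B: "B \<subseteq> ?C" "pairwise orthogonal B" "\<And>x. x \<in> B \<Longrightarrow> norm x = 1"
    "span B = ?C"
    by (rule orthonormal_basis_subspace[OF C], rule that)
  have AB: "orthogonal a b" if "a \<in> A" "b \<in> B" for a b using A(1) B(1) that by blast
  have norm1: "norm x = 1" if "x \<in> A \<union> B" for x using A(3) B(3) that by blast
  have orth: "pairwise orthogonal (A \<union> B)"
    using A(2) B(2) AB unfolding pairwise_def by (metis UnE orthogonal_commute)
  have "0 \<notin> A \<union> B" using norm1 by force
  then have ind: "independent (A \<union> B)" using orth pairwise_orthogonal_independent by blast
  have "x \<in> span (A \<union> B)" for x :: "real ^ 'p"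
  proof -
    have "orth_proj S x \<in> span (A \<union> B)"
      using orth_proj_in[OF S] A(6) span_mono[of A "A \<union> B"] by blast
    moreover have "x - orth_proj S x \<in> ?C"
      using orth_proj_orth[OF S] by (auto simp: orthogonal_def inner_commute)
    then have "x - orth_proj S x \<in> span (A \<union> B)" using B(4) span_mono[of B "A \<union> B"] by blast
    ultimately show ?thesis by (metis diff_add_cancel span_add)
  qed
  then have "span (A \<union> B) = UNIV" by blast
  then have "card (A \<union> B) = dim (UNIV :: (real ^ 'p) set)"
    using dim_eq_card_independent[OF ind] dim_span[of "A \<union> B"] by simp
  then have "card (A \<union> B) = CARD('p)" by simp
  moreover have fin: "finite (A \<union> B)" using ind independent_imp_finite by blast
  ultimately obtain e where e: "bij_betw e (UNIV :: 'p set) (A \<union> B)"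
    using finite_same_card_bij[of "UNIV :: 'p set" "A \<union> B"] by auto
  have eAB: "e j \<in> A \<union> B" for j using e by (auto simp: bij_betw_def)
  define R :: "real ^ 'p ^ 'p" where "R = (\<chi> i j. e j $ i)"
  define J where "J = {j. e j \<in> A}"
  have col: "column j R = e j" for j by (simp add: R_def column_def vec_eq_iff)
  have "orthogonal_matrix R"
    unfolding orthogonal_matrix_orthonormal_columns col
  proof (intro conjI allI impI)
    show "norm (e i) = 1" for i using norm1 eAB by blast
    fix i j :: 'p assume "i \<noteq> j"
    then have "e i \<noteq> e j" using e by (auto simp: bij_betw_def inj_eq)
    then show "orthogonal (e i) (e j)" using orth eAB unfolding pairwise_def by blast
  qed
  moreover have "card J = dim S"
  proof -
    have "e ` J = A" unfolding J_def using e by (auto simp: bij_betw_def)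
    moreover have "inj_on e J" using e unfolding bij_betw_def by (meson inj_on_subset subset_UNIV)
    ultimately show ?thesis using A(5) card_image by metis
  qed
  moreover have "proj_matrix S ** R = R ** (\<chi> i j. if i = j \<and> i \<in> J then 1 else 0)"
  proof -
    have Pe: "orth_proj S (e j) = (if j \<in> J then e j else 0)" for j
    proof (cases "j \<in> J")
      case True
      then show ?thesis using A(1) by (auto simp: J_def intro: orth_proj_id[OF S])
    next
      case False
      then have "e j \<in> ?C" using eAB[of j] B(1) by (auto simp: J_def)
      then have "orth_proj S (e j) = 0"
        by (intro orth_proj_unique[OF S]) (auto simp: orthogonal_def inner_commute subspace_0[OF S])
      with False show ?thesis by simp
    qed
    have "column j (proj_matrix S ** R) = column j (R ** (\<chi> i j. if i = j \<and> i \<in> J then 1 else 0))" for j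
    proof -
      have "column j (proj_matrix S ** R) = proj_matrix S *v column j R"
        by (simp add: column_def matrix_matrix_mult_def matrix_vector_mult_def vec_eq_iff)
      also have "\<dots> = (if j \<in> J then e j else 0)" by (simp add: col proj_matrix_vector[OF S] Pe)
      also have "\<dots> = column j (R ** (\<chi> i j. if i = j \<and> i \<in> J then 1 else 0))"
      proof (cases "j \<in> J")
        case True
        then have "(\<Sum>k\<in>UNIV. e k $ i * (if k = j \<and> k \<in> J then 1 else 0))
            = (\<Sum>k\<in>UNIV. if k = j then e k $ i else 0)" for i by (intro sum.cong) auto
        with True show ?thesis by (simp add: column_def matrix_matrix_mult_def vec_eq_iff R_def)
      next
        case False
        then have "(\<Sum>k\<in>UNIV. e k $ i * (if k = j \<and> k \<in> J then 1 else 0)) = 0" for i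
          by (intro sum.neutral) auto
        with False show ?thesis by (simp add: column_def matrix_matrix_mult_def vec_eq_iff R_def)
      qed
      finally show ?thesis .
    qed
    then show ?thesis by (auto simp: column_def vec_eq_iff)
  qed
  ultimately show ?thesis using that by blast
qed

lemma coordinate_projection_nth:
  fixes x :: "real ^ 'p"
  shows "((\<chi> i j. if i = j \<and> i \<in> J then 1 else 0) *v x) $ i = (if i \<in> J then x $ i else 0)"
proof -
  have "((\<chi> i j. if i = j \<and> i \<in> J then 1 else 0) *v x) $ i
      = (\<Sum>j\<in>UNIV. (if i = j \<and> i \<in> J then 1 else 0) * x $ j)"
    by (simp add: matrix_vector_mult_def)
  also have "\<dots> = (\<Sum>j\<in>UNIV. if j = i then (if i \<in> J then x $ i else 0) else 0)"
    by (rule sum.cong) auto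
  finally show ?thesis by simp
qed

lemma trace_proj_matrix:
  fixes S :: "(real ^ 'p) set"
  assumes S: "subspace S"
  shows "trace (proj_matrix S) = real (dim S)"
proof -
  obtain R :: "real ^ 'p ^ 'p" and J :: "'p set" where R: "orthogonal_matrix R" "card J = dim S"
    and PR: "proj_matrix S ** R = R ** (\<chi> i j. if i = j \<and> i \<in> J then 1 else 0)" (is "_ = R ** ?D")
    using proj_matrix_diagonalisation[OF S] .
  have RR: "R ** transpose R = mat 1" "transpose R ** R = mat 1"
    using R(1) by (auto simp: orthogonal_matrix_def)
  have "trace (proj_matrix S) = trace (R ** (?D ** transpose R))"
    by (simp add: matrix_mul_assoc flip: PR) (simp add: RR flip: matrix_mul_assoc)
  also have "\<dots> = trace ?D" using trace_mul_sym[of R "?D ** transpose R"]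
    by (simp add: matrix_mul_assoc[symmetric] RR)
  also have "\<dots> = real (card J)" by (simp add: trace_def sum.If_cases)
  finally show ?thesis using R(2) by simp
qed

lemma borel_measurable_matrix_vector [measurable]:
  fixes A :: "real ^ 'n ^ 'm"
  shows "(\<lambda>x. A *v x) \<in> borel_measurable borel"
  by (intro borel_measurable_continuous_onI linear_continuous_on) (simp add: linear_conv_bounded_linear[symmetric])

section \<open>Lebesgue measure: rotations and coordinates\<close>

lemma nn_integral_lborel_translate:
  fixes f :: "'a::euclidean_space \<Rightarrow> ennreal"
  assumes [measurable]: "f \<in> borel_measurable borel"
  shows "(\<integral>\<^sup>+x. f (c + x) \<partial>lborel) = (\<integral>\<^sup>+x. f x \<partial>lborel)"
proof -
  have "(\<integral>\<^sup>+x. f x \<partial>lborel) = (\<integral>\<^sup>+x. f x \<partial>distr lborel borel ((+) c))"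
    by (simp add: lborel_distr_plus)
  also have "\<dots> = (\<integral>\<^sup>+x. f (c + x) \<partial>lborel)" by (subst nn_integral_distr) auto
  finally show ?thesis by simp
qed

lemma nn_integral_lborel_reflect:
  fixes f :: "'a::euclidean_space \<Rightarrow> ennreal"
  assumes [measurable]: "f \<in> borel_measurable borel"
  shows "(\<integral>\<^sup>+x. f (c - x) \<partial>lborel) = (\<integral>\<^sup>+x. f x \<partial>lborel)"
proof -
  have "(lborel :: 'a measure) = density (distr lborel borel (\<lambda>x. c + (- 1) *\<^sub>R x)) (\<lambda>_. 1)"
    using lborel_affine[of "-1" c] by simp
  then have "(lborel :: 'a measure) = distr lborel borel (\<lambda>x. c - x)" by (simp add: density_1)
  then have "(\<integral>\<^sup>+x. f x \<partial>lborel) = (\<integral>\<^sup>+x. f x \<partial>distr lborel borel (\<lambda>x. c - x))" by simp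
  also have "\<dots> = (\<integral>\<^sup>+x. f (c - x) \<partial>lborel)" by (subst nn_integral_distr) auto
  finally show ?thesis by simp
qed

text \<open>The uniqueness argument for Haar measure: by Fubini and translation invariance
  \<open>\<lambda>(T\<^sup>-\<^sup>1 A) \<lambda>(B) = \<lambda>(A) \<lambda>(T\<^sup>-\<^sup>1 B)\<close> for all \<open>A\<close> and \<open>B\<close>, and for the unit ball \<open>B\<close> the rotation
  gives \<open>T\<^sup>-\<^sup>1 B = B\<close>.\<close>

lemma lborel_distr_orthogonal:
  fixes T :: "'a::euclidean_space \<Rightarrow> 'a"
  assumes T: "orthogonal_transformation T"
  shows "distr lborel borel T = lborel"
proof (rule measure_eqI)
  have "linear T" using T orthogonal_transformation_linear by blast
  then have [measurable]: "T \<in> borel_measurable borel"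
    by (intro borel_measurable_continuous_onI linear_continuous_on) (simp add: linear_conv_bounded_linear)
  fix A assume "A \<in> sets (distr lborel borel T)"
  then have [measurable]: "A \<in> sets borel" by simp
  let ?B = "ball 0 1 :: 'a set"
  let ?a = "indicator A :: 'a \<Rightarrow> ennreal" and ?b = "indicator ?B :: 'a \<Rightarrow> ennreal"
  have [measurable]: "?B \<in> sets borel" by simp
  have TB: "?b (T x) = ?b x" for x
    using orthogonal_transformation_norm[OF T, of x] by (simp add: indicator_def)
  have [measurable]: "T -` A \<in> sets borel" using measurable_sets_borel[of T borel A] by simp
  have "(\<lambda>x. ?a (T x)) = indicator (T -` A)" by (auto simp: indicator_def fun_eq_iff)
  then have preim: "emeasure lborel (T -` A) = (\<integral>\<^sup>+x. ?a (T x) \<partial>lborel)"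
    by (simp del: indicator_vimage)
  have "emeasure lborel (T -` A) * emeasure lborel ?B
      = (\<integral>\<^sup>+x. ?a (T x) * (\<integral>\<^sup>+y. ?b y \<partial>lborel) \<partial>lborel)"
    unfolding preim by (subst nn_integral_multc) auto
  also have "\<dots> = (\<integral>\<^sup>+x. (\<integral>\<^sup>+y. ?a (T x) * ?b (T x + y) \<partial>lborel) \<partial>lborel)"
  proof (rule nn_integral_cong)
    fix x :: 'a
    have "(\<integral>\<^sup>+y. ?a (T x) * ?b (T x + y) \<partial>lborel) = (\<integral>\<^sup>+y. ?a (T x) * ?b y \<partial>lborel)"
      by (rule nn_integral_lborel_translate[of "\<lambda>y. ?a (T x) * ?b y"]) measurable
    then show "?a (T x) * (\<integral>\<^sup>+y. ?b y \<partial>lborel) = (\<integral>\<^sup>+y. ?a (T x) * ?b (T x + y) \<partial>lborel)"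
      by (simp add: nn_integral_cmult)
  qed
  also have "\<dots> = (\<integral>\<^sup>+y. (\<integral>\<^sup>+x. ?a (T x) * ?b (T x + y) \<partial>lborel) \<partial>lborel)"
    by (rule lborel_pair.Fubini'[symmetric]) measurable
  also have "\<dots> = (\<integral>\<^sup>+y. (\<integral>\<^sup>+x. ?a (T x - y) * ?b (T x) \<partial>lborel) \<partial>lborel)"
  proof (rule nn_integral_cong)
    fix y :: 'a
    obtain z where z: "T z = y" using orthogonal_transformation_surj[OF T] by (metis surjD)
    have "(\<integral>\<^sup>+x. ?a (T x) * ?b (T x + y) \<partial>lborel)
        = (\<integral>\<^sup>+x. ?a (T (- z + x)) * ?b (T (- z + x) + y) \<partial>lborel)"
      by (rule nn_integral_lborel_translate[symmetric]) measurable
    also have "\<dots> = (\<integral>\<^sup>+x. ?a (T x - y) * ?b (T x) \<partial>lborel)"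
      by (simp add: linear_diff[OF \<open>linear T\<close>] z)
    finally show "(\<integral>\<^sup>+x. ?a (T x) * ?b (T x + y) \<partial>lborel)
        = (\<integral>\<^sup>+x. ?a (T x - y) * ?b (T x) \<partial>lborel)" .
  qed
  also have "\<dots> = (\<integral>\<^sup>+x. (\<integral>\<^sup>+y. ?a (T x - y) * ?b (T x) \<partial>lborel) \<partial>lborel)"
    by (rule lborel_pair.Fubini') measurable
  also have "\<dots> = (\<integral>\<^sup>+x. emeasure lborel A * ?b (T x) \<partial>lborel)"
  proof (rule nn_integral_cong)
    fix x :: 'a
    have "(\<integral>\<^sup>+y. ?a (T x - y) * ?b (T x) \<partial>lborel) = (\<integral>\<^sup>+y. ?a y * ?b (T x) \<partial>lborel)"
      by (rule nn_integral_lborel_reflect[of "\<lambda>y. ?a y * ?b (T x)"]) measurable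
    then show "(\<integral>\<^sup>+y. ?a (T x - y) * ?b (T x) \<partial>lborel) = emeasure lborel A * ?b (T x)"
      by (simp add: nn_integral_multc)
  qed
  also have "\<dots> = emeasure lborel A * emeasure lborel ?B"
    unfolding TB by (subst nn_integral_cmult) auto
  finally have eq: "emeasure lborel (T -` A) * emeasure lborel ?B = emeasure lborel A * emeasure lborel ?B" .
  have "emeasure lborel ?B \<noteq> 0"
    using open_not_negligible[of ?B] by (simp add: negligible_iff_null_sets null_sets_def null_sets_completion_iff)
  moreover have "emeasure lborel ?B \<noteq> \<infinity>" using emeasure_lborel_ball_finite[of 0 1] by (auto simp: top.not_eq_extremum)
  ultimately have "emeasure lborel (T -` A) = emeasure lborel A"
    using eq ennreal_mult_cancel_left[of "emeasure lborel ?B" "emeasure lborel (T -` A)" "emeasure lborel A"]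
    by (metis infinity_ennreal_def mult.commute)
  then show "emeasure (distr lborel borel T) A = emeasure lborel A" by (simp add: emeasure_distr)
qed simp

lemma nn_integral_lborel_prod:
  fixes f :: "'n::finite \<Rightarrow> real \<Rightarrow> ennreal"
  assumes [measurable]: "\<And>i. f i \<in> borel_measurable borel"
  shows "(\<integral>\<^sup>+x. (\<Prod>i\<in>UNIV. f i (x $ i)) \<partial>(lborel :: (real ^ 'n) measure))
    = (\<Prod>i\<in>UNIV. \<integral>\<^sup>+t. f i t \<partial>lborel)"
proof -
  have inj: "inj (\<lambda>i::'n. axis i (1::real))" by (auto simp: inj_def axis_eq_axis)
  have B: "(Basis :: (real ^ 'n) set) = range (\<lambda>i. axis i 1)" by (auto simp: Basis_vec_def)
  define g where "g b = f (THE i. b = axis i 1)" for b :: "real ^ 'n"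
  have g: "g (axis i 1) = f i" for i
    unfolding g_def by (rule arg_cong[of _ _ f]) (auto simp: axis_eq_axis)
  have [measurable]: "g b \<in> borel_measurable borel" for b by (simp add: g_def)
  interpret product_sigma_finite "\<lambda>_ :: real ^ 'n. lborel :: real measure" ..
  have "(\<integral>\<^sup>+x. (\<Prod>i\<in>UNIV. f i (x $ i)) \<partial>(lborel :: (real ^ 'n) measure))
      = (\<integral>\<^sup>+h. (\<Prod>i\<in>UNIV. f i ((\<Sum>b\<in>Basis. h b *\<^sub>R b) $ i)) \<partial>(\<Pi>\<^sub>M b\<in>(Basis :: (real ^ 'n) set). lborel))"
    by (subst lborel_eq, subst nn_integral_distr) auto
  also have "\<dots> = (\<integral>\<^sup>+h. (\<Prod>b\<in>Basis. g b (h b)) \<partial>(\<Pi>\<^sub>M b\<in>(Basis :: (real ^ 'n) set). lborel))"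
  proof (rule nn_integral_cong)
    fix h :: "real ^ 'n \<Rightarrow> real"
    have "(\<Sum>b\<in>Basis. h b *\<^sub>R b) $ i = h (axis i 1)" for i :: 'n
    proof -
      have "(\<Sum>b\<in>Basis. h b *\<^sub>R b) $ i = (\<Sum>j\<in>UNIV. (h (axis j 1) *\<^sub>R axis j 1) $ i)"
        unfolding B by (subst sum.reindex[OF inj]) simp
      also have "\<dots> = (\<Sum>j\<in>UNIV. if j = i then h (axis j 1) else 0)"
        by (intro sum.cong) (auto simp: axis_def)
      finally show ?thesis by simp
    qed
    then show "(\<Prod>i\<in>UNIV. f i ((\<Sum>b\<in>Basis. h b *\<^sub>R b) $ i)) = (\<Prod>b\<in>Basis. g b (h b))"
      unfolding B by (subst prod.reindex[OF inj]) (simp add: g)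
  qed
  also have "\<dots> = (\<Prod>b\<in>Basis. \<integral>\<^sup>+t. g b t \<partial>lborel)"
    by (rule product_nn_integral_prod) auto
  also have "\<dots> = (\<Prod>i\<in>UNIV. \<integral>\<^sup>+t. f i t \<partial>lborel)"
    unfolding B by (subst prod.reindex[OF inj]) (simp add: g)
  finally show ?thesis .
qed

section \<open>Gaussian quadratic forms\<close>

lemma inner_transpose:
  fixes A :: "real ^ 'n ^ 'm"
  shows "(transpose A *v x) \<bullet> y = x \<bullet> (A *v y)"
  by (simp only: transpose_matrix_vector dot_lmul_matrix)

lemma std_gaussian_density:
  fixes x :: "real ^ 'p"
  shows "(\<Prod>i\<in>UNIV. std_normal_density (x $ i)) = (1 / sqrt (2 * pi)) ^ CARD('p) * exp (- (x \<bullet> x) / 2)"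
proof -
  have "(\<Prod>i\<in>UNIV. std_normal_density (x $ i))
      = (1 / sqrt (2 * pi)) ^ CARD('p) * exp (\<Sum>i\<in>UNIV. - (x $ i)\<^sup>2 / 2)"
    unfolding std_normal_density_def prod.distrib by (simp add: exp_sum)
  also have "(\<Sum>i\<in>UNIV. - (x $ i)\<^sup>2 / 2) = - (x \<bullet> x) / 2"
    by (simp add: inner_vec_def power2_eq_square sum_negf flip: sum_divide_distrib)
  finally show ?thesis .
qed

lemma nn_integral_std_gaussian:
  fixes f :: "real ^ 'p \<Rightarrow> ennreal"
  assumes [measurable]: "f \<in> borel_measurable borel"
  shows "(\<integral>\<^sup>+z. f z \<partial>std_gaussian)
    = (\<integral>\<^sup>+z. ennreal (\<Prod>i\<in>UNIV. std_normal_density (z $ i)) * f z \<partial>lborel)"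
  unfolding std_gaussian_def by (subst nn_integral_density) auto

lemma nn_integral_std_gaussian_rotate:
  fixes f :: "real ^ 'p \<Rightarrow> ennreal"
  assumes R: "orthogonal_matrix R" and [measurable]: "f \<in> borel_measurable borel"
  shows "(\<integral>\<^sup>+z. f (R *v z) \<partial>std_gaussian) = (\<integral>\<^sup>+z. f z \<partial>std_gaussian)"
proof -
  have T: "orthogonal_transformation ((*v) R)"
    using R by (simp add: orthogonal_transformation_matrix)
  let ?g = "\<lambda>z :: real ^ 'p. ennreal (\<Prod>i\<in>UNIV. std_normal_density (z $ i))"
  have g: "?g z = ?g (R *v z)" for z
    using T by (simp add: std_gaussian_density orthogonal_transformation_def)
  have "(\<integral>\<^sup>+z. f (R *v z) \<partial>std_gaussian) = (\<integral>\<^sup>+z. ?g z * f (R *v z) \<partial>lborel)"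
    by (rule nn_integral_std_gaussian) measurable
  also have "\<dots> = (\<integral>\<^sup>+z. ?g (R *v z) * f (R *v z) \<partial>lborel)" by (subst g) (rule refl)
  also have "\<dots> = (\<integral>\<^sup>+z. ?g z * f z \<partial>distr lborel borel ((*v) R))"
    by (subst nn_integral_distr) auto
  also have "\<dots> = (\<integral>\<^sup>+z. ?g z * f z \<partial>lborel)" by (simp only: lborel_distr_orthogonal[OF T])
  finally show ?thesis by (simp add: nn_integral_std_gaussian)
qed

lemma nn_integral_std_normal_exp_square:
  assumes a: "2 * a < 1"
  shows "(\<integral>\<^sup>+t. ennreal (std_normal_density t) * ennreal (exp (a * t\<^sup>2)) \<partial>lborel)
    = ennreal ((1 - 2 * a) powr (- 1 / 2))"
proof -
  \<comment> \<open>the exponential tilt of the standard normal density is a normal density of larger variance\<close>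
  define \<sigma> where "\<sigma> = (1 - 2 * a) powr (- 1 / 2)"
  have \<sigma>: "0 < \<sigma>" using a by (simp add: \<sigma>_def)
  have "\<sigma>\<^sup>2 = (1 - 2 * a) powr (- 1)"
    using a by (simp add: \<sigma>_def power2_eq_square flip: powr_add)
  then have s2: "\<sigma>\<^sup>2 = 1 / (1 - 2 * a)" using a by (simp add: powr_minus divide_simps)
  have "std_normal_density t * exp (a * t\<^sup>2) = \<sigma> * normal_density 0 \<sigma> t" for t
  proof -
    have tilt: "- t\<^sup>2 / 2 + a * t\<^sup>2 = - (t - 0)\<^sup>2 / (2 * \<sigma>\<^sup>2)" using a by (simp add: s2 field_simps)
    have const: "\<sigma> * (1 / sqrt (2 * pi * \<sigma>\<^sup>2)) = 1 / sqrt (2 * pi)"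
      using \<sigma> by (simp add: real_sqrt_mult)
    have "std_normal_density t * exp (a * t\<^sup>2) = 1 / sqrt (2 * pi) * exp (- t\<^sup>2 / 2 + a * t\<^sup>2)"
      by (simp only: std_normal_density_def exp_add mult.assoc)
    also have "\<dots> = \<sigma> * (1 / sqrt (2 * pi * \<sigma>\<^sup>2)) * exp (- (t - 0)\<^sup>2 / (2 * \<sigma>\<^sup>2))"
      unfolding tilt const ..
    also have "\<dots> = \<sigma> * normal_density 0 \<sigma> t" unfolding normal_density_def by (simp only: mult.assoc)
    finally show ?thesis .
  qed
  then have "(\<integral>\<^sup>+t. ennreal (std_normal_density t) * ennreal (exp (a * t\<^sup>2)) \<partial>lborel)
      = (\<integral>\<^sup>+t. ennreal \<sigma> * ennreal (normal_density 0 \<sigma> t) \<partial>lborel)"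
    using \<sigma> by (intro nn_integral_cong) (simp flip: ennreal_mult)
  also have "\<dots> = ennreal \<sigma> * (\<integral>\<^sup>+t. ennreal (normal_density 0 \<sigma> t) \<partial>lborel)"
    by (rule nn_integral_cmult) measurable
  also have "(\<integral>\<^sup>+t. ennreal (normal_density 0 \<sigma> t) \<partial>lborel) = 1"
    using prob_space.emeasure_space_1[OF prob_space_normal_density[OF \<sigma>, of 0]]
    by (simp add: emeasure_density)
  finally show ?thesis by (simp add: \<sigma>_def)
qed

text \<open>The empty set \<open>J\<close> gives the total mass of the standard Gaussian measure.\<close>

lemma std_gaussian_chi_square_mgf:
  fixes J :: "'p::finite set"
  assumes a: "2 * a < 1"
  shows "(\<integral>\<^sup>+z. ennreal (exp (a * (\<Sum>i\<in>J. (z $ i)\<^sup>2))) \<partial>(std_gaussian :: (real ^ 'p) measure))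
    = ennreal ((1 - 2 * a) powr (- real (card J) / 2))"
proof -
  define f where "f i t = ennreal (std_normal_density t) * (if i \<in> J then ennreal (exp (a * t\<^sup>2)) else 1)"
    for i :: 'p and t
  have [measurable]: "f i \<in> borel_measurable borel" for i unfolding f_def by measurable
  have f: "(\<integral>\<^sup>+t. f i t \<partial>lborel) = (if i \<in> J then ennreal ((1 - 2 * a) powr (- 1 / 2)) else 1)" for i
    using nn_integral_std_normal_exp_square[OF a] nn_integral_std_normal_exp_square[of 0]
    by (simp add: f_def)
  have "ennreal (\<Prod>i\<in>UNIV. std_normal_density (z $ i)) * ennreal (exp (a * (\<Sum>i\<in>J. (z $ i)\<^sup>2)))
      = (\<Prod>i\<in>UNIV. f i (z $ i))" for z :: "real ^ 'p"
    by (simp add: f_def prod.distrib prod.If_cases sum_distrib_left exp_sum prod_ennreal)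
  then have "(\<integral>\<^sup>+z. ennreal (exp (a * (\<Sum>i\<in>J. (z $ i)\<^sup>2))) \<partial>(std_gaussian :: (real ^ 'p) measure))
      = (\<integral>\<^sup>+z. (\<Prod>i\<in>UNIV. f i (z $ i)) \<partial>(lborel :: (real ^ 'p) measure))"
    by (subst nn_integral_std_gaussian) auto
  also have "\<dots> = (\<Prod>i\<in>UNIV. if i \<in> J then ennreal ((1 - 2 * a) powr (- 1 / 2)) else 1)"
    by (simp add: nn_integral_lborel_prod f)
  also have "\<dots> = ennreal (((1 - 2 * a) powr (- 1 / 2)) ^ card J)"
    by (simp add: prod.If_cases ennreal_power)
  also have "((1 - 2 * a) powr (- 1 / 2)) ^ card J = (1 - 2 * a) powr (- real (card J) / 2)"
    using a by (simp add: powr_realpow[symmetric] powr_powr)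
  finally show ?thesis .
qed

text \<open>If \<open>B Z\<close> is isotropic on \<open>Y\<close>, then \<open>B\<^sup>T B\<close> is, up to the factor \<open>b\<close>, itself an orthogonal
  projection of rank \<open>dim Y\<close>. So \<open>|B Z|\<^sup>2\<close> is \<open>b\<close> times a chi-squared variable with \<open>dim Y\<close> degrees
  of freedom.\<close>

lemma isotropic_gaussian_mgf:
  fixes B :: "real ^ 'p ^ 'p"
  assumes Y: "subspace Y" and B: "B ** transpose B = b *\<^sub>R proj_matrix Y" and \<theta>: "2 * \<theta> * b < 1"
  shows "(\<integral>\<^sup>+z. ennreal (exp (\<theta> * (norm (B *v z))\<^sup>2)) \<partial>std_gaussian)
    = ennreal ((1 - 2 * \<theta> * b) powr (- real (dim Y) / 2))"
proof -
  let ?P = "proj_matrix Y"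
  have sq: "(norm (transpose B *v x))\<^sup>2 = b * (x \<bullet> orth_proj Y x)" for x
  proof -
    have "(norm (transpose B *v x))\<^sup>2 = x \<bullet> ((B ** transpose B) *v x)"
      by (simp only: power2_norm_eq_inner inner_transpose matrix_vector_mul_assoc[symmetric])
    then show ?thesis by (simp add: B proj_matrix_vector[OF Y] flip: scaleR_matrix_vector_assoc)
  qed
  show ?thesis
  proof (cases "b = 0")
    case True
    have "transpose B *v x = 0" for x using sq[of x] True by simp
    then have "transpose B = 0" by (simp add: matrix_eq)
    then have "B = 0" by (simp add: vec_eq_iff transpose_def)
    then show ?thesis using True std_gaussian_chi_square_mgf[of 0 "{}"] by simp
  next
    case False
    \<comment> \<open>the variance vanishes on the complement of \<open>Y\<close>\<close>
    have BP: "transpose B *v orth_proj Y x = transpose B *v x" for x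
    proof -
      have "orth_proj Y (x - orth_proj Y x) = 0"
        by (simp add: linear_diff[OF linear_orth_proj[OF Y]] orth_proj_id[OF Y] orth_proj_in[OF Y])
      then have "transpose B *v (x - orth_proj Y x) = 0" using sq[of "x - orth_proj Y x"] by simp
      then show ?thesis by (simp add: matrix_vector_mult_diff_distrib)
    qed
    define Q where "Q = (1 / b) *\<^sub>R (transpose B ** B)"
    have Qv: "Q *v x = (1 / b) *\<^sub>R (transpose B *v (B *v x))" for x
      by (simp only: Q_def matrix_vector_mul_assoc scaleR_matrix_vector_assoc[symmetric])
    have BB: "B *v (transpose B *v x) = b *\<^sub>R orth_proj Y x" for x
      by (simp only: matrix_vector_mul_assoc B proj_matrix_vector[OF Y] scaleR_matrix_vector_assoc[symmetric])
    have Qsym: "transpose Q = Q"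
      by (simp add: Q_def transpose_scalar matrix_transpose_mul)
    have "Q *v (Q *v x) = Q *v x" for x
      using False by (simp add: Qv BB BP matrix_vector_mult_scaleR del: transpose_matrix_vector)
    then have Qidem: "Q ** Q = Q" by (simp add: matrix_eq flip: matrix_vector_mul_assoc)
    define S where "S = range ((*v) Q)"
    have S: "subspace S" unfolding S_def by (intro linear_subspace_image) auto
    have Q: "Q = proj_matrix S" unfolding S_def by (rule proj_matrix_of_idempotent[OF Qsym Qidem])
    have "real (dim S) = trace Q" using trace_proj_matrix[OF S] Q by simp
    also have "\<dots> = (1 / b) * trace (B ** transpose B)"
      by (simp add: Q_def trace_def sum_distrib_left trace_mul_sym[unfolded trace_def, of B])
    also have "\<dots> = trace ?P" using False by (simp add: B trace_def sum_distrib_left)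
    also have "\<dots> = real (dim Y)" by (rule trace_proj_matrix[OF Y])
    finally have dim: "dim S = dim Y" by simp
    obtain R :: "real ^ 'p ^ 'p" and J :: "'p set" where R: "orthogonal_matrix R" "card J = dim S"
      and PR: "proj_matrix S ** R = R ** (\<chi> i j. if i = j \<and> i \<in> J then 1 else 0)" (is "_ = R ** ?D")
      using proj_matrix_diagonalisation[OF S] .
    have QR: "Q ** R = R ** ?D" using PR Q by simp
    have norm: "(norm (B *v (R *v z)))\<^sup>2 = b * (\<Sum>i\<in>J. (z $ i)\<^sup>2)" for z
    proof -
      have "(norm (B *v (R *v z)))\<^sup>2 = (R *v z) \<bullet> (transpose B *v (B *v (R *v z)))"
        by (simp only: power2_norm_eq_inner inner_transpose inner_commute[of _ "transpose B *v _"])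
      also have "transpose B *v (B *v (R *v z)) = b *\<^sub>R (Q *v (R *v z))"
        using False by (simp add: Qv)
      also have "Q *v (R *v z) = R *v (?D *v z)" by (simp add: matrix_vector_mul_assoc QR)
      also have "(R *v z) \<bullet> (b *\<^sub>R (R *v (?D *v z))) = b * (z \<bullet> (?D *v z))"
        using orthogonal_transformation_matrix[of "(*v) R"] R(1)
        by (simp add: orthogonal_transformation_def)
      also have "z \<bullet> (?D *v z) = (\<Sum>i\<in>UNIV. if i \<in> J then (z $ i)\<^sup>2 else 0)"
        unfolding inner_vec_def coordinate_projection_nth
        by (intro sum.cong) (auto simp: power2_eq_square)
      also have "\<dots> = (\<Sum>i\<in>J. (z $ i)\<^sup>2)" by (simp add: sum.If_cases)
      finally show ?thesis .
    qed
    have "(\<integral>\<^sup>+z. ennreal (exp (\<theta> * (norm (B *v z))\<^sup>2)) \<partial>std_gaussian)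
        = (\<integral>\<^sup>+z. ennreal (exp (\<theta> * (norm (B *v (R *v z)))\<^sup>2)) \<partial>std_gaussian)"
      by (rule nn_integral_std_gaussian_rotate[OF R(1), symmetric]) measurable
    also have "\<dots> = (\<integral>\<^sup>+z. ennreal (exp ((\<theta> * b) * (\<Sum>i\<in>J. (z $ i)\<^sup>2))) \<partial>(std_gaussian :: (real ^ 'p) measure))"
      by (simp add: norm mult.assoc)
    also have "\<dots> = ennreal ((1 - 2 * \<theta> * b) powr (- real (dim Y) / 2))"
      using \<theta> by (subst std_gaussian_chi_square_mgf) (simp_all add: R(2) dim mult.assoc)
    finally show ?thesis .
  qed
qed

section \<open>Nets in the unit sphere of a subspace\<close>

text \<open>A ball of radius \<open>a\<close> in \<open>S\<close>, thickened by the unit ball of the orthogonal complement, has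
  volume proportional to \<open>a ^ dim S\<close>: rotate \<open>S\<close> to a coordinate subspace and rescale its axes.\<close>

lemma emeasure_tube:
  fixes S :: "(real ^ 'p) set"
  assumes S: "subspace S" and y: "y \<in> S" and a: "0 < a"
  shows "emeasure lborel {z. norm (orth_proj S z - y) < a \<and> norm (z - orth_proj S z) < 1}
    = ennreal (a ^ dim S) * emeasure lborel {z. norm (orth_proj S z) < 1 \<and> norm (z - orth_proj S z) < 1}"
    (is "emeasure _ ?A = _ * emeasure _ ?K")
proof -
  let ?P = "orth_proj S"
  have lP: "linear ?P" by (rule linear_orth_proj[OF S])
  have [measurable]: "?P \<in> borel_measurable borel" by (rule borel_measurable_orth_proj[OF S])
  have [measurable]: "?A \<in> sets borel" "?K \<in> sets borel" by measurable
  obtain R :: "real ^ 'p ^ 'p" and J :: "'p set" where R: "orthogonal_matrix R" "card J = dim S"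
    and PR: "proj_matrix S ** R = R ** (\<chi> i j. if i = j \<and> i \<in> J then 1 else 0)" (is "_ = R ** ?D")
    using proj_matrix_diagonalisation[OF S] .
  have T: "orthogonal_transformation ((*v) R)"
    using R by (simp add: orthogonal_transformation_matrix)
  have PR: "?P (R *v x) = R *v (?D *v x)" for x
    by (simp only: proj_matrix_vector[OF S, symmetric] matrix_vector_mul_assoc PR)
  note D = coordinate_projection_nth[of J]
  define c where "c b = (if \<exists>i\<in>J. b = axis i 1 then a else 1)" for b :: "real ^ 'p"
  have c: "c (axis i 1) = (if i \<in> J then a else 1)" for i by (simp add: c_def axis_eq_axis)
  have inj: "inj (\<lambda>i::'p. axis i (1::real))" by (auto simp: inj_def axis_eq_axis)
  have Basis: "(Basis :: (real ^ 'p) set) = range (\<lambda>i. axis i 1)" by (auto simp: Basis_vec_def)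
  define t where "t = transpose R *v y"
  have Rt: "R *v t = y"
    using R(1) by (simp add: t_def matrix_vector_mul_assoc orthogonal_matrix_def del: transpose_matrix_vector)
  let ?L = "\<lambda>x. t + (\<Sum>b\<in>Basis. (c b * (x \<bullet> b)) *\<^sub>R b)"
  have L: "?L x = t + (x + (a - 1) *\<^sub>R (?D *v x))" for x
  proof -
    have axis_nth: "axis j (1 :: real) $ i = (if j = i then 1 else 0)" for i j :: 'p by (simp add: axis_def)
    have "(\<Sum>b\<in>Basis. (c b * (x \<bullet> b)) *\<^sub>R b) $ i = (x + (a - 1) *\<^sub>R (?D *v x)) $ i" for i
    proof -
      have "(\<Sum>b\<in>Basis. (c b * (x \<bullet> b)) *\<^sub>R b) $ i
          = (\<Sum>j\<in>UNIV. ((c (axis j 1) * (x \<bullet> axis j 1)) *\<^sub>R axis j 1) $ i)"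
        unfolding Basis by (subst sum.reindex[OF inj]) simp
      also have "\<dots> = (\<Sum>j\<in>UNIV. if j = i then (if i \<in> J then a else 1) * x $ i else 0)"
        by (intro sum.cong) (auto simp: c inner_axis axis_nth)
      finally show ?thesis by (auto simp: D algebra_simps)
    qed
    then show ?thesis by (simp add: vec_eq_iff)
  qed
  have [measurable]: "?L \<in> borel_measurable borel" by measurable
  have "(\<Prod>b\<in>Basis. \<bar>c b\<bar>) = (\<Prod>i\<in>UNIV. if i \<in> J then a else 1)"
    unfolding Basis using a by (subst prod.reindex[OF inj]) (auto simp: c intro!: prod.cong)
  then have "(\<Prod>b\<in>Basis. \<bar>c b\<bar>) = a ^ dim S" by (simp add: prod.If_cases R(2))
  moreover have "c b \<noteq> 0" for b using a by (simp add: c_def)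
  ultimately have lb: "lborel = density (distr lborel borel ?L) (\<lambda>_. ennreal (a ^ dim S))"
    using lborel_affine_euclidean[of c t] by simp
  have rot: "emeasure lborel X = emeasure lborel ((*v) R -` X)" if [measurable]: "X \<in> sets borel" for X
  proof -
    have "emeasure lborel X = emeasure (distr lborel borel ((*v) R)) X"
      by (simp only: lborel_distr_orthogonal[OF T])
    also have "\<dots> = emeasure lborel ((*v) R -` X)" by (subst emeasure_distr) auto
    finally show ?thesis .
  qed
  have "emeasure lborel ?A = emeasure lborel ((*v) R -` ?A)" by (rule rot) measurable
  also have "\<dots> = ennreal (a ^ dim S) * emeasure lborel (?L -` ((*v) R -` ?A))"
  proof -
    have m: "(*v) R -` ?A \<in> sets borel" using measurable_sets_borel[of "(*v) R" borel ?A] by simp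
    have "emeasure lborel ((*v) R -` ?A)
        = emeasure (density (distr lborel borel ?L) (\<lambda>_. ennreal (a ^ dim S))) ((*v) R -` ?A)"
      using lb by simp
    also have "\<dots> = ennreal (a ^ dim S) * emeasure (distr lborel borel ?L) ((*v) R -` ?A)"
      using m by (subst emeasure_density) (auto simp: nn_integral_cmult_indicator)
    finally show ?thesis using m by (simp add: emeasure_distr)
  qed
  also have "?L -` ((*v) R -` ?A) = (*v) R -` ?K"
  proof -
    have "?D *v (?D *v x) = ?D *v x" for x by (simp add: vec_eq_iff D)
    moreover have "?D *v t = t"
    proof -
      have "R *v (?D *v t) = R *v t" using PR[of t] Rt orth_proj_id[OF S y] by simp
      then show ?thesis by (rule injD[OF orthogonal_transformation_inj[OF T]])
    qed
    ultimately have DL: "?D *v (?L x) = t + a *\<^sub>R (?D *v x)" for x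
      unfolding L by (simp add: matrix_vector_right_distrib matrix_vector_mult_scaleR algebra_simps)
    have "?P (R *v ?L x) - y = a *\<^sub>R ?P (R *v x)" for x
      unfolding PR DL by (simp add: matrix_vector_right_distrib matrix_vector_mult_scaleR Rt)
    moreover have "R *v ?L x - ?P (R *v ?L x) = R *v x - ?P (R *v x)" for x
      unfolding PR DL unfolding L
      by (simp add: matrix_vector_right_distrib matrix_vector_mult_scaleR algebra_simps)
    ultimately show ?thesis using a by (auto simp: vimage_def)
  qed
  also have "emeasure lborel ((*v) R -` ?K) = emeasure lborel ?K" by (rule rot[symmetric]) measurable
  finally show ?thesis .
qed

text \<open>Around the points of an \<open>\<epsilon>\<close>-separated set the tubes of radius \<open>\<epsilon> / 2\<close> are disjoint, and
  they lie in the tube of radius \<open>1 + \<epsilon> / 2\<close> around \<open>0\<close>.\<close>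

lemma card_separated_sphere_le:
  fixes S :: "(real ^ 'p) set"
  assumes S: "subspace S" and \<epsilon>: "0 < \<epsilon>" and fin: "finite N" and N: "N \<subseteq> S \<inter> sphere 0 1"
    and sep: "\<And>x y. x \<in> N \<Longrightarrow> y \<in> N \<Longrightarrow> x \<noteq> y \<Longrightarrow> \<epsilon> \<le> dist x y"
  shows "real (card N) \<le> (1 + 2 / \<epsilon>) ^ dim S"
proof -
  let ?P = "orth_proj S"
  \<comment> \<open>all tubes have thickness one in the complement, so that their volumes are comparable\<close>
  define A where "A y a = {z. norm (?P z - y) < a \<and> norm (z - ?P z) < 1}" for y a
  have lP: "linear ?P" by (rule linear_orth_proj[OF S])
  then have cP: "continuous_on UNIV ?P"
    by (intro linear_continuous_on) (simp add: linear_conv_bounded_linear)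
  have op: "open (A y a)" for y a
    unfolding A_def by (intro open_Collect_conj open_Collect_less continuous_intros cP)
  then have [measurable]: "A y a \<in> sets borel" for y a by simp
  have tube: "emeasure lborel (A y a) = ennreal (a ^ dim S) * emeasure lborel (A 0 1)"
    if "y \<in> S" "0 < a" for y a
    using emeasure_tube[OF S that] by (simp add: A_def)
  have "A 0 1 \<subseteq> ball 0 2"
  proof
    fix z assume "z \<in> A 0 1"
    then show "z \<in> ball 0 2" using norm_triangle_ineq[of "?P z" "z - ?P z"] by (simp add: A_def)
  qed
  then have "emeasure lborel (A 0 1) \<le> emeasure lborel (ball (0 :: real ^ 'p) 2)"
    by (intro emeasure_mono) auto
  also have "\<dots> < \<infinity>" using emeasure_lborel_ball_finite[of 0 2] by simp
  finally have K_fin: "emeasure lborel (A 0 1) < \<infinity>" .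
  have "0 \<in> A 0 1" by (simp add: A_def linear_0[OF lP])
  then have "emeasure lborel (A 0 1) \<noteq> 0"
    using open_not_negligible[OF op, of 0 1]
    by (auto simp: negligible_iff_null_sets null_sets_def null_sets_completion_iff)
  then obtain K where K: "emeasure lborel (A 0 1) = ennreal K" "0 < K"
    using K_fin by (cases "emeasure lborel (A 0 1)") (auto simp: less_le)
  have disj: "disjoint_family_on (\<lambda>y. A y (\<epsilon> / 2)) N"
    unfolding disjoint_family_on_def
  proof (intro ballI impI)
    fix x y assume "x \<in> N" "y \<in> N" "x \<noteq> y"
    then have "\<epsilon> \<le> dist x y" using sep by blast
    then show "A x (\<epsilon> / 2) \<inter> A y (\<epsilon> / 2) = {}"
      using dist_triangle_half_r[of _ x \<epsilon> y] by (force simp: A_def dist_norm)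
  qed
  have "ennreal (real (card N) * ((\<epsilon> / 2) ^ dim S * K)) = (\<Sum>y\<in>N. emeasure lborel (A y (\<epsilon> / 2)))"
    using tube N \<epsilon> K by (subst sum.cong[OF refl, of N _ "\<lambda>_. ennreal ((\<epsilon> / 2) ^ dim S * K)"])
      (auto simp: ennreal_mult ennreal_of_nat_eq_real_of_nat)
  also have "\<dots> = emeasure lborel (\<Union>y\<in>N. A y (\<epsilon> / 2))"
    by (rule sum_emeasure[OF _ disj fin]) auto
  also have "\<dots> \<le> emeasure lborel (A 0 (1 + \<epsilon> / 2))"
  proof (rule emeasure_mono)
    show "(\<Union>y\<in>N. A y (\<epsilon> / 2)) \<subseteq> A 0 (1 + \<epsilon> / 2)"
    proof
      fix z assume "z \<in> (\<Union>y\<in>N. A y (\<epsilon> / 2))"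
      then obtain y where "y \<in> N" "z \<in> A y (\<epsilon> / 2)" by blast
      moreover from this have "norm y = 1" using N by auto
      ultimately show "z \<in> A 0 (1 + \<epsilon> / 2)"
        using norm_triangle_ineq[of "?P z - y" y] by (simp add: A_def)
    qed
  qed simp
  also have "\<dots> = ennreal ((1 + \<epsilon> / 2) ^ dim S * K)"
    using tube[of 0 "1 + \<epsilon> / 2"] subspace_0[OF S] \<epsilon> K by (simp add: ennreal_mult)
  finally have "real (card N) * ((\<epsilon> / 2) ^ dim S * K) \<le> (1 + \<epsilon> / 2) ^ dim S * K"
    using K \<epsilon> by (subst (asm) ennreal_le_iff) auto
  then have "real (card N) * (\<epsilon> / 2) ^ dim S \<le> (1 + \<epsilon> / 2) ^ dim S" using K by (simp add: mult.assoc[symmetric])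
  then have "real (card N) \<le> (1 + \<epsilon> / 2) ^ dim S / (\<epsilon> / 2) ^ dim S" using \<epsilon> by (simp add: field_simps)
  also have "\<dots> = ((1 + \<epsilon> / 2) / (\<epsilon> / 2)) ^ dim S" by (rule power_divide[symmetric])
  also have "(1 + \<epsilon> / 2) / (\<epsilon> / 2) = 1 + 2 / \<epsilon>" using \<epsilon> by (simp add: field_simps)
  finally show ?thesis .
qed

text \<open>A separated set of maximal cardinality is a net.\<close>

lemma sphere_net_exists:
  fixes S :: "(real ^ 'p) set"
  assumes S: "subspace S" and \<epsilon>: "0 < \<epsilon>"
  obtains N where "finite N" "N \<subseteq> S \<inter> sphere 0 1" "real (card N) \<le> (1 + 2 / \<epsilon>) ^ dim S"
    "\<And>x. x \<in> S \<Longrightarrow> norm x = 1 \<Longrightarrow> \<exists>y\<in>N. dist x y < \<epsilon>"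
proof -
  define sep where "sep N \<longleftrightarrow> finite N \<and> N \<subseteq> S \<inter> sphere 0 1 \<and>
    (\<forall>x\<in>N. \<forall>y\<in>N. x \<noteq> y \<longrightarrow> \<epsilon> \<le> dist x y)" for N
  have bd: "real (card N) \<le> (1 + 2 / \<epsilon>) ^ dim S" if "sep N" for N
    using that card_separated_sphere_le[OF S \<epsilon>, of N] by (auto simp: sep_def)
  have "sep {}" by (simp add: sep_def)
  moreover have "\<forall>N. sep N \<longrightarrow> card N < nat \<lceil>(1 + 2 / \<epsilon>) ^ dim S\<rceil> + 1"
  proof (intro allI impI)
    fix N assume "sep N"
    then show "card N < nat \<lceil>(1 + 2 / \<epsilon>) ^ dim S\<rceil> + 1"
      using order_trans[OF bd real_nat_ceiling_ge] by force
  qed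
  ultimately obtain N where N: "sep N" "\<And>N'. sep N' \<Longrightarrow> card N' \<le> card N"
    using ex_has_greatest_nat[of sep "{}" card] by blast
  have "\<exists>y\<in>N. dist x y < \<epsilon>" if x: "x \<in> S" "norm x = 1" for x
  proof (rule ccontr)
    assume *: "\<not> (\<exists>y\<in>N. dist x y < \<epsilon>)"
    then have "sep (insert x N)" using N(1) x by (auto simp: sep_def dist_commute not_less)
    then have "card (insert x N) \<le> card N" by (rule N(2))
    moreover have "x \<notin> N" using * \<epsilon> by force
    ultimately show False using N(1) by (auto simp: sep_def)
  qed
  then show ?thesis using that[of N] N(1) bd by (auto simp: sep_def)
qed

section \<open>Real representations\<close>

lemma perm_matrix_component:
  fixes v :: "'a::field ^ 'p"
  assumes "bij g" shows "(perm_matrix g *v v) $ i = v $ (inv_into UNIV g i)"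
proof -
  have "(perm_matrix g *v v) $ i = (\<Sum>j\<in>UNIV. if j = inv_into UNIV g i then v $ j else 0)"
    unfolding matrix_vector_mult_def perm_matrix_def
    using assms by (auto intro!: sum.cong simp: bij_inv_eq_iff)
  then show ?thesis by simp
qed

lemma perm_matrix_inverse:
  fixes v :: "'a::field ^ 'p"
  assumes "bij g"
  shows "perm_matrix g *v (perm_matrix (inv_into UNIV g) *v v) = v"
    and "perm_matrix (inv_into UNIV g) *v (perm_matrix g *v v) = v"
  using assms
  by (simp_all add: vec_eq_iff perm_matrix_component bij_imp_bij_inv inv_inv_eq bij_is_inj bij_is_surj
      surj_f_inv_f)

lemma perm_matrix_adjoint:
  fixes u v :: "'a::{field,real_inner} ^ 'p"
  assumes "bij g"
  shows "(perm_matrix g *v u) \<bullet> v = u \<bullet> (perm_matrix (inv_into UNIV g) *v v)"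
proof -
  have "(perm_matrix g *v u) \<bullet> v = (\<Sum>i\<in>UNIV. u $ inv_into UNIV g i \<bullet> v $ i)"
    by (simp add: inner_vec_def perm_matrix_component assms)
  also have "\<dots> = (\<Sum>i\<in>UNIV. u $ i \<bullet> v $ g i)"
    by (rule sum.reindex_bij_witness[of _ g "inv_into UNIV g"])
       (use assms in \<open>auto simp: bij_is_surj surj_f_inv_f bij_is_inj\<close>)
  finally show ?thesis
    by (simp add: inner_vec_def perm_matrix_component bij_imp_bij_inv assms inv_inv_eq)
qed

definition equivariant :: "('p \<Rightarrow> 'p) set \<Rightarrow> ('a::field ^ 'p \<Rightarrow> 'a ^ 'p) \<Rightarrow> bool" where
  "equivariant G f \<longleftrightarrow> (\<forall>g\<in>G. \<forall>v. f (perm_matrix g *v v) = perm_matrix g *v f v)"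

definition real_invariant :: "('p \<Rightarrow> 'p) set \<Rightarrow> (real ^ 'p) set \<Rightarrow> bool" where
  "real_invariant G V \<longleftrightarrow> subspace V \<and> (\<forall>g\<in>G. \<forall>v\<in>V. perm_matrix g *v v \<in> V)"

definition real_irreducible :: "('p \<Rightarrow> 'p) set \<Rightarrow> (real ^ 'p) set \<Rightarrow> bool" where
  "real_irreducible G V \<longleftrightarrow> real_invariant G V \<and> V \<noteq> {0} \<and>
     (\<forall>W. real_invariant G W \<and> W \<subseteq> V \<longrightarrow> W = {0} \<or> W = V)"

lemma real_irreducible_subspace: "real_irreducible G V \<Longrightarrow> subspace V"
  by (simp add: real_irreducible_def real_invariant_def)

lemma real_irreducible_exists:
  assumes "real_invariant G V" "V \<noteq> {0}"
  obtains U where "real_irreducible G U" "U \<subseteq> V"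
proof -
  have "\<exists>U. real_irreducible G U \<and> U \<subseteq> V"
    using assms
  proof (induction "dim V" arbitrary: V rule: less_induct)
    case less
    show ?case
    proof (cases "real_irreducible G V")
      case False
      then obtain W where W: "real_invariant G W" "W \<subseteq> V" "W \<noteq> {0}" "W \<noteq> V"
        using less.prems unfolding real_irreducible_def by blast
      have "subspace W" "subspace V" using W(1) less.prems(1) by (auto simp: real_invariant_def)
      then have "dim W < dim V"
        using W(2,4) by (metis dim_subset le_neq_implies_less subspace_dim_equal order_refl)
      from less.hyps[OF this W(1,3)] W(2) show ?thesis by blast
    qed blast
  qed
  then show ?thesis using that by blast
qed

lemma real_irreducible_dim_pos:
  assumes "real_irreducible G V" shows "0 < dim V"
proof (rule ccontr)
  assume "\<not> 0 < dim V"
  then have "V \<subseteq> {0}" by (simp add: dim_eq_0)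
  then show False using assms subspace_0[OF real_irreducible_subspace[OF assms]]
    by (auto simp: real_irreducible_def)
qed

lemma orth_proj_equivariant:
  fixes S :: "('a::{field,euclidean_space} ^ 'p) set"
  assumes G: "subgroup G (BijGroup UNIV)" and S: "subspace S"
    and inv: "\<And>g v. g \<in> G \<Longrightarrow> v \<in> S \<Longrightarrow> perm_matrix g *v v \<in> S"
    and lin: "\<And>g. linear (\<lambda>v :: 'a ^ 'p. perm_matrix g *v v)"
  shows "equivariant G (orth_proj S)"
  unfolding equivariant_def
proof (intro ballI allI)
  fix g and v :: "'a ^ 'p" assume g: "g \<in> G"
  show "orth_proj S (perm_matrix g *v v) = perm_matrix g *v orth_proj S v"
  proof (rule orth_proj_commute[OF S lin inv[OF g]])
    fix x w :: "'a ^ 'p" assume x: "\<And>w. w \<in> S \<Longrightarrow> x \<bullet> w = 0" and w: "w \<in> S"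
    show "(perm_matrix g *v x) \<bullet> w = 0"
      unfolding perm_matrix_adjoint[OF subgroup_Bij(1)[OF G g]]
      by (rule x[OF inv[OF subgroup_Bij(2)[OF G g] w]])
  qed
qed

lemma real_orth_proj_equivariant:
  assumes "subgroup G (BijGroup UNIV)" "real_invariant G V"
  shows "equivariant G (orth_proj V)"
  using assms by (intro orth_proj_equivariant) (auto simp: real_invariant_def)

text \<open>For a symmetric operator Schur's lemma holds over the reals, whatever the type of the
  representation, because the operator has a real eigenvalue.\<close>

lemma real_symmetric_schur:
  assumes U: "real_irreducible G U" and f: "linear f" and sym: "\<And>x y. f x \<bullet> y = x \<bullet> f y"
    and eq: "equivariant G f" and fU: "\<And>x. x \<in> U \<Longrightarrow> f x \<in> U"
  obtains \<beta> where "\<And>x. x \<in> U \<Longrightarrow> f x = \<beta> *\<^sub>R x"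
proof -
  have S: "subspace U" and U0: "U \<noteq> {0}" using U by (auto simp: real_irreducible_def real_invariant_def)
  obtain x \<beta> where x: "x \<in> U" "norm x = 1" "f x = \<beta> *\<^sub>R x"
    using symmetric_max_eigenvector[OF f sym S fU U0] by blast
  let ?W = "{y \<in> U. f y = \<beta> *\<^sub>R y}"
  have "subspace ?W" using S f by (auto simp: subspace_def linear_0 linear_add linear_scale scaleR_add_right)
  moreover have "perm_matrix g *v y \<in> ?W" if "g \<in> G" "y \<in> ?W" for g y
    using that U eq by (auto simp: real_irreducible_def real_invariant_def equivariant_def matrix_vector_mult_scaleR)
  ultimately have "real_invariant G ?W" by (auto simp: real_invariant_def)
  moreover have "x \<noteq> 0" using x(2) by auto
  then have "?W \<noteq> {0}" using x by blast
  ultimately have "?W = U" using U unfolding real_irreducible_def by blast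
  then show ?thesis using that by blast
qed

text \<open>Schur's lemma over the reals: the kernel of an intertwiner meets an irreducible representation in
  an invariant subspace.\<close>

lemma real_equivariant_kernel:
  assumes U: "real_irreducible G U" and f: "linear f" "equivariant G f" and u: "u \<in> U" "f u \<noteq> 0"
    and x: "x \<in> U" "f x = 0"
  shows "x = 0"
proof -
  let ?K = "{y \<in> U. f y = 0}"
  have "subspace ?K" using real_irreducible_subspace[OF U] f(1)
    by (auto simp: subspace_def linear_0 linear_add linear_scale)
  then have "real_invariant G ?K"
    using U f(2) by (auto simp: real_irreducible_def real_invariant_def equivariant_def)
  then have "?K = {0} \<or> ?K = U" using U unfolding real_irreducible_def by blast
  then show ?thesis using u x by blast
qed

lemma real_equivariant_image:
  assumes U: "real_irreducible G U" and f: "linear f" "equivariant G f" and u: "u \<in> U" "f u \<noteq> 0"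
  shows "real_irreducible G (f ` U)" and "dim (f ` U) = dim U"
proof -
  have S: "subspace U" by (rule real_irreducible_subspace[OF U])
  have inj: "inj_on f U"
  proof (rule inj_onI)
    fix x y assume "x \<in> U" "y \<in> U" "f x = f y"
    then show "x = y"
      using real_equivariant_kernel[OF U f u, of "x - y"] subspace_diff[OF S] linear_diff[OF f(1)] by auto
  qed
  then show "dim (f ` U) = dim U"
    by (intro dim_image_eq f(1)) (simp add: span_eq_iff[THEN iffD2, OF S])
  have inv: "\<And>g v. g \<in> G \<Longrightarrow> v \<in> U \<Longrightarrow> perm_matrix g *v v \<in> U"
    using U by (auto simp: real_irreducible_def real_invariant_def)
  have eq: "\<And>g v. g \<in> G \<Longrightarrow> f (perm_matrix g *v v) = perm_matrix g *v f v"
    using f(2) by (auto simp: equivariant_def)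
  have "real_invariant G (f ` U)"
    unfolding real_invariant_def using linear_subspace_image[OF f(1) S] inv by (auto simp flip: eq)
  moreover have "f ` U \<noteq> {0}" using u by auto
  moreover have "W = {0} \<or> W = f ` U" if W: "real_invariant G W" "W \<subseteq> f ` U" for W
  proof -
    let ?V = "{x \<in> U. f x \<in> W}"
    have "subspace W" using W(1) by (simp add: real_invariant_def)
    then have "subspace ?V"
      using S f(1) by (auto simp: subspace_def linear_0 linear_add linear_scale)
    moreover have "perm_matrix g *v x \<in> ?V" if "g \<in> G" "x \<in> ?V" for g x
      using that inv eq W(1) by (auto simp: real_invariant_def)
    ultimately have "real_invariant G ?V" by (auto simp: real_invariant_def)
    then have "?V = {0} \<or> ?V = U" using U unfolding real_irreducible_def by blast
    moreover have "W = f ` ?V" using W(2) by auto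
    ultimately show ?thesis using linear_0[OF f(1)] by auto
  qed
  ultimately show "real_irreducible G (f ` U)" unfolding real_irreducible_def by blast
qed

text \<open>The orbit of \<open>u\<close> under the commutant of the representation. For a nonzero \<open>u\<close> in an irreducible
  representation \<open>U\<close> it is a model of the space of homomorphisms from \<open>U\<close> to the whole space,
  and it meets every eigenspace of an invariant matrix that contains a copy of \<open>U\<close>.\<close>

definition commutant_orbit :: "('p \<Rightarrow> 'p) set \<Rightarrow> real ^ 'p \<Rightarrow> (real ^ 'p) set" where
  "commutant_orbit G u = {f u | f. linear f \<and> equivariant G f}"

lemma commutant_orbitI: "linear f \<Longrightarrow> equivariant G f \<Longrightarrow> f u \<in> commutant_orbit G u"
  unfolding commutant_orbit_def by blast

lemma subspace_commutant_orbit: "subspace (commutant_orbit G u)"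
  unfolding subspace_def
proof (intro conjI ballI allI)
  have "linear (\<lambda>x :: real ^ 'a. 0 :: real ^ 'a)" "equivariant G (\<lambda>x :: real ^ 'a. 0)"
    by (auto simp: equivariant_def linear_iff)
  then show "0 \<in> commutant_orbit G u" by (rule commutant_orbitI)
  fix x y assume "x \<in> commutant_orbit G u" "y \<in> commutant_orbit G u"
  then obtain f h where f: "linear f" "equivariant G f" "x = f u" and h: "linear h" "equivariant G h" "y = h u"
    by (auto simp: commutant_orbit_def)
  have "linear (\<lambda>x. f x + h x)" "equivariant G (\<lambda>x. f x + h x)"
    using f h by (auto simp: equivariant_def linear_compose_add matrix_vector_right_distrib)
  then show "x + y \<in> commutant_orbit G u" unfolding f(3) h(3) by (rule commutant_orbitI)
next
  fix c x assume "x \<in> commutant_orbit G u"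
  then obtain f where f: "linear f" "equivariant G f" "x = f u" by (auto simp: commutant_orbit_def)
  have "linear (\<lambda>x. c *\<^sub>R f x)" "equivariant G (\<lambda>x. c *\<^sub>R f x)"
    using f by (auto simp: equivariant_def linear_compose_scale_right matrix_vector_mult_scaleR)
  then show "c *\<^sub>R x \<in> commutant_orbit G u" unfolding f(3) by (rule commutant_orbitI)
qed

text \<open>The reason for nets in commutant orbits: at each of their nonzero points there is a copy of \<open>U\<close>
  to average over.\<close>

lemma commutant_orbit_irreducible:
  assumes U: "real_irreducible G U" and u: "u \<in> U" and y: "y \<in> commutant_orbit G u" "y \<noteq> 0"
  obtains Y where "real_irreducible G Y" "y \<in> Y" "dim Y = dim U"
proof -
  obtain f where f: "linear f" "equivariant G f" "y = f u" using y by (auto simp: commutant_orbit_def)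
  then show ?thesis
    using that[of "f ` U"] real_equivariant_image[OF U f(1,2) u] u y(2) by auto
qed

section \<open>Complex representations\<close>

abbreviation clinear :: "(complex ^ 'p \<Rightarrow> complex ^ 'p) \<Rightarrow> bool" where
  "clinear \<equiv> Vector_Spaces.linear (*s) (*s)"

lemma clinearI:
  assumes "\<And>x y. f (x + y) = f x + f y" "\<And>c x. f (c *s x) = c *s f x"
  shows "clinear f"
  using assms by (intro Vector_Spaces.linear_iff[THEN iffD2] conjI allI vec.vector_space_axioms)

text \<open>\<open>krylov f v p\<close> is $p(f)\,v$ for a polynomial $p$ with complex coefficients.\<close>

definition krylov :: "(complex ^ 'p \<Rightarrow> complex ^ 'p) \<Rightarrow> complex ^ 'p \<Rightarrow> complex poly \<Rightarrow> complex ^ 'p" where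
  "krylov f v p = fold_coeffs (\<lambda>a w. a *s v + f w) p 0"

lemma krylov_0 [simp]: "krylov f v 0 = 0"
  by (simp add: krylov_def)

lemma krylov_pCons: "clinear f \<Longrightarrow> krylov f v (pCons a p) = a *s v + f (krylov f v p)"
  by (cases "p = 0"; cases "a = 0") (auto simp: krylov_def vec.linear_0)

lemma krylov_add: "clinear f \<Longrightarrow> krylov f v (p + q) = krylov f v p + krylov f v q"
  by (induction p q rule: poly_induct2)
     (auto simp: krylov_pCons vec.linear_add vector_sadd_rdistrib algebra_simps)

lemma krylov_smult: "clinear f \<Longrightarrow> krylov f v (smult c p) = c *s krylov f v p"
  by (induction p) (auto simp: krylov_pCons vec.linear_scale vector_add_ldistrib vector_smult_assoc)

lemma krylov_in:
  assumes f: "clinear f" and V: "vec.subspace V" "\<And>x. x \<in> V \<Longrightarrow> f x \<in> V" and v: "v \<in> V"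
  shows "krylov f v p \<in> V"
  by (induction p)
     (auto simp: krylov_pCons[OF f] intro!: vec.subspace_0 vec.subspace_add vec.subspace_scale V v)

lemma krylov_monom: "clinear f \<Longrightarrow> krylov f v (monom c i) = c *s (f ^^ i) v"
  by (induction i) (auto simp: monom_0 monom_Suc krylov_pCons vec.linear_0 vec.linear_scale)

lemma krylov_sum: "clinear f \<Longrightarrow> krylov f v (\<Sum>i\<in>I. p i) = (\<Sum>i\<in>I. krylov f v (p i))"
  by (induction I rule: infinite_finite_induct) (auto simp: krylov_add)

lemma krylov_annihilator_exists:
  fixes f :: "complex ^ 'p \<Rightarrow> complex ^ 'p"
  assumes f: "clinear f"
  obtains p where "p \<noteq> 0" "krylov f v p = 0"
proof -
  let ?w = "\<lambda>i. (f ^^ i) v" and ?I = "{..CARD('p)}"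
  show ?thesis
  proof (cases "inj_on ?w ?I")
    case False
    then obtain i j where ij: "i \<noteq> j" "?w i = ?w j" by (auto simp: inj_on_def)
    have "krylov f v (monom 1 i + monom (- 1) j) = 0"
      using ij(2) by (simp only: krylov_add[OF f] krylov_monom[OF f]) (simp add: vec_eq_iff)
    moreover have "coeff (monom 1 i + monom (- 1) j) i = (1 :: complex)"
      using ij(1) by simp
    then have "monom 1 i + monom (- 1) j \<noteq> (0 :: complex poly)" by force
    ultimately show ?thesis using that by blast
  next
    case True
    have "card (?w ` ?I) = CARD('p) + 1" by (simp add: card_image[OF True])
    moreover have "card (?w ` ?I) \<le> CARD('p)" if "vec.independent (?w ` ?I)"
      using vec.independent_card_le_dim[OF subset_UNIV that] unfolding vec_dim_card .
    ultimately have "vec.dependent (?w ` ?I)" by force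
    then obtain u x where u: "x \<in> ?w ` ?I" "u x \<noteq> 0" "(\<Sum>x\<in>?w ` ?I. u x *s x) = 0"
      by (subst (asm) vec.dependent_finite) auto
    define p where "p = (\<Sum>i\<in>?I. monom (u (?w i)) i)"
    have "krylov f v p = (\<Sum>i\<in>?I. u (?w i) *s ?w i)"
      by (simp add: p_def krylov_sum[OF f] krylov_monom[OF f])
    also have "\<dots> = 0" using u(3) by (simp add: sum.reindex[OF True])
    finally have "krylov f v p = 0" .
    moreover obtain i where i: "i \<in> ?I" "x = ?w i" using u(1) by blast
    have "coeff p i = u (?w i)" using i(1) by (simp add: p_def coeff_sum)
    then have "p \<noteq> 0" using u(2) i(2) by force
    ultimately show ?thesis using that by blast
  qed
qed

text \<open>Over the complex numbers a polynomial of least degree that annihilates a nonzero vector has a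
  linear factor, and the cofactor turns the vector into an eigenvector.\<close>

lemma complex_eigenvector:
  assumes f: "clinear f" and V: "vec.subspace V" "\<And>x. x \<in> V \<Longrightarrow> f x \<in> V" and v: "v \<in> V" "v \<noteq> 0"
  obtains w a where "w \<in> V" "w \<noteq> 0" "f w = a *s w"
proof -
  obtain p0 where "p0 \<noteq> 0 \<and> krylov f v p0 = 0" using krylov_annihilator_exists[OF f] by blast
  from ex_has_least_nat[of "\<lambda>p. p \<noteq> 0 \<and> krylov f v p = 0", OF this, of degree]
  obtain p where p: "p \<noteq> 0" "krylov f v p = 0"
    and least: "\<And>q. q \<noteq> 0 \<Longrightarrow> krylov f v q = 0 \<Longrightarrow> degree p \<le> degree q" by blast
  have "degree p \<noteq> 0"
  proof
    assume "degree p = 0"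
    then obtain c where c: "p = [:c:]" by (rule degree_eq_zeroE)
    then have "c *s v = 0" using p(2) krylov_pCons[OF f, of v c 0] by (simp add: vec.linear_0[OF f])
    then show False using v(2) p(1) c by (simp add: vector_mul_eq_0)
  qed
  then have "\<not> constant (poly p)" by (simp add: constant_degree)
  then obtain a where "poly p a = 0" using fundamental_theorem_of_algebra by blast
  then obtain q where q: "p = [:- a, 1:] * q" by (auto simp: poly_eq_0_iff_dvd dvd_def)
  have "q \<noteq> 0" using p(1) q by auto
  then have "degree p = Suc (degree q)" unfolding q by (subst degree_mult_eq) auto
  then have "krylov f v q \<noteq> 0" using least[OF \<open>q \<noteq> 0\<close>] by auto
  moreover have "p = pCons 0 q + smult (- a) q" unfolding q by simp
  then have "krylov f v p = f (krylov f v q) + (- a) *s krylov f v q"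
    by (simp only: krylov_add[OF f] krylov_pCons[OF f] krylov_smult[OF f]) simp
  then have "f (krylov f v q) = a *s krylov f v q"
    using p(2) by (simp add: vec_eq_iff)
  ultimately show ?thesis using that krylov_in[OF f V v(1)] by blast
qed

lemma irreducible_subrepD:
  assumes "irreducible_subrep G V"
  shows "vec.subspace V" "\<And>g v. g \<in> G \<Longrightarrow> v \<in> V \<Longrightarrow> perm_matrix g *v v \<in> V" "V \<noteq> {0}"
    "\<And>W. invariant_subspace G W \<Longrightarrow> W \<subseteq> V \<Longrightarrow> W = {0} \<or> W = V"
  using assms unfolding irreducible_subrep_def invariant_subspace_def by blast+

lemma perm_matrix_scale: "perm_matrix g *v (c *s v) = c *s (perm_matrix g *v v)"
  for v :: "complex ^ 'p"
  by (simp add: matrix_vector_mult_def vec_eq_iff sum_distrib_left algebra_simps)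

lemma complex_schur:
  assumes V: "irreducible_subrep G V" and f: "clinear f" "\<And>v. v \<in> V \<Longrightarrow> f v \<in> V"
    and eq: "\<And>g v. g \<in> G \<Longrightarrow> v \<in> V \<Longrightarrow> f (perm_matrix g *v v) = perm_matrix g *v f v"
  obtains a where "\<And>v. v \<in> V \<Longrightarrow> f v = a *s v"
proof -
  note V' = irreducible_subrepD[OF V]
  obtain v where "v \<in> V" "v \<noteq> 0" using V'(3) vec.subspace_0[OF V'(1)] by blast
  then obtain w a where w: "w \<in> V" "w \<noteq> 0" "f w = a *s w"
    using complex_eigenvector[OF f(1) V'(1) f(2)] by blast
  let ?W = "{x \<in> V. f x = a *s x}"
  have "vec.subspace ?W"
    using V'(1) f(1) unfolding vec.subspace_def
    by (auto simp: vec.linear_0 vec.linear_add vec.linear_scale vector_add_ldistrib vector_smult_assoc mult.commute)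
  then have "invariant_subspace G ?W"
    unfolding invariant_subspace_def using V'(2) eq by (auto simp: perm_matrix_scale)
  then have "?W = {0} \<or> ?W = V" by (rule V'(4)) auto
  then have "?W = V" using w by blast
  then show ?thesis using that by blast
qed

text \<open>Kernel and image of a nonzero intertwiner are invariant, so it is an equivalence.\<close>

lemma complex_intertwiner_bij:
  assumes V: "irreducible_subrep G V" and W: "irreducible_subrep G W"
    and f: "clinear f" "\<And>v. v \<in> V \<Longrightarrow> f v \<in> W"
    and eq: "\<And>g v. g \<in> G \<Longrightarrow> v \<in> V \<Longrightarrow> f (perm_matrix g *v v) = perm_matrix g *v f v"
    and v: "v \<in> V" "f v \<noteq> 0"
  shows "equivalent_subreps G V W"
proof -
  note V' = irreducible_subrepD[OF V] and W' = irreducible_subrepD[OF W]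
  let ?K = "{x \<in> V. f x = 0}"
  have "vec.subspace ?K"
    using V'(1) f(1) unfolding vec.subspace_def
    by (auto simp: vec.linear_0 vec.linear_add vec.linear_scale)
  then have "invariant_subspace G ?K"
    unfolding invariant_subspace_def using V'(2) eq by auto
  then have "?K = {0} \<or> ?K = V" by (rule V'(4)) auto
  then have K: "?K = {0}" using v by blast
  have "inj_on f V"
  proof (rule inj_onI)
    fix x y assume "x \<in> V" "y \<in> V" "f x = f y"
    then have "x - y \<in> ?K" using vec.subspace_diff[OF V'(1)] vec.linear_diff[OF f(1)] by auto
    then show "x = y" using K by auto
  qed
  moreover have "invariant_subspace G (f ` V)"
    unfolding invariant_subspace_def
    using vec.linear_subspace_image[OF f(1) V'(1)] V'(2) by (auto simp flip: eq)
  then have "f ` V = {0} \<or> f ` V = W" by (rule W'(4)) (use f(2) in auto)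
  then have "f ` V = W" using v by auto
  ultimately show ?thesis
    unfolding equivalent_subreps_def bij_betw_def using f(1) eq by blast
qed

lemma active_irreps_members:
  assumes i: "i \<in> active_irreps G" and V: "V \<in> i"
  shows "irreducible_subrep G V" and "W \<in> i \<longleftrightarrow> irreducible_subrep G W \<and> equivalent_subreps G V W"
proof -
  let ?R = "{(V, W). irreducible_subrep G V \<and> irreducible_subrep G W \<and> equivalent_subreps G V W}"
  obtain U where U: "irreducible_subrep G U" "i = ?R `` {U}"
    using i unfolding active_irreps_def by (auto elim: quotientE)
  then have UV: "(U, V) \<in> ?R" using V by auto
  then show V': "irreducible_subrep G V" by auto
  have "i = ?R `` {V}" using equiv_class_eq[OF equiv_equivalent_subreps UV] U(2) by simp
  then show "W \<in> i \<longleftrightarrow> irreducible_subrep G W \<and> equivalent_subreps G V W" using V' by auto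
qed

lemma irreducible_in_active:
  assumes "irreducible_subrep G V"
  obtains i where "i \<in> active_irreps G" "V \<in> i"
proof -
  let ?R = "{(V, W). irreducible_subrep G V \<and> irreducible_subrep G W \<and> equivalent_subreps G V W}"
  have "(V, V) \<in> ?R"
    using equiv_equivalent_subreps[of G] assms by (auto simp: equiv_def refl_on_def)
  moreover have "?R `` {V} \<in> active_irreps G"
    unfolding active_irreps_def using assms by (intro quotientI) simp
  ultimately show ?thesis using that by blast
qed

lemma irrep_dim_eq:
  assumes i: "i \<in> active_irreps G" and V: "V \<in> i"
  shows "irrep_dim i = vec.dim V"
proof -
  have "(SOME V. V \<in> i) \<in> i" using V by (rule someI)
  then have "equivalent_subreps G V (SOME V. V \<in> i)" using active_irreps_members[OF i V] by blast
  then obtain f where f: "clinear f" "bij_betw f V (SOME V. V \<in> i)"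
    unfolding equivalent_subreps_def by blast
  have "vec.span V = V" using irreducible_subrepD(1)[OF active_irreps_members(1)[OF i V]] by simp
  then have "vec.dim (f ` V) = vec.dim V"
    using f by (intro vec.dim_image_eq) (simp_all only: bij_betw_def)
  then show ?thesis using f(2) by (simp add: irrep_dim_def bij_betw_def)
qed

text \<open>Uniqueness of the summands makes the component maps of a direct sum linear and equivariant.\<close>

lemma irreducible_decomposition_components:
  fixes D :: "(complex ^ 'p) set set"
  assumes D: "irreducible_decomposition G D"
  obtains c where "\<And>W. W \<in> D \<Longrightarrow> clinear (c W)" "\<And>W v. W \<in> D \<Longrightarrow> c W v \<in> W"
    "\<And>W. W \<in> D \<Longrightarrow> equivariant G (c W)" "\<And>v. v = (\<Sum>W\<in>D. c W v)"
proof -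
  define d where "d v = (THE f. f \<in> (\<Pi>\<^sub>E W\<in>D. W) \<and> v = (\<Sum>W\<in>D. f W))" for v
  have ex1: "\<exists>!f. f \<in> (\<Pi>\<^sub>E W\<in>D. W) \<and> v = (\<Sum>W\<in>D. f W)" for v
    using D by (simp add: irreducible_decomposition_def)
  have d: "d v \<in> (\<Pi>\<^sub>E W\<in>D. W)" "v = (\<Sum>W\<in>D. d v W)" for v
    using theI'[OF ex1[of v]] by (auto simp: d_def)
  have dW: "d v W \<in> W" if "W \<in> D" for v W using d(1) that by auto
  have d_eq: "d v W = f W" if "W \<in> D" "\<And>W. W \<in> D \<Longrightarrow> f W \<in> W" "v = (\<Sum>W\<in>D. f W)" for f v W
  proof -
    have "restrict f D \<in> (\<Pi>\<^sub>E W\<in>D. W) \<and> v = (\<Sum>W\<in>D. restrict f D W)"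
      using that(2,3) by (auto intro!: sum.cong)
    then have "d v = restrict f D" unfolding d_def by (rule the1_equality[OF ex1])
    then show ?thesis using that(1) by simp
  qed
  have irr: "vec.subspace W" "\<And>g v. g \<in> G \<Longrightarrow> v \<in> W \<Longrightarrow> perm_matrix g *v v \<in> W" if "W \<in> D" for W
  proof -
    have "irreducible_subrep G W" using D that by (simp add: irreducible_decomposition_def)
    then show "vec.subspace W" "\<And>g v. g \<in> G \<Longrightarrow> v \<in> W \<Longrightarrow> perm_matrix g *v v \<in> W"
      by (rule irreducible_subrepD)+
  qed
  have "clinear (\<lambda>v. d v W)" if W: "W \<in> D" for W
  proof (rule clinearI)
    fix u v :: "complex ^ 'p" and r
    show "d (u + v) W = d u W + d v W"
    proof (rule d_eq[OF W, of "\<lambda>W. d u W + d v W"])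
      show "u + v = (\<Sum>W\<in>D. d u W + d v W)" unfolding sum.distrib d(2)[symmetric] ..
    qed (use dW irr in \<open>auto intro: vec.subspace_add\<close>)
    show "d (r *s v) W = r *s d v W"
    proof (rule d_eq[OF W, of "\<lambda>W. r *s d v W"])
      show "r *s v = (\<Sum>W\<in>D. r *s d v W)" unfolding vec.scale_sum_right[symmetric] d(2)[symmetric] ..
    qed (use dW irr in \<open>auto intro: vec.subspace_scale\<close>)
  qed
  moreover have "equivariant G (\<lambda>v. d v W)" if W: "W \<in> D" for W
    unfolding equivariant_def
  proof (intro ballI allI)
    fix g v assume g: "g \<in> G"
    show "d (perm_matrix g *v v) W = perm_matrix g *v d v W"
    proof (rule d_eq[OF W, of "\<lambda>W. perm_matrix g *v d v W"])
      show "perm_matrix g *v v = (\<Sum>W\<in>D. perm_matrix g *v d v W)"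
        unfolding vec.linear_sum[OF matrix_vector_mul_linear_gen, symmetric] d(2)[symmetric] ..
    qed (use dW irr g in auto)
  qed
  ultimately show ?thesis using that[of "\<lambda>W v. d v W"] dW d(2) by blast
qed

text \<open>By Schur's lemma an equivariant endomorphism composed with the projection to a summand \<open>W\<close>
  sends \<open>v \<in> V\<close> to a multiple of one fixed vector, which is zero unless \<open>W\<close> is equivalent to \<open>V\<close>.\<close>

lemma complex_commutant_orbit_span:
  fixes G :: "('p::finite \<Rightarrow> 'p) set"
  assumes G: "subgroup G (BijGroup UNIV)" and i: "i \<in> active_irreps G" and V: "V \<in> i" and v: "v \<in> V"
  obtains B where "finite B" "card B \<le> irrep_mult G i"
    "\<And>F. clinear F \<Longrightarrow> equivariant G F \<Longrightarrow> F v \<in> vec.span B"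
proof -
  define D where "D = (SOME D. irreducible_decomposition G D)"
  have D: "irreducible_decomposition G D"
    unfolding D_def using irreducible_decomposition_exists[OF G] by (rule someI_ex)
  have fin: "finite D" and Dirr: "\<And>W. W \<in> D \<Longrightarrow> irreducible_subrep G W"
    using D by (auto simp: irreducible_decomposition_def)
  obtain c where c: "\<And>W. W \<in> D \<Longrightarrow> clinear (c W)" "\<And>W v. W \<in> D \<Longrightarrow> c W v \<in> W"
    "\<And>W. W \<in> D \<Longrightarrow> equivariant G (c W)" "\<And>v. v = (\<Sum>W\<in>D. c W v)"
    using irreducible_decomposition_components[OF D] by metis
  have Virr: "irreducible_subrep G V" by (rule active_irreps_members(1)[OF i V])
  have "\<exists>b. \<forall>F. clinear F \<longrightarrow> equivariant G F \<longrightarrow> c W (F v) \<in> vec.span {b}" if W: "W \<in> i \<inter> D" for W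
  proof -
    have "equivalent_subreps G W V" using active_irreps_members(2)[OF i, of W V] W V by blast
    then obtain h where h: "clinear h" "bij_betw h W V"
      "\<And>g w. g \<in> G \<Longrightarrow> w \<in> W \<Longrightarrow> h (perm_matrix g *v w) = perm_matrix g *v h w"
      unfolding equivalent_subreps_def by blast
    obtain b where b: "b \<in> W" "h b = v" using h(2) v by (metis bij_betw_iff_bijections)
    have "c W (F v) \<in> vec.span {b}" if F: "clinear F" "equivariant G F" for F
    proof -
      have cW: "clinear (c W)" "\<And>x. c W x \<in> W" "equivariant G (c W)" using c W by auto
      have "clinear (\<lambda>x. h (c W (F x)))"
        using F(1) cW(1) h(1) by (intro clinearI) (simp_all add: vec.linear_add vec.linear_scale)
      moreover have "h (c W (F x)) \<in> V" for x using h(2) cW(2) by (auto simp: bij_betw_def)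
      moreover have "h (c W (F (perm_matrix g *v x))) = perm_matrix g *v h (c W (F x))"
        if "g \<in> G" for g x using that F(2) cW(2,3) h(3) by (simp add: equivariant_def)
      ultimately obtain a where "\<And>x. x \<in> V \<Longrightarrow> h (c W (F x)) = a *s x"
        using complex_schur[OF Virr, of "\<lambda>x. h (c W (F x))"] by blast
      then have "h (c W (F v)) = h (a *s b)" using v b(2) by (simp add: vec.linear_scale[OF h(1)])
      moreover have "a *s b \<in> W" using W irreducible_subrepD(1)[OF Dirr] b(1) by (auto intro: vec.subspace_scale)
      ultimately have "c W (F v) = a *s b" using h(2) cW(2) by (auto simp: bij_betw_def inj_on_def)
      then show ?thesis by (simp add: vec.span_scale vec.span_base)
    qed
    then show ?thesis by blast
  qed
  then obtain b where b: "\<And>W F. W \<in> i \<inter> D \<Longrightarrow> clinear F \<Longrightarrow> equivariant G F \<Longrightarrow> c W (F v) \<in> vec.span {b W}"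
    by metis
  have "F v \<in> vec.span (b ` (i \<inter> D))" if F: "clinear F" "equivariant G F" for F
  proof -
    have "c W (F v) \<in> vec.span (b ` (i \<inter> D))" if W: "W \<in> D" for W
    proof (cases "W \<in> i")
      case True
      then show ?thesis using b[OF _ F, of W] W vec.span_mono[of "{b W}" "b ` (i \<inter> D)"] by auto
    next
      case False
      have "c W (F v) = 0"
      proof (rule ccontr)
        assume "c W (F v) \<noteq> 0"
        then have "equivalent_subreps G V W"
          using c(2)[OF W] c(3)[OF W] F(2) v
          by (intro complex_intertwiner_bij[OF Virr Dirr[OF W], of "\<lambda>x. c W (F x)" v])
             (auto simp: equivariant_def vec.linear_add[OF F(1)] vec.linear_scale[OF F(1)]
               vec.linear_add[OF c(1)[OF W]] vec.linear_scale[OF c(1)[OF W]] intro: clinearI)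
        then show False using False active_irreps_members(2)[OF i V] Dirr[OF W] by blast
      qed
      then show ?thesis by (simp add: vec.span_zero)
    qed
    then have "(\<Sum>W\<in>D. c W (F v)) \<in> vec.span (b ` (i \<inter> D))" by (rule vec.span_sum)
    then show ?thesis using c(4)[of "F v"] by simp
  qed
  moreover have "card (b ` (i \<inter> D)) \<le> irrep_mult G i"
    unfolding irrep_mult_def D_def[symmetric] using fin by (intro card_image_le) auto
  ultimately show ?thesis using that[of "b ` (i \<inter> D)"] fin by blast
qed

section \<open>Complexification of real representations\<close>

definition cpx :: "real ^ 'p \<Rightarrow> complex ^ 'p" where
  "cpx x = (\<chi> i. of_real (x $ i))"

definition Re_vec :: "complex ^ 'p \<Rightarrow> real ^ 'p" where
  "Re_vec v = (\<chi> i. Re (v $ i))"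

definition Im_vec :: "complex ^ 'p \<Rightarrow> real ^ 'p" where
  "Im_vec v = (\<chi> i. Im (v $ i))"

definition cnj_vec :: "complex ^ 'p \<Rightarrow> complex ^ 'p" where
  "cnj_vec v = (\<chi> i. cnj (v $ i))"

lemmas cpx_defs = cpx_def Re_vec_def Im_vec_def cnj_vec_def vec_eq_iff complex_eq_iff

lemma cpx_simps [simp]:
  "Re_vec (cpx x) = x" "Im_vec (cpx x) = 0" "cnj_vec (cpx x) = cpx x" "cnj_vec (cnj_vec v) = v"
  "cpx 0 = 0" "cpx (x + y) = cpx x + cpx y" "cpx (r *\<^sub>R x) = of_real r *s cpx x"
  "Re_vec (v + w) = Re_vec v + Re_vec w" "Im_vec (v + w) = Im_vec v + Im_vec w"
  "Re_vec (c *s v) = Re c *\<^sub>R Re_vec v - Im c *\<^sub>R Im_vec v"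
  "Im_vec (c *s v) = Re c *\<^sub>R Im_vec v + Im c *\<^sub>R Re_vec v"
  "Re_vec 0 = 0" "Im_vec 0 = 0" "cnj_vec 0 = 0"
  "Re_vec (cnj_vec v) = Re_vec v" "Im_vec (cnj_vec v) = - Im_vec v"
  "cnj_vec (v + w) = cnj_vec v + cnj_vec w" "cnj_vec (c *s v) = cnj c *s cnj_vec v"
  by (auto simp: cpx_defs)

lemma cpx_Re_Im: "v = cpx (Re_vec v) + \<i> *s cpx (Im_vec v)"
  by (simp add: cpx_defs)

lemma cpx_inject [simp]: "cpx x = cpx y \<longleftrightarrow> x = y"
  by (metis cpx_simps(1))

lemma cpx_perm_matrix:
  assumes "bij g"
  shows "cpx (perm_matrix g *v x) = perm_matrix g *v cpx x"
    and "Re_vec (perm_matrix g *v v) = perm_matrix g *v Re_vec v"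
    and "Im_vec (perm_matrix g *v v) = perm_matrix g *v Im_vec v"
    and "cnj_vec (perm_matrix g *v v) = perm_matrix g *v cnj_vec v"
  by (simp_all add: cpx_defs perm_matrix_component[OF assms])

definition complexification :: "(real ^ 'p) set \<Rightarrow> (complex ^ 'p) set" where
  "complexification U = {v. Re_vec v \<in> U \<and> Im_vec v \<in> U}"

lemma complexification_subspace: "subspace U \<Longrightarrow> vec.subspace (complexification U)"
  unfolding vec.subspace_def complexification_def
  by (auto intro: subspace_0 subspace_add subspace_diff subspace_scale)

lemma complexification_invariant:
  assumes G: "subgroup G (BijGroup UNIV)" and U: "real_invariant G U"
  shows "invariant_subspace G (complexification U)"
  unfolding invariant_subspace_def
  using U complexification_subspace subgroup_Bij(1)[OF G]
  by (auto simp: real_invariant_def complexification_def cpx_perm_matrix)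

lemma cpx_in_complexification: "subspace U \<Longrightarrow> cpx x \<in> complexification U \<longleftrightarrow> x \<in> U"
  by (auto simp: complexification_def subspace_0)

text \<open>Real vectors gain no linear relations over the complex numbers. This is how a real dimension is
  bounded by the size of a complex spanning set.\<close>

lemma cpx_independent:
  assumes B: "independent B" shows "vec.independent (cpx ` B)"
proof -
  have fin: "finite B" using B independent_imp_finite by blast
  have inj: "inj_on cpx B" by (simp add: inj_on_def)
  have "c (cpx b) = 0" if c: "(\<Sum>v\<in>cpx ` B. c v *s v) = 0" and b: "b \<in> B" for c b
  proof -
    have sum0: "(\<Sum>b\<in>B. c (cpx b) *s cpx b) = 0" using c by (simp add: sum.reindex[OF inj])
    have "(\<Sum>b\<in>B. Re (c (cpx b)) *\<^sub>R b) = Re_vec (\<Sum>b\<in>B. c (cpx b) *s cpx b)"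
      by (simp add: cpx_defs)
    moreover have "(\<Sum>b\<in>B. Im (c (cpx b)) *\<^sub>R b) = Im_vec (\<Sum>b\<in>B. c (cpx b) *s cpx b)"
      by (simp add: cpx_defs)
    ultimately have "(\<Sum>b\<in>B. Re (c (cpx b)) *\<^sub>R b) = 0" "(\<Sum>b\<in>B. Im (c (cpx b)) *\<^sub>R b) = 0"
      using sum0 by simp_all
    then have "Re (c (cpx b)) = 0" "Im (c (cpx b)) = 0"
      using B b fin independentD[of B B "\<lambda>b. Re (c (cpx b))" b] independentD[of B B "\<lambda>b. Im (c (cpx b))" b]
      by auto
    then show ?thesis by (simp add: complex_eq_iff)
  qed
  then show ?thesis unfolding vec.independent_explicit using fin by blast
qed

lemma dim_complexification_le:
  assumes U: "subspace U" shows "vec.dim (complexification U) \<le> dim U"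
proof -
  obtain B where B: "B \<subseteq> U" "independent B" "U \<subseteq> span B" "card B = dim U"
    using basis_exists by blast
  have fin: "finite B" using B(2) independent_imp_finite by blast
  have cB: "cpx x \<in> vec.span (cpx ` B)" if "x \<in> span B" for x
    using that
  proof (induction rule: span_induct_alt)
    case base then show ?case by (simp add: vec.span_zero)
  next
    case (step c x y)
    then show ?case by (simp add: vec.span_add vec.span_scale vec.span_base)
  qed
  have "complexification U \<subseteq> vec.span (cpx ` B)"
  proof
    fix v assume "v \<in> complexification U"
    then have "cpx (Re_vec v) \<in> vec.span (cpx ` B)" "cpx (Im_vec v) \<in> vec.span (cpx ` B)"
      using B(3) cB by (auto simp: complexification_def)
    then show "v \<in> vec.span (cpx ` B)"
      by (subst cpx_Re_Im) (intro vec.span_add vec.span_scale)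
  qed
  then have "vec.dim (complexification U) \<le> card (cpx ` B)" using fin by (intro vec.dim_le_card) auto
  also have "\<dots> \<le> dim U" using card_image_le[OF fin, of cpx] B(4) by simp
  finally show ?thesis .
qed

definition complexified_map :: "(real ^ 'p \<Rightarrow> real ^ 'p) \<Rightarrow> complex ^ 'p \<Rightarrow> complex ^ 'p" where
  "complexified_map f v = cpx (f (Re_vec v)) + \<i> *s cpx (f (Im_vec v))"

lemma complexified_map:
  assumes f: "linear f"
  shows "clinear (complexified_map f)"
    and "complexified_map f (cpx x) = cpx (f x)"
    and "complexified_map f (cnj_vec v) = cnj_vec (complexified_map f v)"
proof -
  show "clinear (complexified_map f)"
    by (rule clinearI)
       (simp_all add: complexified_map_def linear_add[OF f] linear_diff[OF f] linear_scale[OF f]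
         cpx_def vec_eq_iff complex_eq_iff algebra_simps)
  show "complexified_map f (cpx x) = cpx (f x)"
    by (simp add: complexified_map_def linear_0[OF f])
  show "complexified_map f (cnj_vec v) = cnj_vec (complexified_map f v)"
    by (simp add: complexified_map_def linear_neg[OF f]) (simp add: cpx_def vec_eq_iff)
qed

lemma complexified_map_equivariant:
  assumes G: "subgroup G (BijGroup UNIV)" and f: "equivariant G f"
  shows "equivariant G (complexified_map f)"
  using f subgroup_Bij(1)[OF G]
  by (auto simp: equivariant_def complexified_map_def cpx_perm_matrix matrix_vector_right_distrib perm_matrix_scale)

text \<open>A subspace closed under conjugation is spanned by its real points, and these form an invariant
  subspace of \<open>U\<close>.\<close>

lemma conjugation_closed_subrep:
  assumes G: "subgroup G (BijGroup UNIV)" and U: "real_irreducible G U"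
    and W: "invariant_subspace G W" "W \<subseteq> complexification U" "\<And>w. w \<in> W \<Longrightarrow> cnj_vec w \<in> W"
  shows "W = {0} \<or> W = complexification U"
proof -
  have sW: "vec.subspace W" using W(1) by (simp add: invariant_subspace_def)
  let ?R = "{x. cpx x \<in> W}"
  have "subspace ?R"
    using sW by (auto simp: subspace_def vec.subspace_0 vec.subspace_add vec.subspace_scale)
  then have "real_invariant G ?R"
    using W(1) subgroup_Bij(1)[OF G] by (auto simp: real_invariant_def invariant_subspace_def cpx_perm_matrix)
  moreover have "?R \<subseteq> U"
    using W(2) cpx_in_complexification[OF real_irreducible_subspace[OF U]] by auto
  ultimately have R: "?R = {0} \<or> ?R = U" using U unfolding real_irreducible_def by blast
  have parts: "Re_vec w \<in> ?R" "Im_vec w \<in> ?R" if "w \<in> W" for w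
  proof -
    have "cpx (Re_vec w) = (1 / 2) *s (w + cnj_vec w)" by (simp add: cpx_defs)
    then show "Re_vec w \<in> ?R" using sW W(3) that by (auto intro: vec.subspace_scale vec.subspace_add)
    have "cpx (Im_vec w) = (- \<i> / 2) *s (w - cnj_vec w)" by (simp add: cpx_defs)
    then show "Im_vec w \<in> ?R" using sW W(3) that by (auto intro: vec.subspace_scale vec.subspace_diff)
  qed
  from R show ?thesis
  proof
    assume "?R = {0}"
    then have "w = 0" if "w \<in> W" for w using parts[OF that] cpx_Re_Im[of w] by simp
    then show ?thesis using vec.subspace_0[OF sW] by blast
  next
    assume RU: "?R = U"
    have "w \<in> W" if "w \<in> complexification U" for w
    proof -
      have "cpx (Re_vec w) \<in> W" "cpx (Im_vec w) \<in> W" using that RU by (auto simp: complexification_def)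
      then show ?thesis by (subst cpx_Re_Im) (intro vec.subspace_add[OF sW] vec.subspace_scale[OF sW])
    qed
    then show ?thesis using W(2) by blast
  qed
qed

lemma complexification_constituent_exists:
  assumes G: "subgroup G (BijGroup UNIV)" and U: "real_irreducible G U"
  obtains i V where "i \<in> active_irreps G" "V \<in> i" "V \<subseteq> complexification U"
proof -
  have inv: "invariant_subspace G (complexification U)"
    using complexification_invariant[OF G] U by (auto simp: real_irreducible_def)
  from orthogonal_irreducible_decomposition[OF G this] obtain D where
    D: "\<And>W. W \<in> D \<Longrightarrow> irreducible_subrep G W \<and> W \<subseteq> complexification U"
    and dec: "\<And>v. v \<in> complexification U \<Longrightarrow> \<exists>f. (\<forall>W\<in>D. f W \<in> W) \<and> v = (\<Sum>W\<in>D. f W)"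
    by metis
  obtain u where u: "u \<in> U" "u \<noteq> 0"
    using U subspace_0[OF real_irreducible_subspace[OF U]] by (auto simp: real_irreducible_def)
  have "cpx u \<in> complexification U"
    using u cpx_in_complexification[OF real_irreducible_subspace[OF U]] by blast
  then obtain f where "cpx u = (\<Sum>W\<in>D. f W)" using dec by blast
  moreover have "cpx u \<noteq> 0" using u(2) cpx_inject[of u 0] by simp
  ultimately have "D \<noteq> {}" by auto
  then obtain V where V: "irreducible_subrep G V" "V \<subseteq> complexification U" using D by blast
  then show ?thesis using irreducible_in_active[OF V(1)] that by blast
qed

text \<open>The complexification of \<open>U\<close> is \<open>V\<close> or the direct sum of \<open>V\<close> and its conjugate. In the first
  case the commutant orbit of \<open>u\<close> has dimension at most $s_i$; in the second case its dimension is at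
  most $2 s_i$, but the dimension of \<open>U\<close> is $2 m_i$.\<close>

lemma commutant_orbit_dim_le:
  fixes G :: "('p::finite \<Rightarrow> 'p) set"
  assumes G: "subgroup G (BijGroup UNIV)" and U: "real_irreducible G U" and u: "u \<in> U"
    and i: "i \<in> active_irreps G" and V: "V \<in> i" and VU: "V \<subseteq> complexification U"
  shows "irrep_dim i \<le> dim U"
    and "dim (commutant_orbit G u) * irrep_dim i \<le> irrep_mult G i * dim U"
proof -
  have sU: "subspace U" by (rule real_irreducible_subspace[OF U])
  have Virr: "irreducible_subrep G V" by (rule active_irreps_members(1)[OF i V])
  note V' = irreducible_subrepD[OF Virr]
  have m: "irrep_dim i = vec.dim V" by (rule irrep_dim_eq[OF i V])
  have "vec.dim V \<le> vec.dim (complexification U)" using VU by (rule vec.dim_subset)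
  then have mk: "irrep_dim i \<le> dim U"
    using dim_complexification_le[OF sU] m by simp
  then show "irrep_dim i \<le> dim U" .
  obtain B where B: "B \<subseteq> commutant_orbit G u" "independent B" "card B = dim (commutant_orbit G u)"
    by (rule basis_exists[of "commutant_orbit G u"], rule that)
  have card_le: "dim (commutant_orbit G u) \<le> card C"
    if C: "finite C" "\<And>f. linear f \<Longrightarrow> equivariant G f \<Longrightarrow> cpx (f u) \<in> vec.span C" for C
  proof -
    have "cpx ` B \<subseteq> vec.span C" using B(1) C(2) by (auto simp: commutant_orbit_def)
    then have "card (cpx ` B) \<le> card C"
      using vec.independent_span_bound[OF C(1) cpx_independent[OF B(2)]] by blast
    moreover have "card (cpx ` B) = card B" by (rule card_image) (simp add: inj_on_def)
    ultimately show ?thesis using B(3) by simp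
  qed
  have cpx_u: "cpx u \<in> complexification U" using u cpx_in_complexification[OF sU] by blast
  show "dim (commutant_orbit G u) * irrep_dim i \<le> irrep_mult G i * dim U"
  proof (cases "V = complexification U")
    case True
    then have "cpx u \<in> V" using cpx_u by simp
    then obtain C where C: "finite C" "card C \<le> irrep_mult G i"
      "\<And>F. clinear F \<Longrightarrow> equivariant G F \<Longrightarrow> F (cpx u) \<in> vec.span C"
      using complex_commutant_orbit_span[OF G i V] by metis
    have "cpx (f u) \<in> vec.span C" if "linear f" "equivariant G f" for f
      using C(3)[OF complexified_map(1)[OF that(1)] complexified_map_equivariant[OF G that(2)]]
      by (simp add: complexified_map(2)[OF that(1)])
    then have "dim (commutant_orbit G u) \<le> irrep_mult G i" using card_le[OF C(1)] C(2) by force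
    then show ?thesis using mk by (rule mult_le_mono)
  next
    case False
    \<comment> \<open>\<open>V\<close> meets its conjugate trivially and their sum is the whole complexification\<close>
    let ?V' = "cnj_vec ` V"
    have conj_scale: "c *s cnj_vec v = cnj_vec (cnj c *s v)" for c v by simp
    have V's: "vec.subspace ?V'"
      unfolding vec.subspace_def
    proof (intro conjI ballI allI)
      show "0 \<in> ?V'" using vec.subspace_0[OF V'(1)] by (force intro: image_eqI[of _ _ 0])
      show "x + y \<in> ?V'" if "x \<in> ?V'" "y \<in> ?V'" for x y
        using that vec.subspace_add[OF V'(1)] by (auto simp flip: cpx_simps(17))
      show "c *s x \<in> ?V'" if "x \<in> ?V'" for c x
        using that vec.subspace_scale[OF V'(1)] unfolding image_iff by (metis conj_scale)
    qed
    have V'inv: "invariant_subspace G ?V'"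
      unfolding invariant_subspace_def using V's V'(2) subgroup_Bij(1)[OF G]
      by (auto simp flip: cpx_perm_matrix(4))
    have V'U: "?V' \<subseteq> complexification U"
      using VU subspace_neg[OF sU] by (auto simp: complexification_def)
    have Vinv: "invariant_subspace G V" using V' by (simp add: invariant_subspace_def)
    have "invariant_subspace G (V \<inter> ?V')"
      using Vinv V'inv by (auto simp: invariant_subspace_def vec.subspace_inter)
    moreover have "cnj_vec w \<in> V \<inter> ?V'" if "w \<in> V \<inter> ?V'" for w
      using that by auto
    moreover have "V \<inter> ?V' \<noteq> complexification U" using False VU by blast
    ultimately have inter: "V \<inter> ?V' = {0}"
      using conjugation_closed_subrep[OF G U, of "V \<inter> ?V'"] VU by blast
    let ?S = "{x + y | x y. x \<in> V \<and> y \<in> ?V'}"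
    have sum_sub: "vec.subspace ?S" by (rule vec.subspace_sums[OF V'(1) V's])
    have "perm_matrix g *v w \<in> ?S" if g: "g \<in> G" and w: "w \<in> ?S" for g w
    proof -
      obtain x y where "x \<in> V" "y \<in> ?V'" "w = x + y" using w by blast
      moreover from this have "perm_matrix g *v x \<in> V" "perm_matrix g *v y \<in> ?V'"
        using V'(2) V'inv g unfolding invariant_subspace_def by blast+
      ultimately show ?thesis by (auto simp: matrix_vector_right_distrib)
    qed
    then have "invariant_subspace G ?S" using sum_sub by (simp add: invariant_subspace_def)
    moreover have "?S \<subseteq> complexification U"
      using VU V'U vec.subspace_add[OF complexification_subspace[OF sU]] by blast
    moreover have "cnj_vec w \<in> ?S" if w: "w \<in> ?S" for w
    proof -
      obtain x y' where xy': "x \<in> V" "y' \<in> ?V'" "w = x + y'" using w by blast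
      moreover then obtain y where "y \<in> V" "y' = cnj_vec y" by blast
      ultimately have "cnj_vec w = y + cnj_vec x" "x \<in> V" "y \<in> V" by simp_all
      then show ?thesis by blast
    qed
    moreover have "?S \<noteq> {0}"
    proof -
      obtain x where "x \<in> V" "x \<noteq> 0" using V'(3) vec.subspace_0[OF V'(1)] by blast
      then have "x + 0 \<in> ?S" using vec.subspace_0[OF V's] by blast
      then show ?thesis using \<open>x \<noteq> 0\<close> by auto
    qed
    ultimately have sum: "?S = complexification U"
      using conjugation_closed_subrep[OF G U, of ?S] by blast
    have dimV': "vec.dim ?V' = vec.dim V"
    proof -
      have le: "vec.dim (cnj_vec ` W) \<le> vec.dim W" if W: "vec.subspace W" for W :: "(complex ^ 'p) set"
      proof -
        obtain C where C: "C \<subseteq> W" "vec.independent C" "W \<subseteq> vec.span C" "card C = vec.dim W"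
          using vec.basis_exists by blast
        have fin: "finite C" using C(2) vec.finiteI_independent by blast
        have "cnj_vec x \<in> vec.span (cnj_vec ` C)" if "x \<in> vec.span C" for x
          using that
        proof (induction rule: vec.span_induct_alt)
          case base then show ?case by (simp add: vec.span_zero)
        next
          case (step c x y)
          then show ?case by (simp add: vec.span_add vec.span_scale vec.span_base)
        qed
        then have "vec.dim (cnj_vec ` W) \<le> card (cnj_vec ` C)" using C(3) fin by (intro vec.dim_le_card) auto
        then show ?thesis using card_image_le[OF fin, of cnj_vec] C(4) by simp
      qed
      have "cnj_vec ` ?V' = V" by (force simp: image_image)
      then show ?thesis using le[OF V'(1)] le[OF V's] by simp
    qed
    have "2 * irrep_dim i = vec.dim (complexification U)"
      using vec.dim_sums_Int[OF V'(1) V's] inter sum dimV' m by simp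
    then have k2: "2 * irrep_dim i \<le> dim U" using dim_complexification_le[OF sU] by simp
    have "cpx u \<in> ?S" using cpx_u sum by blast
    then obtain v w' where "v \<in> V" "w' \<in> ?V'" "cpx u = v + w'" by blast
    then obtain w where vw: "v \<in> V" "w \<in> V" "cpx u = v + cnj_vec w" by blast
    obtain C where C: "finite C" "card C \<le> irrep_mult G i"
      "\<And>F. clinear F \<Longrightarrow> equivariant G F \<Longrightarrow> F v \<in> vec.span C"
      using complex_commutant_orbit_span[OF G i V vw(1)] by metis
    obtain E where E: "finite E" "card E \<le> irrep_mult G i"
      "\<And>F. clinear F \<Longrightarrow> equivariant G F \<Longrightarrow> F w \<in> vec.span E"
      using complex_commutant_orbit_span[OF G i V vw(2)] by metis
    have spanE: "cnj_vec x \<in> vec.span (cnj_vec ` E)" if "x \<in> vec.span E" for x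
      using that
    proof (induction rule: vec.span_induct_alt)
      case base then show ?case by (simp add: vec.span_zero)
    next
      case (step c x y)
      then show ?case by (simp add: vec.span_add vec.span_scale vec.span_base)
    qed
    have "cpx (f u) \<in> vec.span (C \<union> cnj_vec ` E)" if f: "linear f" "equivariant G f" for f
    proof -
      let ?F = "complexified_map f"
      have F: "clinear ?F" "equivariant G ?F"
        using complexified_map(1)[OF f(1)] complexified_map_equivariant[OF G f(2)] by auto
      have "cpx (f u) = ?F v + cnj_vec (?F w)"
        using complexified_map(2,3)[OF f(1)] vec.linear_add[OF F(1)] vw(3) by metis
      moreover have "?F v \<in> vec.span (C \<union> cnj_vec ` E)" "cnj_vec (?F w) \<in> vec.span (C \<union> cnj_vec ` E)"
        using C(3)[OF F] spanE[OF E(3)[OF F]] vec.span_mono[of C "C \<union> cnj_vec ` E"]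
          vec.span_mono[of "cnj_vec ` E" "C \<union> cnj_vec ` E"] by auto
      ultimately show ?thesis by (simp add: vec.span_add)
    qed
    then have "dim (commutant_orbit G u) \<le> card (C \<union> cnj_vec ` E)" using C(1) E(1) by (intro card_le) auto
    also have "\<dots> \<le> card C + card E"
      using card_Un_le[of C "cnj_vec ` E"] card_image_le[OF E(1), of cnj_vec] by linarith
    also have "\<dots> \<le> 2 * irrep_mult G i" using C(2) E(2) by simp
    finally have "dim (commutant_orbit G u) * irrep_dim i \<le> 2 * irrep_mult G i * irrep_dim i"
      by (rule mult_le_mono1)
    also have "\<dots> = irrep_mult G i * (2 * irrep_dim i)" by simp
    also have "\<dots> \<le> irrep_mult G i * dim U" using k2 by (rule mult_le_mono2)
    finally show ?thesis .
  qed
qed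

text \<open>The real and imaginary parts of a complex intertwiner between constituents are real
  intertwiners, and they cannot both vanish.\<close>

lemma shared_constituent_intertwiner:
  fixes G :: "('p::finite \<Rightarrow> 'p) set"
  assumes G: "subgroup G (BijGroup UNIV)" and sU: "subspace U" and i: "i \<in> active_irreps G"
    and V: "V \<in> i" "V \<subseteq> complexification U" and V': "V' \<in> i" "V' \<subseteq> complexification U'"
  obtains f u where "linear f" "equivariant G f" "\<And>x. f x \<in> U'" "u \<in> U" "f u \<noteq> 0"
proof -
  have Virr: "irreducible_subrep G V" by (rule active_irreps_members(1)[OF i V(1)])
  note VD = irreducible_subrepD[OF Virr]
  have "equivalent_subreps G V V'" using active_irreps_members(2)[OF i V(1)] V'(1) by blast
  then obtain h where h: "clinear h" "bij_betw h V V'"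
    "\<And>g v. g \<in> G \<Longrightarrow> v \<in> V \<Longrightarrow> h (perm_matrix g *v v) = perm_matrix g *v h v"
    unfolding equivalent_subreps_def by blast
  have scaleR: "r *\<^sub>R v = complex_of_real r *s v" for r and v :: "complex ^ 'p"
    by (simp only: vec_eq_iff vector_scaleR_component vector_smult_component) (simp add: scaleR_conv_of_real)
  have V_real: "subspace V"
    using VD(1) unfolding subspace_def vec.subspace_def by (simp add: scaleR)
  \<comment> \<open>the orthogonal projection for the real inner product is complex linear, because the orthogonal
    complement of a complex subspace is one\<close>
  let ?P = "orth_proj V"
  have adj: "(c *s x) \<bullet> w = x \<bullet> (cnj c *s w)" for c and x w :: "complex ^ 'p"
    by (auto simp: inner_vec_def inner_complex_def algebra_simps intro!: sum.cong)
  have P_scale: "?P (c *s x) = c *s ?P x" for c x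
  proof (rule orth_proj_commute[OF V_real])
    show "linear (\<lambda>x :: complex ^ 'p. c *s x)"
      by (rule linearI) (simp_all add: scaleR vector_add_ldistrib vector_smult_assoc mult.commute)
    show "c *s y \<in> V" if "y \<in> V" for y using that vec.subspace_scale[OF VD(1)] by blast
    show "(c *s y) \<bullet> w = 0" if "\<And>w. w \<in> V \<Longrightarrow> y \<bullet> w = 0" "w \<in> V" for y w
      unfolding adj using that vec.subspace_scale[OF VD(1)] by blast
  qed
  have P_lin: "clinear ?P"
    using P_scale linear_add[OF linear_orth_proj[OF V_real]] by (intro clinearI)
  have P_eq: "equivariant G ?P"
  proof (rule orth_proj_equivariant[OF G V_real VD(2)])
    show "linear (\<lambda>v :: complex ^ 'p. perm_matrix g *v v)" for g
      by (rule linearI) (simp_all add: scaleR matrix_vector_right_distrib perm_matrix_scale)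
  qed
  define F where "F x = h (?P x)" for x
  have F_lin: "clinear F"
    unfolding F_def by (intro clinearI) (simp_all add: vec.linear_add[OF P_lin] vec.linear_scale[OF P_lin]
        vec.linear_add[OF h(1)] vec.linear_scale[OF h(1)])
  have F_eq: "F (perm_matrix g *v v) = perm_matrix g *v F v" if "g \<in> G" for g v
    using that P_eq h(3) orth_proj_in[OF V_real] by (simp add: F_def equivariant_def)
  have F_in: "F x \<in> complexification U'" for x
    using h(2) orth_proj_in[OF V_real, of x] V'(2) by (auto simp: F_def bij_betw_def)
  define f1 where "f1 x = Re_vec (F (cpx x))" for x
  define f2 where "f2 x = Im_vec (F (cpx x))" for x
  have lin: "linear f1" "linear f2"
    by (auto intro!: linearI simp: f1_def f2_def vec.linear_add[OF F_lin] vec.linear_scale[OF F_lin])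
  have eq: "equivariant G f1" "equivariant G f2"
    using F_eq subgroup_Bij(1)[OF G]
    by (auto simp: equivariant_def f1_def f2_def cpx_perm_matrix)
  have inU: "f1 x \<in> U'" "f2 x \<in> U'" for x
    using F_in[of "cpx x"] by (auto simp: f1_def f2_def complexification_def)
  have "\<exists>u\<in>U. f1 u \<noteq> 0 \<or> f2 u \<noteq> 0"
  proof (rule ccontr)
    assume *: "\<not> ?thesis"
    have F0: "F (cpx u) = 0" if "u \<in> U" for u
      using * that cpx_Re_Im[of "F (cpx u)"] by (simp add: f1_def f2_def)
    obtain v where v: "v \<in> V" "v \<noteq> 0" using VD(3) vec.subspace_0[OF VD(1)] by blast
    have "F v = F (cpx (Re_vec v)) + \<i> *s F (cpx (Im_vec v))"
      by (subst cpx_Re_Im[of v]) (simp only: vec.linear_add[OF F_lin] vec.linear_scale[OF F_lin])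
    then have "F v = 0" using F0 v(1) V(2) by (auto simp: complexification_def)
    then have "h v = h 0" using orth_proj_id[OF V_real v(1)] by (simp add: F_def vec.linear_0[OF h(1)])
    then show False using h(2) v vec.subspace_0[OF VD(1)] by (auto simp: bij_betw_def inj_on_def)
  qed
  then show ?thesis using that lin eq inU by blast
qed

section \<open>The projection onto the invariant matrices\<close>

lemma closest_point_eq_orth_proj:
  fixes S :: "'a::euclidean_space set"
  assumes S: "subspace S" shows "closest_point S x = orth_proj S x"
proof (rule closest_point_unique[symmetric])
  show "convex S" "closed S" using S by (auto simp: subspace_imp_convex closed_subspace)
  show "orth_proj S x \<in> S" by (rule orth_proj_in[OF S])
  show "\<forall>z\<in>S. dist x (orth_proj S x) \<le> dist x z"
  proof
    fix z assume z: "z \<in> S"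
    let ?d = "x - orth_proj S x" and ?e = "orth_proj S x - z"
    have "?d \<bullet> ?e = 0" by (rule orth_proj_orth[OF S subspace_diff[OF S orth_proj_in[OF S] z]])
    then have "(norm (?d + ?e))\<^sup>2 = (norm ?d)\<^sup>2 + (norm ?e)\<^sup>2"
      by (intro norm_add_Pythagorean) (simp add: orthogonal_def)
    then have "(norm ?d)\<^sup>2 \<le> (norm (x - z))\<^sup>2" by simp
    then show "dist x (orth_proj S x) \<le> dist x z" 
      unfolding dist_norm by (rule power2_le_imp_le) simp
  qed
qed

lemma transpose_minus: "transpose (A - B) = transpose A - transpose B"
  for A B :: "real ^ 'n ^ 'm"
  by (simp add: transpose_def vec_eq_iff)

lemma matrix_inner:
  fixes A B :: "real ^ 'n ^ 'm"
  shows "A \<bullet> B = (\<Sum>i\<in>UNIV. \<Sum>j\<in>UNIV. A $ i $ j * B $ i $ j)"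
  by (simp add: inner_vec_def)

lemma matrix_inner_trace:
  fixes A B :: "real ^ 'n ^ 'n"
  shows "A \<bullet> B = trace (transpose A ** B)"
  unfolding matrix_inner trace_def matrix_matrix_mult_def transpose_def
  by (subst sum.swap) simp

lemma matrix_inner_outer:
  fixes A :: "real ^ 'n ^ 'n"
  shows "A \<bullet> (\<chi> i j. x $ i * x $ j) = x \<bullet> (A *v x)"
  unfolding matrix_inner by (simp add: inner_vec_def matrix_vector_mult_def sum_distrib_left algebra_simps)

lemma transpose_inner:
  fixes A B :: "real ^ 'n ^ 'n"
  shows "transpose A \<bullet> B = A \<bullet> transpose B"
  unfolding matrix_inner transpose_def by (subst sum.swap) simp

text \<open>Since $\Pi_g^T = \Pi_g^{-1}$, the invariant matrices are the commutant of the representation.\<close>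

lemma fixed_point_subspace_iff:
  assumes G: "subgroup G (BijGroup UNIV)"
  shows "M \<in> fixed_point_subspace G \<longleftrightarrow> equivariant G ((*v) M)"
proof -
  have tr: "transpose (perm_matrix g) *v x = perm_matrix (inv_into UNIV g) *v x"
    if g: "g \<in> G" for g and x :: "real ^ 'a"
  proof (rule vector_eq_ldot[THEN iffD1], rule allI)
    fix z :: "real ^ 'a"
    have "z \<bullet> (transpose (perm_matrix g) *v x) = (perm_matrix g *v z) \<bullet> x"
      by (metis inner_commute inner_transpose)
    then show "z \<bullet> (transpose (perm_matrix g) *v x) = z \<bullet> (perm_matrix (inv_into UNIV g) *v x)"
      using perm_matrix_adjoint[OF subgroup_Bij(1)[OF G g], of z x] by simp
  qed
  have "perm_matrix g ** M ** transpose (perm_matrix g) = M \<longleftrightarrow>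
      (\<forall>v. M *v (perm_matrix g *v v) = perm_matrix g *v (M *v v))" if g: "g \<in> G" for g
  proof -
    note inv = perm_matrix_inverse[OF subgroup_Bij(1)[OF G g], where 'a = real]
    have e: "(perm_matrix g ** M ** transpose (perm_matrix g)) *v x
        = perm_matrix g *v (M *v (perm_matrix (inv_into UNIV g) *v x))" for x
      by (simp only: matrix_vector_mul_assoc[symmetric] tr[OF g])
    show ?thesis
    proof
      assume *: "perm_matrix g ** M ** transpose (perm_matrix g) = M"
      show "\<forall>v. M *v (perm_matrix g *v v) = perm_matrix g *v (M *v v)"
      proof
        fix v
        show "M *v (perm_matrix g *v v) = perm_matrix g *v (M *v v)"
          using e[of "perm_matrix g *v v"] unfolding * inv(2) .
      qed
    next
      assume *: "\<forall>v. M *v (perm_matrix g *v v) = perm_matrix g *v (M *v v)"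
      have "(perm_matrix g ** M ** transpose (perm_matrix g)) *v x = M *v x" for x
        unfolding e *[rule_format, symmetric] inv(1) ..
      then show "perm_matrix g ** M ** transpose (perm_matrix g) = M" by (simp add: matrix_eq)
    qed
  qed
  then show ?thesis unfolding fixed_point_subspace_def equivariant_def by blast
qed

lemma subspace_fixed_point_subspace:
  assumes G: "subgroup G (BijGroup UNIV)" shows "subspace (fixed_point_subspace G)"
  unfolding subspace_def
  by (auto simp: fixed_point_subspace_iff[OF G] equivariant_def matrix_vector_mult_add_rdistrib
      matrix_vector_right_distrib matrix_vector_mult_scaleR scaleR_matrix_vector_assoc[symmetric])

lemma transpose_fixed_point_subspace:
  "M \<in> fixed_point_subspace G \<Longrightarrow> transpose M \<in> fixed_point_subspace G"
  unfolding fixed_point_subspace_def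
proof (intro CollectI ballI)
  fix g assume "M \<in> {M. \<forall>g\<in>G. perm_matrix g ** M ** transpose (perm_matrix g) = M}" "g \<in> G"
  then have "transpose (perm_matrix g ** M ** transpose (perm_matrix g)) = transpose M" by simp
  then show "perm_matrix g ** transpose M ** transpose (perm_matrix g) = transpose M"
    by (simp add: matrix_transpose_mul matrix_mul_assoc)
qed

lemma group_projection_eq:
  assumes G: "subgroup G (BijGroup UNIV)"
  shows "group_projection G S = orth_proj (fixed_point_subspace G) S"
  unfolding group_projection_def by (rule closest_point_eq_orth_proj[OF subspace_fixed_point_subspace[OF G]])

lemma transpose_group_projection:
  fixes G :: "('p::finite \<Rightarrow> 'p) set"
  assumes G: "subgroup G (BijGroup UNIV)" and S: "transpose S = S"
  shows "transpose (group_projection G S) = group_projection G S"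
proof -
  let ?W = "fixed_point_subspace G"
  have "orth_proj ?W (transpose S) = transpose (orth_proj ?W S)"
  proof (rule orth_proj_commute[OF subspace_fixed_point_subspace[OF G]])
    show "linear (transpose :: real ^ 'p ^ 'p \<Rightarrow> _)"
      by (rule linearI) (simp_all add: transpose_def vec_eq_iff)
    show "transpose A \<bullet> B = 0" if "\<And>w. w \<in> ?W \<Longrightarrow> A \<bullet> w = 0" "B \<in> ?W" for A B
      unfolding transpose_inner using that transpose_fixed_point_subspace by blast
  qed (rule transpose_fixed_point_subspace)
  then show ?thesis using S by (simp add: group_projection_eq[OF G])
qed

text \<open>An invariant symmetric matrix compresses to a scalar on an irreducible representation \<open>Y\<close>;
  evaluating at a unit vector or taking traces identifies the scalar.\<close>

lemma invariant_compression:
  fixes G :: "('p::finite \<Rightarrow> 'p) set"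
  assumes G: "subgroup G (BijGroup UNIV)" and Y: "real_irreducible G Y" and y: "y \<in> Y" "norm y = 1"
    and M: "M \<in> fixed_point_subspace G" "transpose M = M"
  shows "proj_matrix Y ** M ** proj_matrix Y = (y \<bullet> (M *v y)) *\<^sub>R proj_matrix Y"
proof -
  have S: "subspace Y" by (rule real_irreducible_subspace[OF Y])
  have Yinv: "real_invariant G Y" using Y by (simp add: real_irreducible_def)
  let ?f = "\<lambda>x. orth_proj Y (M *v orth_proj Y x)"
  have lin: "linear ?f"
    using linear_compose[OF linear_compose[OF linear_orth_proj[OF S] matrix_vector_mul_linear] linear_orth_proj[OF S], of M]
    by (simp add: o_def)
  have sym: "?f x \<bullet> z = x \<bullet> ?f z" for x z
    by (simp add: orth_proj_symmetric[OF S] symmetric_inner[OF M(2)])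
  have eq: "equivariant G ?f"
    using real_orth_proj_equivariant[OF G Yinv] M(1)
    by (simp add: fixed_point_subspace_iff[OF G] equivariant_def)
  obtain \<beta> where \<beta>: "\<And>x. x \<in> Y \<Longrightarrow> ?f x = \<beta> *\<^sub>R x"
    using real_symmetric_schur[OF Y lin sym eq orth_proj_in[OF S]] by blast
  have "y \<bullet> ?f y = y \<bullet> (M *v y)"
    using orth_proj_symmetric[OF S, of y] by (simp add: orth_proj_id[OF S y(1)])
  then have "\<beta> = y \<bullet> (M *v y)" using \<beta>[OF y(1)] y(2) by (simp add: norm_eq_1)
  moreover have "(proj_matrix Y ** M ** proj_matrix Y) *v x = \<beta> *\<^sub>R orth_proj Y x" for x
  proof -
    have "(proj_matrix Y ** M ** proj_matrix Y) *v x = ?f x"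
      by (simp only: matrix_vector_mul_assoc[symmetric] proj_matrix_vector[OF S])
    also have "\<dots> = ?f (orth_proj Y x)" by (simp add: orth_proj_id[OF S orth_proj_in[OF S]])
    finally show ?thesis using \<beta>[OF orth_proj_in[OF S]] by simp
  qed
  ultimately show ?thesis
    by (simp add: matrix_eq proj_matrix_vector[OF S] scaleR_matrix_vector_assoc[symmetric])
qed

text \<open>The projection onto the invariant matrices averages the quadratic form over the
  irreducible representation that contains \<open>y\<close>.\<close>

lemma group_projection_quadratic_form:
  fixes G :: "('p::finite \<Rightarrow> 'p) set"
  assumes G: "subgroup G (BijGroup UNIV)" and Y: "real_irreducible G Y" and y: "y \<in> Y" "norm y = 1"
    and S: "transpose S = S"
  shows "y \<bullet> (group_projection G S *v y) = (proj_matrix Y \<bullet> S) / real (dim Y)"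
proof -
  have sY: "subspace Y" by (rule real_irreducible_subspace[OF Y])
  let ?W = "fixed_point_subspace G" and ?P = "proj_matrix Y" and ?M = "group_projection G S"
  have sW: "subspace ?W" by (rule subspace_fixed_point_subspace[OF G])
  have MW: "?M \<in> ?W" unfolding group_projection_eq[OF G] by (rule orth_proj_in[OF sW])
  have "equivariant G ((*v) ?P)"
    using real_orth_proj_equivariant[OF G] Y by (simp add: real_irreducible_def proj_matrix_vector[OF sY] equivariant_def)
  then have "?P \<in> ?W" by (simp add: fixed_point_subspace_iff[OF G])
  then have "(S - ?M) \<bullet> ?P = 0" unfolding group_projection_eq[OF G] by (rule orth_proj_orth[OF sW])
  then have "S \<bullet> ?P = ?M \<bullet> ?P" by (simp add: inner_diff_left)
  then have "?P \<bullet> S = ?P \<bullet> ?M" by (simp only: inner_commute)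
  also have "\<dots> = trace (?P ** ?P ** ?M)"
    by (simp add: matrix_inner_trace transpose_proj_matrix[OF sY] proj_matrix_idem[OF sY])
  also have "\<dots> = trace (?P ** ?M ** ?P)"
    using trace_mul_sym[of ?P "?P ** ?M"] by (simp add: matrix_mul_assoc)
  also have "\<dots> = (y \<bullet> (?M *v y)) * trace ?P"
    unfolding invariant_compression[OF G Y y MW transpose_group_projection[OF G S]]
    by (simp add: trace_def sum_distrib_left)
  finally have "?P \<bullet> S = (y \<bullet> (?M *v y)) * real (dim Y)" by (simp add: trace_proj_matrix[OF sY])
  moreover have "real (dim Y) \<noteq> 0" using real_irreducible_dim_pos[OF Y] by linarith
  ultimately show ?thesis by (metis nonzero_mult_div_cancel_right)
qed

lemma transpose_empirical_covariance: "transpose (empirical_covariance n x) = empirical_covariance n x"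
  by (simp add: empirical_covariance_def transpose_def vec_eq_iff mult.commute)

lemma projected_empirical_quadratic_form:
  fixes G :: "('p::finite \<Rightarrow> 'p) set"
  assumes G: "subgroup G (BijGroup UNIV)" and Y: "real_irreducible G Y" and y: "y \<in> Y" "norm y = 1"
  shows "y \<bullet> (group_projection G (empirical_covariance n x) *v y)
    = (\<Sum>k=1..n. (norm (orth_proj Y (x k)))\<^sup>2) / (real n * real (dim Y))"
proof -
  have sY: "subspace Y" by (rule real_irreducible_subspace[OF Y])
  have "v \<bullet> (proj_matrix Y *v v) = (norm (orth_proj Y v))\<^sup>2" for v
    using orth_proj_symmetric[OF sY, of v "orth_proj Y v"]
    by (simp add: proj_matrix_vector[OF sY] power2_norm_eq_inner orth_proj_id[OF sY orth_proj_in[OF sY]])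
  then have "proj_matrix Y \<bullet> empirical_covariance n x
      = (\<Sum>k=1..n. (norm (orth_proj Y (x k)))\<^sup>2) / real n"
    by (simp add: empirical_covariance_def inner_sum_right matrix_inner_outer)
  then show ?thesis
    by (simp add: group_projection_quadratic_form[OF G Y y transpose_empirical_covariance])
qed

section \<open>Concentration of one quadratic form\<close>

lemma gaussian_law_mgf:
  fixes \<Sigma> :: "real ^ 'p ^ 'p"
  assumes N: "gaussian_law \<Sigma> N" and Y: "subspace Y"
    and iso: "proj_matrix Y ** \<Sigma> ** proj_matrix Y = b *\<^sub>R proj_matrix Y" and \<theta>: "2 * \<theta> * b < 1"
  shows "(\<integral>\<^sup>+x. ennreal (exp (\<theta> * (norm (orth_proj Y x))\<^sup>2)) \<partial>N)
    = ennreal ((1 - 2 * \<theta> * b) powr (- real (dim Y) / 2))"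
proof -
  obtain A :: "real ^ 'p ^ 'p" where A: "A ** transpose A = \<Sigma>" "N = distr std_gaussian borel (\<lambda>z. A *v z)"
    using N unfolding gaussian_law_def by blast
  let ?B = "proj_matrix Y ** A"
  have [measurable]: "(\<lambda>z. A *v z) \<in> measurable std_gaussian borel"
    by (simp add: std_gaussian_def)
  have [measurable]: "orth_proj Y \<in> borel_measurable borel" by (rule borel_measurable_orth_proj[OF Y])
  have "?B ** transpose ?B = proj_matrix Y ** (A ** transpose A) ** proj_matrix Y"
    by (simp add: matrix_transpose_mul transpose_proj_matrix[OF Y] matrix_mul_assoc)
  then have B: "?B ** transpose ?B = b *\<^sub>R proj_matrix Y" using A(1) iso by simp
  have "(\<integral>\<^sup>+x. ennreal (exp (\<theta> * (norm (orth_proj Y x))\<^sup>2)) \<partial>N)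
      = (\<integral>\<^sup>+z. ennreal (exp (\<theta> * (norm (orth_proj Y (A *v z)))\<^sup>2)) \<partial>std_gaussian)"
    unfolding A(2) by (subst nn_integral_distr) measurable
  also have "\<dots> = (\<integral>\<^sup>+z. ennreal (exp (\<theta> * (norm (?B *v z))\<^sup>2)) \<partial>std_gaussian)"
    by (simp only: matrix_vector_mul_assoc[symmetric] proj_matrix_vector[OF Y])
  also have "\<dots> = ennreal ((1 - 2 * \<theta> * b) powr (- real (dim Y) / 2))"
    by (rule isotropic_gaussian_mgf[OF Y B \<theta>])
  finally show ?thesis .
qed

text \<open>The function \<open>- (t + ln (1 - 2 * t) / 2)\<close> is the cumulant function of $\chi^2_1 - 1$ at
  \<open>t\<close>. It increases for positive \<open>t\<close>, so a variance below \<open>\<psi>\<close> may be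
  replaced by \<open>\<psi>\<close>; and it is larger at \<open>t\<close> than at \<open>- t\<close>, so the bound for the upper tail also
  holds for the lower tail.\<close>

lemma chi_square_cumulant_mono:
  fixes t x :: real
  assumes "0 \<le> t" "t \<le> x" "2 * x < 1"
  shows "x + ln (1 - 2 * x) / 2 \<le> t + ln (1 - 2 * t) / 2"
proof -
  have "- (t + ln (1 - 2 * t) / 2) \<le> - (x + ln (1 - 2 * x) / 2)"
  proof (rule DERIV_nonneg_imp_nondecreasing[OF assms(2), where f = "\<lambda>t. - (t + ln (1 - 2 * t) / 2)"])
    fix s assume s: "t \<le> s" "s \<le> x"
    then have "((\<lambda>t. - (t + ln (1 - 2 * t) / 2)) has_real_derivative (2 * s / (1 - 2 * s))) (at s)"
      using assms by (auto intro!: derivative_eq_intros simp: field_simps)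
    moreover have "0 \<le> 2 * s / (1 - 2 * s)" using s assms by simp
    ultimately show "\<exists>y. ((\<lambda>t. - (t + ln (1 - 2 * t) / 2)) has_real_derivative y) (at s) \<and> 0 \<le> y" by blast
  qed
  then show ?thesis by simp
qed

lemma chi_square_cumulant_reflect:
  fixes t :: real
  assumes "0 \<le> t" "2 * t < 1"
  shows "t + ln (1 - 2 * t) / 2 \<le> - t + ln (1 + 2 * t) / 2"
proof -
  let ?f = "\<lambda>t :: real. (ln (1 + 2 * t) - ln (1 - 2 * t)) / 2 - 2 * t"
  have "?f 0 \<le> ?f t"
  proof (rule DERIV_nonneg_imp_nondecreasing[OF assms(1)])
    fix s assume s: "0 \<le> s" "s \<le> t"
    then have p: "0 < 1 - 2 * s" "0 < 1 + 2 * s" using assms by auto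
    then have "(?f has_real_derivative ((2 / (1 + 2 * s) + 2 / (1 - 2 * s)) / 2 - 2)) (at s)"
      by (auto intro!: derivative_eq_intros)
    moreover have "0 \<le> (2 / (1 + 2 * s) + 2 / (1 - 2 * s)) / 2 - 2"
    proof -
      have "2 / (1 + 2 * s) + 2 / (1 - 2 * s) = 4 / ((1 + 2 * s) * (1 - 2 * s))"
        using p by (subst add_frac_eq) auto
      moreover have "(1 + 2 * s) * (1 - 2 * s) = 1 - 4 * s\<^sup>2"
        by (simp add: algebra_simps power2_eq_square)
      then have "(1 + 2 * s) * (1 - 2 * s) \<le> 1" by simp
      then have "4 \<le> 4 / ((1 + 2 * s) * (1 - 2 * s))" using p by (simp add: pos_le_divide_eq)
      ultimately have "4 \<le> 2 / (1 + 2 * s) + 2 / (1 - 2 * s)" by (simp only:)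
      then have "2 \<le> (2 / (1 + 2 * s) + 2 / (1 - 2 * s)) / 2"
        by (subst le_divide_eq_numeral1) simp
      then show ?thesis by (simp only: diff_ge_0_iff_ge)
    qed
    ultimately show "\<exists>y. (?f has_real_derivative y) (at s) \<and> 0 \<le> y" by blast
  qed
  then show ?thesis by (simp add: field_simps)
qed

text \<open>Chernoff's bound for the normalised chi-squared variable
  $q = \frac{1}{n \dim Y} \sum_k |P_Y X_k|^2$ with mean \<open>b \<le> \<psi>\<close>, on the side given by the sign \<open>s\<close>;
  \<open>x\<close> is the free parameter of the exponential moment.\<close>

lemma (in prob_space) projected_gaussian_tail:
  fixes \<Sigma> :: "real ^ 'p ^ 'p" and X :: "nat \<Rightarrow> 'a \<Rightarrow> real ^ 'p"
  assumes ind: "indep_vars (\<lambda>_. borel) X {1..n}"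
    and law: "\<forall>k\<in>{1..n}. gaussian_law \<Sigma> (distr M borel (X k))"
    and Y: "subspace Y" and iso: "proj_matrix Y ** \<Sigma> ** proj_matrix Y = b *\<^sub>R proj_matrix Y"
    and b: "0 \<le> b" "b \<le> \<psi>" and \<psi>: "0 < \<psi>" and x: "0 \<le> x" "2 * x < 1" and s: "s = 1 \<or> s = - 1"
    and nk: "0 < n" "0 < dim Y"
  shows "\<P>(\<omega> in M. \<psi> * a \<le> s * ((\<Sum>k=1..n. (norm (orth_proj Y (X k \<omega>)))\<^sup>2) / (real n * real (dim Y)) - b))
    \<le> exp (- (real n * real (dim Y) * (x * (1 + a) + ln (1 - 2 * x) / 2)))"
proof -
  define K where "K = real n * real (dim Y)"
  have K: "0 < K" using nk by (simp add: K_def)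
  define \<theta> where "\<theta> = s * x / \<psi>"
  define t where "t = x * b / \<psi>"
  have t: "0 \<le> t" "t \<le> x"
    using b \<psi> x mult_left_mono[of b \<psi> x] by (auto simp: t_def divide_simps)
  have \<theta>b: "\<theta> * b = s * t" by (simp add: \<theta>_def t_def)
  have less: "2 * \<theta> * b < 1" using s t x \<theta>b by (auto simp: mult.assoc)
  have [measurable]: "X k \<in> borel_measurable M" if "k \<in> {1..n}" for k
    using ind that by (auto simp: indep_vars_def)
  have [measurable]: "orth_proj Y \<in> borel_measurable borel" by (rule borel_measurable_orth_proj[OF Y])
  define Q where "Q \<omega> = (\<Sum>k=1..n. (norm (orth_proj Y (X k \<omega>)))\<^sup>2)" for \<omega>
  have [measurable]: "Q \<in> borel_measurable M" unfolding Q_def by measurable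
  let ?g = "\<lambda>v :: real ^ 'p. ennreal (exp (\<theta> * (norm (orth_proj Y v))\<^sup>2))"
  have "(\<integral>\<^sup>+\<omega>. ennreal (exp (\<theta> * Q \<omega>)) \<partial>M) = (\<integral>\<^sup>+\<omega>. (\<Prod>k\<in>{1..n}. ?g (X k \<omega>)) \<partial>M)"
    by (simp add: Q_def sum_distrib_left exp_sum prod_ennreal)
  also have "\<dots> = (\<Prod>k\<in>{1..n}. \<integral>\<^sup>+\<omega>. ?g (X k \<omega>) \<partial>M)"
    by (intro indep_vars_nn_integral indep_vars_compose2[OF ind, where Y = "\<lambda>_. ?g"]) auto
  also have "\<dots> = (\<Prod>k\<in>{1..n}. ennreal ((1 - 2 * \<theta> * b) powr (- real (dim Y) / 2)))"
  proof (rule prod.cong[OF refl])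
    fix k assume k: "k \<in> {1..n}"
    have "(\<integral>\<^sup>+\<omega>. ?g (X k \<omega>) \<partial>M) = (\<integral>\<^sup>+v. ?g v \<partial>distr M borel (X k))"
      using k by (subst nn_integral_distr) auto
    also have "\<dots> = ennreal ((1 - 2 * \<theta> * b) powr (- real (dim Y) / 2))"
      by (rule gaussian_law_mgf[OF law[rule_format, OF k] Y iso less])
    finally show "(\<integral>\<^sup>+\<omega>. ?g (X k \<omega>) \<partial>M) = ennreal ((1 - 2 * \<theta> * b) powr (- real (dim Y) / 2))" .
  qed
  also have "\<dots> = ennreal (((1 - 2 * \<theta> * b) powr (- real (dim Y) / 2)) ^ n)"
    by (simp add: ennreal_power)
  also have "((1 - 2 * \<theta> * b) powr (- real (dim Y) / 2)) ^ n = exp (- (K * (ln (1 - 2 * \<theta> * b) / 2)))"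
    using less by (simp add: powr_def K_def exp_of_nat_mult[symmetric] algebra_simps)
  finally have mgf: "(\<integral>\<^sup>+\<omega>. ennreal (exp (\<theta> * Q \<omega>)) \<partial>M) = ennreal (exp (- (K * (ln (1 - 2 * \<theta> * b) / 2))))" .
  let ?c = "exp (- (K * (x * a + \<theta> * b)))"
  let ?E = "{\<omega> \<in> space M. \<psi> * a \<le> s * (Q \<omega> / K - b)}"
  have sub: "?E \<subseteq> {\<omega> \<in> space M. 1 \<le> ennreal ?c * ennreal (exp (\<theta> * Q \<omega>))}"
  proof (clarify)
    fix \<omega> assume "\<omega> \<in> space M" and *: "\<psi> * a \<le> s * (Q \<omega> / K - b)"
    have "x * a = (x / \<psi>) * (\<psi> * a)" using \<psi> by simp
    also have "\<dots> \<le> (x / \<psi>) * (s * (Q \<omega> / K - b))" using * x \<psi> by (intro mult_left_mono) auto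
    also have "\<dots> = \<theta> * (Q \<omega> / K) - \<theta> * b" by (simp add: \<theta>_def algebra_simps)
    finally have "K * (x * a + \<theta> * b) \<le> K * (\<theta> * (Q \<omega> / K))" using K by (intro mult_left_mono) auto
    then have "K * (x * a + \<theta> * b) \<le> \<theta> * Q \<omega>" using K by simp
    then have "1 \<le> ?c * exp (\<theta> * Q \<omega>)" by (simp flip: exp_add)
    then show "1 \<le> ennreal ?c * ennreal (exp (\<theta> * Q \<omega>))"
      by (simp flip: ennreal_mult)
  qed
  have "emeasure M ?E \<le> emeasure M {\<omega> \<in> space M. 1 \<le> ennreal ?c * ennreal (exp (\<theta> * Q \<omega>))}"
    by (rule emeasure_mono[OF sub]) measurable
  also have "\<dots> \<le> ennreal ?c * (\<integral>\<^sup>+\<omega>. ennreal (exp (\<theta> * Q \<omega>)) * indicator (space M) \<omega> \<partial>M)"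
    by (rule nn_integral_Markov_inequality) measurable
  also have "(\<integral>\<^sup>+\<omega>. ennreal (exp (\<theta> * Q \<omega>)) * indicator (space M) \<omega> \<partial>M) = (\<integral>\<^sup>+\<omega>. ennreal (exp (\<theta> * Q \<omega>)) \<partial>M)"
    by (rule nn_integral_cong) simp
  also have "ennreal ?c * (\<integral>\<^sup>+\<omega>. ennreal (exp (\<theta> * Q \<omega>)) \<partial>M)
      = ennreal (exp (- (K * (x * a + (s * t + ln (1 - 2 * (s * t)) / 2)))))"
  proof -
    have "1 - 2 * \<theta> * b = 1 - 2 * (s * t)" using \<theta>b by (simp add: mult.assoc)
    then show ?thesis unfolding mgf \<theta>b
      by (simp add: algebra_simps flip: ennreal_mult exp_add)
  qed
  also have "\<dots> \<le> ennreal (exp (- (K * (x * (1 + a) + ln (1 - 2 * x) / 2))))"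
  proof -
    have "x + ln (1 - 2 * x) / 2 \<le> s * t + ln (1 - 2 * (s * t)) / 2"
      using s chi_square_cumulant_mono[OF t x(2)] chi_square_cumulant_reflect[OF t(1)] t x by auto
    then have "K * (x * (1 + a) + ln (1 - 2 * x) / 2) \<le> K * (x * a + (s * t + ln (1 - 2 * (s * t)) / 2))"
      using K by (intro mult_left_mono) (auto simp: algebra_simps)
    then show ?thesis by (intro ennreal_leI) simp
  qed
  finally have "emeasure M ?E \<le> ennreal (exp (- (K * (x * (1 + a) + ln (1 - 2 * x) / 2))))" .
  then have "measure M ?E \<le> exp (- (K * (x * (1 + a) + ln (1 - 2 * x) / 2)))"
    by (simp add: emeasure_eq_measure)
  then show ?thesis by (simp add: K_def Q_def)
qed

section \<open>The numerical trade-off\<close>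

text \<open>The number 7 is \<open>1 + 2 / \<epsilon>\<close> for \<open>\<epsilon> = 1 / 3\<close>, the base of the size of the net.\<close>

lemma ln_7_le: "ln (7 :: real) \<le> 47 / 24"
proof -
  have "ln (7 :: real) = ln (7 / 8) + 3 * ln 2"
    using ln_realpow[of "2 :: real" 3] by (simp add: ln_div)
  moreover have "ln (7 / 8 :: real) \<le> 7 / 8 - 1" by (rule ln_le_minus_one) simp
  ultimately show ?thesis using ln2_le_25_over_36 by simp
qed

text \<open>The exponent for deviations below \<open>\<psi>\<close>. At a net point the relative deviation is at least
  \<open>a = (2 * c - 1) * 8 * \<tau>\<close> with \<open>c = (17 / 18)\<^sup>2\<close>. The parameter \<open>x\<close> is the optimal one, and it
  leaves \<open>(a - ln (1 + a)) / 2\<close>, which is estimated by \<open>ln (1 + a) \<le> a - a\<^sup>2 / 4\<close>. The term \<open>ln 2\<close>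
  pays for the two tails.\<close>

lemma two_sided_exponent:
  fixes \<tau> :: real
  defines "a \<equiv> 508 / 81 * \<tau>"
  defines "x \<equiv> a / (2 * (1 + a))"
  assumes \<tau>: "0 < \<tau>" "\<tau> \<le> 1 / 8"
  shows "0 \<le> x" "2 * x < 1" "\<tau>\<^sup>2 * (1 / 2 + ln 7 + ln 2) \<le> x * (1 + a) + ln (1 - 2 * x) / 2"
proof -
  have a: "0 < a" "a \<le> 1" using \<tau> by (auto simp: a_def)
  show x: "0 \<le> x" "2 * x < 1" using a by (auto simp: x_def field_simps)
  have "1 - 2 * x = 1 / (1 + a)" using a by (simp add: x_def field_simps)
  then have ln: "ln (1 - 2 * x) = - ln (1 + a)" using a by (simp add: ln_div)
  have xa: "x * (1 + a) = a / 2" using a by (simp add: x_def field_simps)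
  let ?u = "a - a\<^sup>2 / 4"
  have "0 \<le> a * (1 - a / 4)" using a by (intro mult_nonneg_nonneg) auto
  then have u: "0 \<le> ?u" by (simp add: power2_eq_square algebra_simps)
  have "0 \<le> a\<^sup>2 * (1 - a) / 4 + a ^ 4 / 32" using a by simp
  also have "\<dots> = 1 + ?u + ?u\<^sup>2 / 2 - (1 + a)"
    by (simp add: field_simps power2_eq_square power4_eq_xxxx)
  finally have "1 + a \<le> exp ?u" using exp_lower_Taylor_quadratic[OF u] by linarith
  then have "ln (1 + a) \<le> ?u" using a ln_le_cancel_iff[of "1 + a" "exp ?u"] by simp
  then have "a\<^sup>2 / 8 \<le> x * (1 + a) + ln (1 - 2 * x) / 2" using ln xa by simp
  moreover have "\<tau>\<^sup>2 * (1 / 2 + ln 7 + ln 2) \<le> \<tau>\<^sup>2 * (1 / 2 + 47 / 24 + 25 / 36)"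
    using ln_7_le ln2_le_25_over_36 by (intro mult_left_mono) auto
  moreover have "\<dots> \<le> a\<^sup>2 / 8"
  proof -
    have "a\<^sup>2 / 8 = (508 / 81)\<^sup>2 / 8 * \<tau>\<^sup>2" by (simp add: a_def power_mult_distrib power_divide)
    moreover have "(1 / 2 + 47 / 24 + 25 / 36) * \<tau>\<^sup>2 \<le> (508 / 81)\<^sup>2 / 8 * \<tau>\<^sup>2"
      by (intro mult_right_mono) (auto simp: power2_eq_square)
    ultimately show ?thesis by (simp add: mult.commute)
  qed
  ultimately show "\<tau>\<^sup>2 * (1 / 2 + ln 7 + ln 2) \<le> x * (1 + a) + ln (1 - 2 * x) / 2" by linarith
qed

text \<open>The exponent for deviations above \<open>\<psi>\<close>, where the net point satisfies
  \<open>1 + a = c * (1 + 8 * \<tau>)\<close> with \<open>c = (17 / 18)\<^sup>2 = 289 / 324\<close>. For fixed \<open>x\<close> the inequality is concave in \<open>\<tau>\<close>, so it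
  can be checked at the ends of an interval; two values of \<open>x\<close> cover the range.\<close>

lemma upper_exponent:
  fixes \<tau> :: real
  assumes \<tau>: "1 / 8 \<le> \<tau>" "\<tau> \<le> 1"
  obtains x where "0 \<le> x" "2 * x < 1"
    "\<tau>\<^sup>2 * (1 / 2 + ln 7) \<le> x * (289 / 324 * (1 + 8 * \<tau>)) + ln (1 - 2 * x) / 2"
proof -
  have C: "\<tau>\<^sup>2 * (1 / 2 + ln 7) \<le> \<tau>\<^sup>2 * (59 / 24)" using ln_7_le by (intro mult_left_mono) auto
  show ?thesis
  proof (cases "\<tau> \<le> 3 / 10")
    case True
    have "0 \<le> (\<tau> - 1 / 8) * (3 / 10 - \<tau>)" using \<tau> True by (intro mult_nonneg_nonneg) auto
    moreover have "(\<tau> - 1 / 8) * (3 / 10 - \<tau>) = 17 / 40 * \<tau> - 3 / 80 - \<tau>\<^sup>2"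
      by (simp add: power2_eq_square field_simps)
    ultimately have sq: "\<tau>\<^sup>2 \<le> 17 / 40 * \<tau> - 3 / 80" by linarith
    have ln: "ln (1 - 2 * (1 / 4 :: real)) = - ln 2" by (simp add: ln_div)
    have "\<tau>\<^sup>2 * (59 / 24) \<le> 1 / 4 * (289 / 324 * (1 + 8 * \<tau>)) + ln (1 - 2 * (1 / 4)) / 2"
    proof -
      have "1 / 4 * (289 / 324 * (1 + 8 * \<tau>)) = 289 / 1296 + 289 / 162 * \<tau>" by simp
      then show ?thesis unfolding ln using sq ln2_le_25_over_36 \<tau> True by linarith
    qed
    then have "\<tau>\<^sup>2 * (1 / 2 + ln 7) \<le> 1 / 4 * (289 / 324 * (1 + 8 * \<tau>)) + ln (1 - 2 * (1 / 4)) / 2"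
      using C by linarith
    then show ?thesis by (intro that[of "1 / 4"]) auto
  next
    case False
    have "0 \<le> (\<tau> - 3 / 10) * (1 - \<tau>)" using \<tau> False by (intro mult_nonneg_nonneg) auto
    moreover have "(\<tau> - 3 / 10) * (1 - \<tau>) = 13 / 10 * \<tau> - 3 / 10 - \<tau>\<^sup>2"
      by (simp add: power2_eq_square field_simps)
    ultimately have sq: "\<tau>\<^sup>2 \<le> 13 / 10 * \<tau> - 3 / 10" by linarith
    have ln: "ln (1 - 2 * (7 / 16 :: real)) = - 3 * ln 2"
      using ln_realpow[of "2 :: real" 3] by (simp add: ln_div)
    have "\<tau>\<^sup>2 * (59 / 24) \<le> 7 / 16 * (289 / 324 * (1 + 8 * \<tau>)) + ln (1 - 2 * (7 / 16)) / 2"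
    proof -
      have "7 / 16 * (289 / 324 * (1 + 8 * \<tau>)) = 2023 / 5184 + 2023 / 648 * \<tau>" by simp
      then show ?thesis unfolding ln using sq ln2_le_25_over_36 \<tau> False by linarith
    qed
    then have "\<tau>\<^sup>2 * (1 / 2 + ln 7) \<le> 7 / 16 * (289 / 324 * (1 + 8 * \<tau>)) + ln (1 - 2 * (7 / 16)) / 2"
      using C by linarith
    then show ?thesis by (intro that[of "7 / 16"]) auto
  qed
qed

section \<open>The deviation over one irreducible representation\<close>

lemma spectral_norm_minus_commute: "spectral_norm (A - B) = spectral_norm (B - A)"
  for A B :: "real ^ 'n ^ 'm"
proof -
  have "(*v) (A - B) = (\<lambda>x. - ((B - A) *v x))"
    by (simp add: fun_eq_iff matrix_vector_mult_diff_rdistrib)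
  then show ?thesis unfolding spectral_norm_eq_onorm by (simp only: onorm_neg)
qed

text \<open>Decompose \<open>y\<close> into its component along the eigenvector \<open>x\<close> and a rest \<open>w\<close> orthogonal to it. There are
  no cross terms, and the coefficient \<open>c = (x \<bullet> y)\<^sup>2\<close> is at least \<open>(1 - (1 / 3)\<^sup>2 / 2)\<^sup>2 = 289 / 324\<close>.\<close>

lemma quadratic_form_near_eigenvector:
  fixes E :: "real ^ 'p ^ 'p"
  assumes sym: "transpose E = E" and H: "subspace H" and x: "x \<in> H" "norm x = 1" "E *v x = l *\<^sub>R x"
    and y: "y \<in> H" "norm y = 1" "dist x y < 1 / 3"
  obtains w c where "w \<in> H" "289 / 324 \<le> c" "c \<le> 1" "w \<bullet> w = 1 - c"
    "y \<bullet> (E *v y) = c * l + w \<bullet> (E *v w)"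
proof -
  define g where "g = x \<bullet> y"
  define w where "w = y - g *\<^sub>R x"
  have xx: "x \<bullet> x = 1" and yy: "y \<bullet> y = 1" using x(2) y(2) by (simp_all add: norm_eq_1)
  have "(norm (x - y))\<^sup>2 = 2 - 2 * g"
    by (simp add: power2_norm_eq_inner inner_diff_left inner_diff_right xx yy g_def inner_commute)
  moreover have "(norm (x - y))\<^sup>2 \<le> (1 / 3)\<^sup>2" using y(3) by (intro power_mono) (auto simp: dist_norm)
  ultimately have g: "17 / 18 \<le> g" by (simp add: power2_eq_square)
  have xw: "x \<bullet> w = 0" by (simp add: w_def inner_diff_right xx g_def)
  have ww: "w \<bullet> w = 1 - g\<^sup>2"
    by (simp add: w_def inner_diff_left inner_diff_right xx yy inner_commute[of y x] power2_eq_square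
        flip: g_def)
  have wH: "w \<in> H" unfolding w_def using x(1) y(1) H by (intro subspace_diff subspace_scale)
  have "x \<bullet> (E *v w) = 0" using symmetric_inner[OF sym, of x w] x(3) xw by simp
  moreover have "y = g *\<^sub>R x + w" by (simp add: w_def)
  ultimately have "y \<bullet> (E *v y) = g\<^sup>2 * l + w \<bullet> (E *v w)"
    by (simp add: matrix_vector_right_distrib matrix_vector_mult_scaleR inner_add_left inner_add_right
        x(3) xx xw inner_commute[of w x] power2_eq_square)
  moreover have "289 / 324 \<le> g\<^sup>2" using power_mono[OF g, of 2] by (simp add: power2_eq_square)
  moreover have "g\<^sup>2 \<le> 1" using ww inner_ge_zero[of w] by simp
  ultimately show ?thesis using that[OF wH] ww by blast
qed

text \<open>Since \<open>1 \<le> r \<le> K * t\<^sup>2\<close>, both the net of size \<open>7 ^ r\<close> and a constant factor are absorbed by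
  the exponent.\<close>

lemma card_net_exponent:
  fixes K t \<kappa> :: real
  assumes card: "real m \<le> 7 ^ r" and r: "real r \<le> K * t\<^sup>2" and E: "t\<^sup>2 * (1 / 2 + ln 7 + \<kappa>) \<le> e"
    and \<kappa>: "0 \<le> \<kappa>" "r \<noteq> 0" and K: "0 \<le> K"
  shows "exp \<kappa> * real m * exp (- (K * e)) \<le> exp (- (K * t\<^sup>2 / 2))"
proof -
  have "real m \<le> exp (real r * ln 7)" using card by (simp add: exp_of_nat_mult)
  also have "\<dots> \<le> exp (K * t\<^sup>2 * ln 7)" using r by (intro exp_le_cancel_iff[THEN iffD2] mult_right_mono) auto
  finally have m: "real m \<le> exp (K * t\<^sup>2 * ln 7)" .
  have "1 \<le> K * t\<^sup>2" using r \<kappa>(2) by linarith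
  then have k: "exp \<kappa> \<le> exp (K * t\<^sup>2 * \<kappa>)" using \<kappa>(1) mult_right_mono[of 1 "K * t\<^sup>2" \<kappa>] by simp
  have "exp \<kappa> * real m * exp (- (K * e)) \<le> exp (K * t\<^sup>2 * \<kappa>) * exp (K * t\<^sup>2 * ln 7) * exp (- (K * e))"
    using m k by (intro mult_right_mono mult_mono) auto
  also have "\<dots> = exp (K * t\<^sup>2 * \<kappa> + K * t\<^sup>2 * ln 7 - K * e)" by (simp add: exp_diff exp_add exp_minus field_simps)
  also have "\<dots> \<le> exp (- (K * t\<^sup>2 / 2))"
    using mult_left_mono[OF E K] by (simp add: algebra_simps)
  finally show ?thesis .
qed

lemma (in prob_space) projected_quadratic_form_tail:
  fixes G :: "('p::finite \<Rightarrow> 'p) set" and \<Sigma> :: "real ^ 'p ^ 'p" and X :: "nat \<Rightarrow> 'a \<Rightarrow> real ^ 'p" and n :: nat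
  defines "E \<omega> \<equiv> group_projection G (empirical_covariance n (\<lambda>k. X k \<omega>)) - \<Sigma>"
  assumes G: "subgroup G (BijGroup UNIV)" and \<Sigma>: "covariance_matrix \<Sigma>" "\<Sigma> \<in> fixed_point_subspace G"
    and \<psi>: "\<psi> = spectral_norm \<Sigma>" "0 < \<psi>"
    and ind: "indep_vars (\<lambda>_. borel) X {1..n}"
    and law: "\<forall>k\<in>{1..n}. gaussian_law \<Sigma> (distr M borel (X k))"
    and Y: "real_irreducible G Y" and y: "y \<in> Y" "norm y = 1" and n: "0 < n"
    and s: "s = 1 \<or> s = - 1"
  shows "{\<omega> \<in> space M. \<psi> * a \<le> s * (y \<bullet> (E \<omega> *v y))} \<in> sets M"
    and "0 \<le> x \<Longrightarrow> 2 * x < 1 \<Longrightarrow> \<P>(\<omega> in M. \<psi> * a \<le> s * (y \<bullet> (E \<omega> *v y)))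
      \<le> exp (- (real n * real (dim Y) * (x * (1 + a) + ln (1 - 2 * x) / 2)))"
proof -
  have sY: "subspace Y" by (rule real_irreducible_subspace[OF Y])
  define b where "b = y \<bullet> (\<Sigma> *v y)"
  have b: "0 \<le> b" "b \<le> \<psi>"
    using \<Sigma>(1) quadratic_form_le_spectral_norm[of y \<Sigma>] y(2)
    by (auto simp: covariance_matrix_def b_def \<psi> norm_eq_1)
  have iso: "proj_matrix Y ** \<Sigma> ** proj_matrix Y = b *\<^sub>R proj_matrix Y"
    unfolding b_def using \<Sigma> by (intro invariant_compression[OF G Y y]) (auto simp: covariance_matrix_def)
  have form: "y \<bullet> (E \<omega> *v y)
      = (\<Sum>k=1..n. (norm (orth_proj Y (X k \<omega>)))\<^sup>2) / (real n * real (dim Y)) - b" for \<omega>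
    by (simp add: E_def matrix_vector_mult_diff_rdistrib inner_diff_right b_def
        projected_empirical_quadratic_form[OF G Y y])
  have [measurable]: "X k \<in> borel_measurable M" if "k \<in> {1..n}" for k
    using ind that by (auto simp: indep_vars_def)
  have [measurable]: "orth_proj Y \<in> borel_measurable borel" by (rule borel_measurable_orth_proj[OF sY])
  show "{\<omega> \<in> space M. \<psi> * a \<le> s * (y \<bullet> (E \<omega> *v y))} \<in> sets M"
    unfolding form by measurable
  from projected_gaussian_tail[OF ind law sY iso b \<psi>(2) _ _ s n real_irreducible_dim_pos[OF Y]]
  show "\<P>(\<omega> in M. \<psi> * a \<le> s * (y \<bullet> (E \<omega> *v y)))
      \<le> exp (- (real n * real (dim Y) * (x * (1 + a) + ln (1 - 2 * x) / 2)))"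
    if "0 \<le> x" "2 * x < 1"
    unfolding form using that by blast
qed

text \<open>A union bound over a net: near an extremal eigenvector in the commutant orbit there is a net point at
  which the quadratic form is large. The event \<open>B\<close> is the union of the corresponding tail events.\<close>

lemma (in prob_space) irreducible_deviation_bound:
  fixes G :: "('p::finite \<Rightarrow> 'p) set" and \<Sigma> :: "real ^ 'p ^ 'p" and X :: "nat \<Rightarrow> 'a \<Rightarrow> real ^ 'p" and n :: nat
  defines "E \<omega> \<equiv> group_projection G (empirical_covariance n (\<lambda>k. X k \<omega>)) - \<Sigma>"
  assumes G: "subgroup G (BijGroup UNIV)" and \<Sigma>: "covariance_matrix \<Sigma>" "\<Sigma> \<in> fixed_point_subspace G"
    and \<psi>: "\<psi> = spectral_norm \<Sigma>"
    and ind: "indep_vars (\<lambda>_. borel) X {1..n}"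
    and law: "\<forall>k\<in>{1..n}. gaussian_law \<Sigma> (distr M borel (X k))"
    and \<delta>: "0 < \<delta>" "\<delta> \<le> 8 * \<psi>"
    and U: "real_irreducible G U" and u: "u \<in> U" "u \<noteq> 0"
    and large: "real (dim (commutant_orbit G u)) \<le> real n * real (dim U) * (\<delta> / (8 * \<psi>))\<^sup>2"
  obtains B where "B \<in> sets M" "prob B \<le> exp (- (real n * real (dim U) * \<delta>\<^sup>2 / (128 * \<psi>\<^sup>2)))"
    "\<And>\<omega> x l. \<omega> \<in> space M \<Longrightarrow> x \<in> commutant_orbit G u \<Longrightarrow> x \<noteq> 0 \<Longrightarrow> E \<omega> *v x = l *\<^sub>R x \<Longrightarrow>
       \<bar>l\<bar> = spectral_norm (E \<omega>) \<Longrightarrow> \<delta> \<le> spectral_norm (E \<omega>) \<Longrightarrow> \<omega> \<in> B"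
proof -
  let ?H = "commutant_orbit G u"
  define \<tau> where "\<tau> = \<delta> / (8 * \<psi>)"
  define K where "K = real n * real (dim U)"
  have \<psi>0: "0 < \<psi>" using \<delta> by linarith
  have \<tau>: "0 < \<tau>" "\<tau> \<le> 1" using \<delta> \<psi>0 by (auto simp: \<tau>_def field_simps)
  have \<delta>_eq: "\<delta> = 8 * \<psi> * \<tau>" using \<psi>0 by (simp add: \<tau>_def)
  have H: "subspace ?H" by (rule subspace_commutant_orbit)
  have "u \<in> ?H" using commutant_orbitI[of "\<lambda>x. x" G u] by (simp add: equivariant_def linear_id[unfolded id_def])
  then have r0: "dim ?H \<noteq> 0" using u(2) dim_eq_0[of ?H] by auto
  have K\<tau>: "real (dim ?H) \<le> K * \<tau>\<^sup>2" using large by (simp add: K_def \<tau>_def)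
  have n: "0 < n" using K\<tau> r0 by (cases n) (auto simp: K_def)
  have K0: "0 \<le> K" by (simp add: K_def)
  have goal_exp: "K * \<tau>\<^sup>2 / 2 = real n * real (dim U) * \<delta>\<^sup>2 / (128 * \<psi>\<^sup>2)"
    using \<psi>0 by (simp add: K_def \<tau>_def power_divide power_mult_distrib)
  have tail: "{\<omega> \<in> space M. \<psi> * a \<le> s * (y \<bullet> (E \<omega> *v y))} \<in> sets M"
    "0 \<le> x \<Longrightarrow> 2 * x < 1 \<Longrightarrow> \<P>(\<omega> in M. \<psi> * a \<le> s * (y \<bullet> (E \<omega> *v y)))
        \<le> exp (- (K * (x * (1 + a) + ln (1 - 2 * x) / 2)))"
    if y: "y \<in> ?H" "norm y = 1" and s: "s = 1 \<or> s = - 1" for y s a x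
  proof -
    have "y \<noteq> 0" using y(2) by auto
    from commutant_orbit_irreducible[OF U u(1) y(1) this]
    obtain Y where Y: "real_irreducible G Y" "y \<in> Y" "dim Y = dim U" .
    show "{\<omega> \<in> space M. \<psi> * a \<le> s * (y \<bullet> (E \<omega> *v y))} \<in> sets M"
      unfolding E_def by (rule projected_quadratic_form_tail(1)[OF G \<Sigma> \<psi> \<psi>0 ind law Y(1,2) y(2) n s])
    show "\<P>(\<omega> in M. \<psi> * a \<le> s * (y \<bullet> (E \<omega> *v y)))
        \<le> exp (- (K * (x * (1 + a) + ln (1 - 2 * x) / 2)))" if "0 \<le> x" "2 * x < 1"
      using projected_quadratic_form_tail(2)[OF G \<Sigma> \<psi> \<psi>0 ind law Y(1,2) y(2) n s that, of a]
      unfolding E_def K_def Y(3) .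
  qed
  have lower: "- \<psi> * (w \<bullet> w) \<le> w \<bullet> (E \<omega> *v w)" if w: "w \<in> ?H" for w \<omega>
  proof (cases "w = 0")
    case False
    from commutant_orbit_irreducible[OF U u(1) w this]
    obtain Y where Y: "real_irreducible G Y" "w \<in> Y" .
    let ?v = "(1 / norm w) *\<^sub>R w" and ?P = "group_projection G (empirical_covariance n (\<lambda>k. X k \<omega>))"
    have "?v \<in> Y" using Y real_irreducible_subspace subspace_scale by blast
    moreover have "norm ?v = 1" using False by simp
    ultimately have "0 \<le> ?v \<bullet> (?P *v ?v)"
      by (simp only: projected_empirical_quadratic_form[OF G Y(1)]) (simp add: sum_nonneg)
    moreover have "w \<bullet> (?P *v w) = (norm w)\<^sup>2 * (?v \<bullet> (?P *v ?v))"
      using False by (simp add: matrix_vector_mult_scaleR power2_eq_square)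
    ultimately have "0 \<le> w \<bullet> (?P *v w)" by (metis mult_nonneg_nonneg zero_le_power2)
    moreover have "w \<bullet> (\<Sigma> *v w) \<le> \<psi> * (w \<bullet> w)"
      using quadratic_form_le_spectral_norm[of w \<Sigma>] by (simp add: \<psi>)
    ultimately show ?thesis by (simp add: E_def matrix_vector_mult_diff_rdistrib inner_diff_right)
  qed simp
  have sym: "transpose (E \<omega>) = E \<omega>" for \<omega>
    using \<Sigma>(1) by (simp add: E_def transpose_minus covariance_matrix_def
        transpose_group_projection[OF G transpose_empirical_covariance])
  obtain N where N: "finite N" "N \<subseteq> ?H \<inter> sphere 0 1" "real (card N) \<le> (1 + 2 / (1 / 3)) ^ dim ?H"
    "\<And>x. x \<in> ?H \<Longrightarrow> norm x = 1 \<Longrightarrow> \<exists>y\<in>N. dist x y < 1 / 3"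
    using sphere_net_exists[OF H, of "1 / 3"] by auto
  have cardN: "real (card N) \<le> 7 ^ dim ?H" using N(3) by simp
  have NH: "y \<in> ?H" "norm y = 1" if "y \<in> N" for y using N(2) that by auto
  have near: "\<exists>y\<in>N. \<exists>w c. w \<in> ?H \<and> 289 / 324 \<le> c \<and> c \<le> 1 \<and> w \<bullet> w = 1 - c \<and>
      y \<bullet> (E \<omega> *v y) = c * l + w \<bullet> (E \<omega> *v w)"
    if x: "x \<in> ?H" "x \<noteq> 0" "E \<omega> *v x = l *\<^sub>R x" for \<omega> x l
  proof -
    let ?x = "(1 / norm x) *\<^sub>R x"
    have x1: "?x \<in> ?H" "norm ?x = 1" "E \<omega> *v ?x = l *\<^sub>R ?x"
      using x subspace_scale[OF H] by (auto simp: matrix_vector_mult_scaleR)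
    obtain y where y: "y \<in> N" "dist ?x y < 1 / 3" using N(4)[OF x1(1,2)] by blast
    show ?thesis
      using quadratic_form_near_eigenvector[OF sym H x1 NH[OF y(1)] y(2)] y(1) by metis
  qed
  \<comment> \<open>up to \<open>\<psi>\<close> eigenvalues of both signs occur; above, positivity on \<open>H\<close> excludes negative ones
    and improves the estimate of the remainder \<open>w\<close>\<close>
  show ?thesis
  proof (cases "\<delta> \<le> \<psi>")
    case True
    then have \<tau>8: "\<tau> \<le> 1 / 8" using \<psi>0 by (simp add: \<tau>_def field_simps)
    define a where "a = 508 / 81 * \<tau>"
    define x where "x = a / (2 * (1 + a))"
    note x = two_sided_exponent[OF \<tau>(1) \<tau>8, folded a_def, folded x_def]
    have \<psi>a: "\<psi> * a = 127 / 162 * \<delta>" unfolding a_def \<delta>_eq by simp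
    define A where "A = (\<lambda>(y, s). {\<omega> \<in> space M. \<psi> * a \<le> s * (y \<bullet> (E \<omega> *v y))})"
    let ?I = "N \<times> {1, - 1 :: real}"
    have A: "A p \<in> sets M" "prob (A p) \<le> exp (- (K * (x * (1 + a) + ln (1 - 2 * x) / 2)))" if "p \<in> ?I" for p
    proof -
      obtain y s where p: "p = (y, s)" and y: "y \<in> N" and s: "s = 1 \<or> s = - 1" using \<open>p \<in> ?I\<close> by auto
      have Ap: "A p = {\<omega> \<in> space M. \<psi> * a \<le> s * (y \<bullet> (E \<omega> *v y))}" by (simp add: A_def p)
      show "A p \<in> sets M" unfolding Ap by (rule tail(1)[OF NH[OF y] s])
      show "prob (A p) \<le> exp (- (K * (x * (1 + a) + ln (1 - 2 * x) / 2)))"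
        unfolding Ap by (rule tail(2)[OF NH[OF y] s x(1,2)])
    qed
    define B where "B = (\<Union>p\<in>?I. A p)"
    have fin: "finite ?I" using N(1) by simp
    have "prob B \<le> (\<Sum>p\<in>?I. prob (A p))"
      unfolding B_def by (rule finite_measure_subadditive_finite[OF fin]) (use A(1) in blast)
    also have "\<dots> \<le> (\<Sum>p\<in>?I. exp (- (K * (x * (1 + a) + ln (1 - 2 * x) / 2))))"
      by (intro sum_mono A(2))
    also have "\<dots> = exp (ln 2) * real (card N) * exp (- (K * (x * (1 + a) + ln (1 - 2 * x) / 2)))"
      by (simp add: card_cartesian_product)
    also have "\<dots> \<le> exp (- (K * \<tau>\<^sup>2 / 2))"
      by (rule card_net_exponent[OF cardN K\<tau> x(3) _ r0 K0]) simp
    finally have "prob B \<le> exp (- (K * \<tau>\<^sup>2 / 2))" .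
    moreover have "B \<in> sets M" unfolding B_def by (rule sets.finite_UN[OF fin A(1)])
    moreover have "\<omega> \<in> B" if \<omega>: "\<omega> \<in> space M" and z: "z \<in> ?H" "z \<noteq> 0" "E \<omega> *v z = l *\<^sub>R z"
      and l: "\<bar>l\<bar> = spectral_norm (E \<omega>)" "\<delta> \<le> spectral_norm (E \<omega>)" for \<omega> z l
    proof -
      let ?L = "spectral_norm (E \<omega>)"
      obtain y w c where y: "y \<in> N" and c: "289 / 324 \<le> c" "c \<le> 1" "w \<bullet> w = 1 - c"
        and form: "y \<bullet> (E \<omega> *v y) = c * l + w \<bullet> (E \<omega> *v w)"
        using near[OF z] by (elim bexE exE conjE) (rule that)
      have w: "\<bar>w \<bullet> (E \<omega> *v w)\<bar> \<le> ?L * (1 - c)"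
        using quadratic_form_le_spectral_norm[of w "E \<omega>"] c(3) by simp
      have "127 / 162 * \<delta> \<le> (2 * c - 1) * ?L"
        using c(1) l(2) \<delta>(1) by (intro mult_mono) auto
      then have L: "\<psi> * a \<le> c * ?L - ?L * (1 - c)" by (simp add: \<psi>a algebra_simps)
      from l(1) consider "l = ?L" | "l = - ?L" by linarith
      then have "\<exists>s\<in>{1, - 1}. \<psi> * a \<le> s * (y \<bullet> (E \<omega> *v y))"
      proof cases
        case 1 then show ?thesis using L w form by auto
      next
        case 2 then show ?thesis using L w form by auto
      qed
      then show ?thesis unfolding B_def A_def using y \<omega> by auto
    qed
    ultimately show ?thesis using that goal_exp by metis
  next
    case False
    then have \<tau>8: "1 / 8 \<le> \<tau>" using \<psi>0 by (simp add: \<tau>_def field_simps)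
    define a where "a = 289 / 324 * (1 + 8 * \<tau>) - 1"
    obtain x where x: "0 \<le> x" "2 * x < 1" "\<tau>\<^sup>2 * (1 / 2 + ln 7) \<le> x * (1 + a) + ln (1 - 2 * x) / 2"
      using upper_exponent[OF \<tau>8 \<tau>(2)] by (auto simp: a_def)
    have \<psi>a: "\<psi> * a = 289 / 324 * (\<delta> + \<psi>) - \<psi>" by (simp add: a_def \<delta>_eq algebra_simps)
    define A where "A y = {\<omega> \<in> space M. \<psi> * a \<le> 1 * (y \<bullet> (E \<omega> *v y))}" for y
    have A: "A y \<in> sets M" "prob (A y) \<le> exp (- (K * (x * (1 + a) + ln (1 - 2 * x) / 2)))" if "y \<in> N" for y
      unfolding A_def by (rule tail(1)[OF NH[OF that]] tail(2)[OF NH[OF that] _ x(1,2)], simp)+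
    define B where "B = (\<Union>y\<in>N. A y)"
    have "prob B \<le> (\<Sum>y\<in>N. prob (A y))"
      unfolding B_def by (rule finite_measure_subadditive_finite[OF N(1)]) (use A(1) in blast)
    also have "\<dots> \<le> (\<Sum>y\<in>N. exp (- (K * (x * (1 + a) + ln (1 - 2 * x) / 2))))"
      by (intro sum_mono A(2))
    also have "\<dots> = exp 0 * real (card N) * exp (- (K * (x * (1 + a) + ln (1 - 2 * x) / 2)))"
      by simp
    also have "\<dots> \<le> exp (- (K * \<tau>\<^sup>2 / 2))"
      by (rule card_net_exponent[OF cardN K\<tau> _ _ r0 K0]) (use x(3) in auto)
    finally have "prob B \<le> exp (- (K * \<tau>\<^sup>2 / 2))" .
    moreover have "B \<in> sets M" unfolding B_def by (rule sets.finite_UN[OF N(1) A(1)])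
    moreover have "\<omega> \<in> B" if \<omega>: "\<omega> \<in> space M" and z: "z \<in> ?H" "z \<noteq> 0" "E \<omega> *v z = l *\<^sub>R z"
      and l: "\<bar>l\<bar> = spectral_norm (E \<omega>)" "\<delta> \<le> spectral_norm (E \<omega>)" for \<omega> z l
    proof -
      let ?L = "spectral_norm (E \<omega>)"
      obtain y w c where y: "y \<in> N" and w: "w \<in> ?H" and c: "289 / 324 \<le> c" "c \<le> 1" "w \<bullet> w = 1 - c"
        and form: "y \<bullet> (E \<omega> *v y) = c * l + w \<bullet> (E \<omega> *v w)"
        using near[OF z] by (elim bexE exE conjE) (rule that)
      have "- \<psi> * (z \<bullet> z) \<le> l * (z \<bullet> z)" using lower[OF z(1), of \<omega>] z(3) by simp
      then have "- \<psi> \<le> l" by (rule mult_right_le_imp_le) (use z(2) in simp)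
      then have "l = ?L" using l False by linarith
      then have "\<delta> \<le> l" using l by simp
      then have "c * \<delta> \<le> c * l" using c(1) by (intro mult_left_mono) auto
      moreover have "289 / 324 * (\<delta> + \<psi>) \<le> c * (\<delta> + \<psi>)" using c(1) \<delta>(1) \<psi>0 by (intro mult_right_mono) auto
      moreover have "- \<psi> * (1 - c) \<le> w \<bullet> (E \<omega> *v w)" using lower[OF w, of \<omega>] c(3) by simp
      ultimately have "\<psi> * a \<le> 1 * (y \<bullet> (E \<omega> *v y))" unfolding \<psi>a form by (simp add: algebra_simps)
      then show ?thesis unfolding B_def A_def using y \<omega> by blast
    qed
    ultimately show ?thesis using that goal_exp by metis
  qed
qed

section \<open>The union over the active irreducibles\<close>

theorem theorem3p1:
  fixes G :: "('p::finite \<Rightarrow> 'p) set"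
    and \<Sigma> :: "real ^ 'p ^ 'p"
    and \<psi> \<delta> :: real
    and M :: "'w measure"
    and X :: "nat \<Rightarrow> 'w \<Rightarrow> real ^ 'p"
    and n :: nat
  assumes "subgroup G (BijGroup UNIV)"
    and "covariance_matrix \<Sigma>"
    and "\<Sigma> \<in> fixed_point_subspace G"
    and "\<psi> = spectral_norm \<Sigma>"
    and "prob_space M"
    and "prob_space.indep_vars M (\<lambda>_. borel) X {1..n}"
    and "\<forall>k\<in>{1..n}. gaussian_law \<Sigma> (distr M borel (X k))"
    and "0 < \<delta>"
    and "\<delta> \<le> 8 * \<psi>"
    and "(MAX i\<in>active_irreps G.
            64 * real (irrep_mult G i) * \<psi>\<^sup>2 / (real (irrep_dim i) * \<delta>\<^sup>2)) \<le> real n"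
  shows "\<P>(\<omega> in M. \<delta> \<le> spectral_norm
            (\<Sigma> - group_projection G (empirical_covariance n (\<lambda>k. X k \<omega>))))
          \<le> real (card (active_irreps G)) *
             exp (- (real n * (MIN i\<in>active_irreps G. real (irrep_dim i)) * \<delta>\<^sup>2)
                  / (128 * \<psi>\<^sup>2))"
proof -
  interpret prob_space M by fact
  note G = assms(1) and \<Sigma> = assms(2,3) and \<psi> = assms(4) and ind = assms(6) and law = assms(7) and \<delta> = assms(8,9)
  have \<psi>0: "0 < \<psi>" using \<delta> by linarith
  define E where "E \<omega> = group_projection G (empirical_covariance n (\<lambda>k. X k \<omega>)) - \<Sigma>" for \<omega>
  let ?I = "active_irreps G"
  have fin: "finite ?I" and ne: "?I \<noteq> {}" using active_irreps_finite_nonempty[OF G] by auto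
  let ?c = "exp (- (real n * (MIN i\<in>?I. real (irrep_dim i)) * \<delta>\<^sup>2) / (128 * \<psi>\<^sup>2))"
  define real_form where "real_form i U u \<longleftrightarrow> real_irreducible G U \<and> u \<in> U \<and> u \<noteq> 0 \<and>
      (\<exists>V\<in>i. V \<subseteq> complexification U)" for i U and u :: "real ^ 'p"
  \<comment> \<open>one real representation is chosen for each class in \<open>J\<close>; any other real representation with that
    class is reached from it by an intertwiner\<close>
  define J where "J = {i \<in> ?I. \<exists>U u. real_form i U u}"
  define covers where "covers u B \<longleftrightarrow> (\<forall>\<omega>\<in>space M. \<forall>x l. x \<in> commutant_orbit G u \<longrightarrow> x \<noteq> 0 \<longrightarrow> E \<omega> *v x = l *\<^sub>R x \<longrightarrow>
         \<bar>l\<bar> = spectral_norm (E \<omega>) \<longrightarrow> \<delta> \<le> spectral_norm (E \<omega>) \<longrightarrow> \<omega> \<in> B)" for u B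
  have "\<exists>B u U. real_form i U u \<and> B \<in> sets M \<and> prob B \<le> ?c \<and> covers u B" if i: "i \<in> J" for i
  proof -
    obtain U u V where Uu: "real_form i U u" and U: "real_irreducible G U" "u \<in> U" "u \<noteq> 0"
      and V: "V \<in> i" "V \<subseteq> complexification U" and iI: "i \<in> ?I"
      using i unfolding J_def real_form_def by blast
    note dims = commutant_orbit_dim_le[OF G U(1,2) iI V]
    have "irrep_dim i \<noteq> 0"
    proof
      assume "irrep_dim i = 0"
      then have "vec.dim V = 0" using irrep_dim_eq[OF iI V(1)] by simp
      then have "V \<subseteq> {0}" by simp
      then show False
        using irreducible_subrepD(1,3)[OF active_irreps_members(1)[OF iI V(1)]] vec.subspace_0 by blast
    qed
    then have m0: "0 < real (irrep_dim i)" by simp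
    have "64 * real (irrep_mult G i) * \<psi>\<^sup>2 / (real (irrep_dim i) * \<delta>\<^sup>2) \<le> real n"
      using fin iI assms(10) by (auto simp: Max_le_iff[OF finite_imageI[OF fin]] ne)
    then have s: "real (irrep_mult G i) \<le> real n * real (irrep_dim i) * (\<delta> / (8 * \<psi>))\<^sup>2"
      using m0 \<delta>(1) \<psi>0 by (simp add: field_simps power_divide power_mult_distrib)
    have "real (dim (commutant_orbit G u)) * real (irrep_dim i) \<le> real (irrep_mult G i) * real (dim U)"
      using dims(2) by (metis of_nat_le_iff of_nat_mult)
    also have "\<dots> \<le> (real n * real (irrep_dim i) * (\<delta> / (8 * \<psi>))\<^sup>2) * real (dim U)"
      using s by (rule mult_right_mono) simp
    finally have large: "real (dim (commutant_orbit G u)) \<le> real n * real (dim U) * (\<delta> / (8 * \<psi>))\<^sup>2"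
      using m0 by (simp add: mult_ac)
    obtain B where B: "B \<in> sets M" "prob B \<le> exp (- (real n * real (dim U) * \<delta>\<^sup>2 / (128 * \<psi>\<^sup>2)))"
      "\<And>\<omega> x l. \<omega> \<in> space M \<Longrightarrow> x \<in> commutant_orbit G u \<Longrightarrow> x \<noteq> 0 \<Longrightarrow> E \<omega> *v x = l *\<^sub>R x \<Longrightarrow>
         \<bar>l\<bar> = spectral_norm (E \<omega>) \<Longrightarrow> \<delta> \<le> spectral_norm (E \<omega>) \<Longrightarrow> \<omega> \<in> B"
      by (rule irreducible_deviation_bound[OF G \<Sigma> \<psi> ind law \<delta> U large, folded E_def], rule that)
    have "(MIN i\<in>?I. real (irrep_dim i)) \<le> real (irrep_dim i)" using fin iI by (intro Min_le) auto
    also have "\<dots> \<le> real (dim U)" using dims(1) by simp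
    finally have "real n * (MIN i\<in>?I. real (irrep_dim i)) * \<delta>\<^sup>2 / (128 * \<psi>\<^sup>2)
        \<le> real n * real (dim U) * \<delta>\<^sup>2 / (128 * \<psi>\<^sup>2)"
      by (intro divide_right_mono mult_right_mono mult_left_mono) auto
    then have "exp (- (real n * real (dim U) * \<delta>\<^sup>2 / (128 * \<psi>\<^sup>2))) \<le> ?c" by simp
    then have "prob B \<le> ?c" using B(2) by linarith
    moreover have "covers u B" unfolding covers_def using B(3) by blast
    ultimately show ?thesis using Uu B(1) by blast
  qed
  then obtain B u U where form: "\<And>i. i \<in> J \<Longrightarrow> real_form i (U i) (u i)"
    and B: "\<And>i. i \<in> J \<Longrightarrow> B i \<in> sets M" "\<And>i. i \<in> J \<Longrightarrow> prob (B i) \<le> ?c"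
    and cover: "\<And>i. i \<in> J \<Longrightarrow> covers (u i) (B i)"
    by metis
  have finJ: "finite J" using fin by (simp add: J_def)
  have "{\<omega> \<in> space M. \<delta> \<le> spectral_norm (\<Sigma> - group_projection G (empirical_covariance n (\<lambda>k. X k \<omega>)))}
      \<subseteq> (\<Union>i\<in>J. B i)"
  proof
    fix \<omega> assume "\<omega> \<in> {\<omega> \<in> space M. \<delta> \<le> spectral_norm (\<Sigma> - group_projection G (empirical_covariance n (\<lambda>k. X k \<omega>)))}"
    then have \<omega>: "\<omega> \<in> space M" "\<delta> \<le> spectral_norm (E \<omega>)"
      by (auto simp: E_def spectral_norm_minus_commute[of \<Sigma>])
    have P: "group_projection G (empirical_covariance n (\<lambda>k. X k \<omega>)) \<in> fixed_point_subspace G"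
      unfolding group_projection_eq[OF G] by (rule orth_proj_in[OF subspace_fixed_point_subspace[OF G]])
    have EW: "E \<omega> \<in> fixed_point_subspace G"
      unfolding E_def by (rule subspace_diff[OF subspace_fixed_point_subspace[OF G] P \<Sigma>(2)])
    have "transpose (E \<omega>) = E \<omega>"
      using \<Sigma>(1) by (simp add: E_def transpose_minus covariance_matrix_def
          transpose_group_projection[OF G transpose_empirical_covariance])
    then obtain x l where x: "x \<noteq> 0" "E \<omega> *v x = l *\<^sub>R x" "\<bar>l\<bar> = spectral_norm (E \<omega>)"
      using symmetric_spectral_eigenvalue by blast
    \<comment> \<open>the eigenspace contains a real irreducible representation, and so an eigenvector in the
      commutant orbit of the vector chosen for its class\<close>
    let ?S = "{v. E \<omega> *v v = l *\<^sub>R v}"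
    have "subspace ?S"
      by (auto simp: subspace_def matrix_vector_right_distrib matrix_vector_mult_scaleR scaleR_add_right)
    then have "real_invariant G ?S"
      using EW by (auto simp: real_invariant_def fixed_point_subspace_iff[OF G] equivariant_def matrix_vector_mult_scaleR)
    moreover have "?S \<noteq> {0}" using x by blast
    ultimately obtain U' where U': "real_irreducible G U'" "U' \<subseteq> ?S" by (rule real_irreducible_exists)
    obtain i V' where i: "i \<in> ?I" "V' \<in> i" "V' \<subseteq> complexification U'"
      using complexification_constituent_exists[OF G U'(1)] .
    obtain u' where "u' \<in> U'" "u' \<noteq> 0"
      using U'(1) subspace_0[OF real_irreducible_subspace[OF U'(1)]] by (auto simp: real_irreducible_def)
    then have "real_form i U' u'" unfolding real_form_def using U'(1) i by blast
    then have iJ: "i \<in> J" unfolding J_def using i(1) by blast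
    from form[OF iJ] obtain V where V: "real_irreducible G (U i)" "u i \<in> U i" "u i \<noteq> 0" "V \<in> i"
      "V \<subseteq> complexification (U i)"
      unfolding real_form_def by blast
    obtain f v where f: "linear f" "equivariant G f" "\<And>x. f x \<in> U'" "v \<in> U i" "f v \<noteq> 0"
      by (rule shared_constituent_intertwiner[OF G real_irreducible_subspace[OF V(1)] i(1) V(4,5) i(2,3)], rule that)
    have "f (u i) \<noteq> 0" using real_equivariant_kernel[OF V(1) f(1,2,4,5) V(2)] V(3) by blast
    moreover have "f (u i) \<in> commutant_orbit G (u i)" by (rule commutant_orbitI[OF f(1,2)])
    moreover have "E \<omega> *v f (u i) = l *\<^sub>R f (u i)" using f(3) U'(2) by blast
    ultimately show "\<omega> \<in> (\<Union>i\<in>J. B i)" using cover[OF iJ] \<omega> x(3) iJ unfolding covers_def by blast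
  qed
  then have "\<P>(\<omega> in M. \<delta> \<le> spectral_norm (\<Sigma> - group_projection G (empirical_covariance n (\<lambda>k. X k \<omega>))))
      \<le> prob (\<Union>i\<in>J. B i)"
    using finJ B(1) by (intro finite_measure_mono sets.finite_UN) auto
  also have "\<dots> \<le> (\<Sum>i\<in>J. prob (B i))"
    using finJ B(1) by (intro finite_measure_subadditive_finite) auto
  also have "\<dots> \<le> (\<Sum>i\<in>J. ?c)" by (intro sum_mono B(2))
  also have "\<dots> = real (card J) * ?c" by simp
  also have "\<dots> \<le> real (card ?I) * ?c"
    using card_mono[OF fin, of J] by (intro mult_right_mono) (auto simp: J_def)
  finally show ?thesis .
qed

end
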